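(* Let $G$ be an infinite compact abelian group with dual group $\varGamma$ and let $\varLambda \subset \varGamma$. If $L^1_{\varGamma\setminus\varLambda^{-1}}(G)$ is a rich subspace of $L^1(G)$, then the quotient space $C(G)/C_\varLambda(G)$ has the Daugavet property.
   Context: $\varGamma$ is the (discrete) group of continuous homomorphisms $G \to \mathbb T$, $\varLambda^{-1} = \{\gamma^{-1} : \gamma \in \varLambda\}$ where $\gamma^{-1} = \overline\gamma$; $m$ is the normalized Haar measure on $G$; $L^1(G) = L^1(G,m)$ and $C(G)$ (sup norm) consist of complex-valued functions. $\hat f(\gamma) = \int_G f\overline\gamma\,dm$. For $\varTheta\subset\varGamma$, $C_\varTheta(G)$ (resp. $L^1_\varTheta(G)$) is the set of $f$ in $C(G)$ (resp. $L^1(G)$) with $\hat f(\gamma) = 0$ for all $\gamma \in \varGamma\setminus\varTheta$. A Banach space $X$ has the Daugavet property if every bounded rank-one operator $T: X \to X$ satisfies $\|\mathrm{Id}+T\| = 1 + \|T\|$. ($L^1(G)$ has the Daugavet property.) If $X$ has the Daugavet property and $E$ is a Banach space, a bounded linear operator $T: X\to E$ is narrow if for all $x,y \in S_X$ (unit sphere), $x^*\in X^*$, $\varepsilon>0$ there is $z \in S_X$ with $\|T(y-z)\| + |x^*(y-z)| \le \varepsilon$ and $\|x+z\| \ge 2-\varepsilon$. A closed subspace $Y$ of $X$ is rich if the quotient map $X \to X/Y$ is narrow. *)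

theory Defs
  imports "HOL-Analysis.Analysis"
begin

section \<open>Complex normed spaces on a carrier\<close>

text \<open>
  The spaces below are quotients of function spaces by subspaces that depend on variables of the
  statement, so they cannot be types of class \<^class>\<open>banach\<close> (which moreover has real
  scalars only). They are therefore given by an explicit carrier with its operations.
\<close>

record 'v normed_struct =
  carrier :: "'v set"
  vadd :: "'v \<Rightarrow> 'v \<Rightarrow> 'v"  (infixl \<open>\<oplus>\<index>\<close> 65)
  vzero :: 'v  (\<open>\<zero>\<index>\<close>)
  vscale :: "complex \<Rightarrow> 'v \<Rightarrow> 'v"  (infixr \<open>\<odot>\<index>\<close> 75)
  vnorm :: "'v \<Rightarrow> real"  (\<open>\<parallel>_\<parallel>\<index>\<close>)

definition vdiff :: "('v, 'm) normed_struct_scheme \<Rightarrow> 'v \<Rightarrow> 'v \<Rightarrow> 'v"  (infixl \<open>\<ominus>\<index>\<close> 65)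
  where "x \<ominus>\<^bsub>X\<^esub> y = x \<oplus>\<^bsub>X\<^esub> ((-1) \<odot>\<^bsub>X\<^esub> y)"

locale complex_normed_space =
  fixes X :: "('v, 'm) normed_struct_scheme" (structure)
  assumes add_closed: "x \<in> carrier X \<Longrightarrow> y \<in> carrier X \<Longrightarrow> x \<oplus> y \<in> carrier X"
    and zero_closed: "\<zero> \<in> carrier X"
    and scale_closed: "x \<in> carrier X \<Longrightarrow> c \<odot> x \<in> carrier X"
    and add_assoc: "x \<in> carrier X \<Longrightarrow> y \<in> carrier X \<Longrightarrow> z \<in> carrier X
          \<Longrightarrow> (x \<oplus> y) \<oplus> z = x \<oplus> (y \<oplus> z)"
    and add_commute: "x \<in> carrier X \<Longrightarrow> y \<in> carrier X \<Longrightarrow> x \<oplus> y = y \<oplus> x"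
    and add_zero: "x \<in> carrier X \<Longrightarrow> x \<oplus> \<zero> = x"
    and diff_self: "x \<in> carrier X \<Longrightarrow> x \<ominus> x = \<zero>"
    and scale_add_right: "x \<in> carrier X \<Longrightarrow> y \<in> carrier X
          \<Longrightarrow> c \<odot> (x \<oplus> y) = (c \<odot> x) \<oplus> (c \<odot> y)"
    and scale_add_left: "x \<in> carrier X \<Longrightarrow> (c + d) \<odot> x = (c \<odot> x) \<oplus> (d \<odot> x)"
    and scale_scale: "x \<in> carrier X \<Longrightarrow> c \<odot> (d \<odot> x) = (c * d) \<odot> x"
    and scale_one: "x \<in> carrier X \<Longrightarrow> 1 \<odot> x = x"
    and norm_nonneg: "x \<in> carrier X \<Longrightarrow> 0 \<le> \<parallel>x\<parallel>"
    and norm_eq_0_iff: "x \<in> carrier X \<Longrightarrow> \<parallel>x\<parallel> = 0 \<longleftrightarrow> x = \<zero>"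
    and norm_triangle: "x \<in> carrier X \<Longrightarrow> y \<in> carrier X \<Longrightarrow> \<parallel>x \<oplus> y\<parallel> \<le> \<parallel>x\<parallel> + \<parallel>y\<parallel>"
    and norm_scale: "x \<in> carrier X \<Longrightarrow> \<parallel>c \<odot> x\<parallel> = cmod c * \<parallel>x\<parallel>"

locale complex_banach_space = complex_normed_space +
  assumes complete:
    "(\<And>n. s n \<in> carrier X) \<Longrightarrow>
     (\<forall>\<epsilon>>0. \<exists>N::nat. \<forall>i\<ge>N. \<forall>j\<ge>N. \<parallel>s i \<ominus> s j\<parallel> < \<epsilon>) \<Longrightarrow>
     \<exists>x\<in>carrier X. (\<lambda>n. \<parallel>s n \<ominus> x\<parallel>) \<longlonglongrightarrow> 0"

definition sphere_of :: "('v, 'm) normed_struct_scheme \<Rightarrow> 'v set"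
  where "sphere_of X = {x \<in> carrier X. \<parallel>x\<parallel>\<^bsub>X\<^esub> = 1}"

definition closed_subspace :: "('v, 'm) normed_struct_scheme \<Rightarrow> 'v set \<Rightarrow> bool"
  where "closed_subspace X Y \<longleftrightarrow>
    Y \<subseteq> carrier X \<and> \<zero>\<^bsub>X\<^esub> \<in> Y \<and>
    (\<forall>x\<in>Y. \<forall>y\<in>Y. x \<oplus>\<^bsub>X\<^esub> y \<in> Y) \<and> (\<forall>c. \<forall>x\<in>Y. c \<odot>\<^bsub>X\<^esub> x \<in> Y) \<and>
    (\<forall>s x. (\<forall>n. s n \<in> Y) \<and> x \<in> carrier X \<and> (\<lambda>n. \<parallel>s n \<ominus>\<^bsub>X\<^esub> x\<parallel>\<^bsub>X\<^esub>) \<longlonglongrightarrow> 0 \<longrightarrow> x \<in> Y)"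

definition coset_of :: "('v, 'm) normed_struct_scheme \<Rightarrow> 'v set \<Rightarrow> 'v \<Rightarrow> 'v set"
  where "coset_of X Y x = (\<lambda>y. x \<oplus>\<^bsub>X\<^esub> y) ` Y"

text \<open>
  The vectors of \<open>X / Y\<close> are the cosets \<open>x + Y\<close>, and \<open>coset_of X Y\<close> is the quotient map. The
  summand from \<open>Y\<close> in the scalar multiple makes \<open>0 \<odot> A\<close> equal to \<open>Y\<close> rather than to \<open>{0}\<close>.
  The construction is also used for a seminorm on \<open>X\<close>, with \<open>Y\<close> its kernel.
\<close>

definition quotient_space ::
    "('v, 'm) normed_struct_scheme \<Rightarrow> 'v set \<Rightarrow> 'v set normed_struct"
  where "quotient_space X Y =
    \<lparr>carrier = coset_of X Y ` carrier X,
     vadd = (\<lambda>A B. {a \<oplus>\<^bsub>X\<^esub> b | a b. a \<in> A \<and> b \<in> B}),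
     vzero = Y,
     vscale = (\<lambda>c A. {(c \<odot>\<^bsub>X\<^esub> a) \<oplus>\<^bsub>X\<^esub> y | a y. a \<in> A \<and> y \<in> Y}),
     vnorm = (\<lambda>A. INF a\<in>A. \<parallel>a\<parallel>\<^bsub>X\<^esub>)\<rparr>"

section \<open>Operators, the Daugavet property, narrow operators and rich subspaces\<close>

definition bounded_operator ::
    "('v, 'm) normed_struct_scheme \<Rightarrow> ('w, 'n) normed_struct_scheme \<Rightarrow> ('v \<Rightarrow> 'w) \<Rightarrow> bool"
  where "bounded_operator X E T \<longleftrightarrow>
    (\<forall>x\<in>carrier X. T x \<in> carrier E) \<and>
    (\<forall>x\<in>carrier X. \<forall>y\<in>carrier X. T (x \<oplus>\<^bsub>X\<^esub> y) = T x \<oplus>\<^bsub>E\<^esub> T y) \<and>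
    (\<forall>c. \<forall>x\<in>carrier X. T (c \<odot>\<^bsub>X\<^esub> x) = c \<odot>\<^bsub>E\<^esub> T x) \<and>
    (\<exists>K. \<forall>x\<in>carrier X. \<parallel>T x\<parallel>\<^bsub>E\<^esub> \<le> K * \<parallel>x\<parallel>\<^bsub>X\<^esub>)"

definition operator_norm ::
    "('v, 'm) normed_struct_scheme \<Rightarrow> ('w, 'n) normed_struct_scheme \<Rightarrow> ('v \<Rightarrow> 'w) \<Rightarrow> real"
  where "operator_norm X E T = (SUP x\<in>{x \<in> carrier X. \<parallel>x\<parallel>\<^bsub>X\<^esub> \<le> 1}. \<parallel>T x\<parallel>\<^bsub>E\<^esub>)"

definition rank_one ::
    "('v, 'm) normed_struct_scheme \<Rightarrow> ('w, 'n) normed_struct_scheme \<Rightarrow> ('v \<Rightarrow> 'w) \<Rightarrow> bool"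
  where "rank_one X E T \<longleftrightarrow>
    (\<exists>e\<in>carrier E. e \<noteq> \<zero>\<^bsub>E\<^esub> \<and> T ` carrier X = {c \<odot>\<^bsub>E\<^esub> e | c. True})"

definition daugavet_property :: "('v, 'm) normed_struct_scheme \<Rightarrow> bool"
  where "daugavet_property X \<longleftrightarrow> complex_banach_space X \<and>
    (\<forall>T. bounded_operator X X T \<and> rank_one X X T \<longrightarrow>
      operator_norm X X (\<lambda>x. x \<oplus>\<^bsub>X\<^esub> T x) = 1 + operator_norm X X T)"

definition scalar_space :: "complex normed_struct"
  where "scalar_space =
    \<lparr>carrier = UNIV, vadd = (+), vzero = 0, vscale = (*), vnorm = cmod\<rparr>"

text \<open>
  Narrow operators are usually considered only on a space \<open>X\<close> with the Daugavet property and
  with values in a Banach space \<open>E\<close>; these standing conditions are not part of the definition.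
\<close>

definition narrow ::
    "('v, 'm) normed_struct_scheme \<Rightarrow> ('w, 'n) normed_struct_scheme \<Rightarrow> ('v \<Rightarrow> 'w) \<Rightarrow> bool"
  where "narrow X E T \<longleftrightarrow> bounded_operator X E T \<and>
    (\<forall>x\<in>sphere_of X. \<forall>y\<in>sphere_of X. \<forall>\<phi>. bounded_operator X scalar_space \<phi> \<longrightarrow>
      (\<forall>\<epsilon>>0. \<exists>z\<in>sphere_of X.
        \<parallel>T (y \<ominus>\<^bsub>X\<^esub> z)\<parallel>\<^bsub>E\<^esub> + cmod (\<phi> (y \<ominus>\<^bsub>X\<^esub> z)) \<le> \<epsilon> \<and> \<parallel>x \<oplus>\<^bsub>X\<^esub> z\<parallel>\<^bsub>X\<^esub> \<ge> 2 - \<epsilon>))"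

definition rich :: "('v, 'm) normed_struct_scheme \<Rightarrow> 'v set \<Rightarrow> bool"
  where "rich X Y \<longleftrightarrow>
    closed_subspace X Y \<and> narrow X (quotient_space X Y) (coset_of X Y)"

section \<open>Harmonic analysis on a compact abelian group, written additively\<close>

text \<open>
  Regularity is part of the definition: on a non-metrizable compact group a Borel measure need
  not be regular.
\<close>

definition normalized_haar_measure :: "'g::topological_ab_group_add measure \<Rightarrow> bool"
  where "normalized_haar_measure m \<longleftrightarrow>
    sets m = sets borel \<and> emeasure m UNIV = 1 \<and>
    (\<forall>A\<in>sets borel. \<forall>x. emeasure m ((\<lambda>y. x + y) ` A) = emeasure m A) \<and>
    (\<forall>A\<in>sets borel. emeasure m A = (INF U\<in>{U. open U \<and> A \<subseteq> U}. emeasure m U)) \<and>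
    (\<forall>A\<in>sets borel. emeasure m A = (SUP K\<in>{K. compact K \<and> K \<subseteq> A}. emeasure m K))"

definition dual_group :: "('g::topological_ab_group_add \<Rightarrow> complex) set"
  where "dual_group = {\<gamma>. continuous_on UNIV \<gamma> \<and> (\<forall>x. cmod (\<gamma> x) = 1) \<and>
    (\<forall>x y. \<gamma> (x + y) = \<gamma> x * \<gamma> y)}"

definition inverse_characters :: "('g \<Rightarrow> complex) set \<Rightarrow> ('g \<Rightarrow> complex) set"
  where "inverse_characters \<Lambda> = (\<lambda>\<gamma> x. cnj (\<gamma> x)) ` \<Lambda>"

definition fourier_coeff :: "'g measure \<Rightarrow> ('g \<Rightarrow> complex) \<Rightarrow> ('g \<Rightarrow> complex) \<Rightarrow> complex"
  where "fourier_coeff m f \<gamma> = (LINT x|m. f x * cnj (\<gamma> x))"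

definition C_space :: "('g::topological_space \<Rightarrow> complex) normed_struct"
  where "C_space =
    \<lparr>carrier = {f. continuous_on UNIV f},
     vadd = (\<lambda>f g x. f x + g x), vzero = (\<lambda>x. 0), vscale = (\<lambda>c f x. c * f x),
     vnorm = (\<lambda>f. SUP x. cmod (f x))\<rparr>"

definition integrable_functions :: "'g measure \<Rightarrow> ('g \<Rightarrow> complex) normed_struct"
  where "integrable_functions m =
    \<lparr>carrier = {f. integrable m f},
     vadd = (\<lambda>f g x. f x + g x), vzero = (\<lambda>x. 0), vscale = (\<lambda>c f x. c * f x),
     vnorm = (\<lambda>f. LINT x|m. cmod (f x))\<rparr>"

definition null_functions :: "'g measure \<Rightarrow> ('g \<Rightarrow> complex) set"
  where "null_functions m = {f. integrable m f \<and> (AE x in m. f x = 0)}"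

definition L1_space :: "'g measure \<Rightarrow> ('g \<Rightarrow> complex) set normed_struct"
  where "L1_space m = quotient_space (integrable_functions m) (null_functions m)"

lemma L1_class_eq:
  assumes "integrable m f"
  shows "coset_of (integrable_functions m) (null_functions m) f =
    {g. integrable m g \<and> (AE x in m. g x = f x)}"
proof (intro equalityI subsetI)
  fix g assume "g \<in> coset_of (integrable_functions m) (null_functions m) f"
  then show "g \<in> {g. integrable m g \<and> (AE x in m. g x = f x)}"
    using assms by (auto simp: coset_of_def integrable_functions_def null_functions_def)
next
  fix g assume g: "g \<in> {g. integrable m g \<and> (AE x in m. g x = f x)}"
  then have "(\<lambda>x. g x - f x) \<in> null_functions m"
    using assms by (auto simp: null_functions_def)
  moreover have "g = (\<lambda>x. f x + (g x - f x))"
    by auto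
  ultimately show "g \<in> coset_of (integrable_functions m) (null_functions m) f"
    by (auto simp: coset_of_def integrable_functions_def image_iff intro!: bexI)
qed

text \<open>The quotient norm is the usual \<open>L\<^sup>1\<close> norm of any representative.\<close>

lemma L1_norm_class:
  assumes "integrable m f"
  shows "\<parallel>coset_of (integrable_functions m) (null_functions m) f\<parallel>\<^bsub>L1_space m\<^esub> =
    (LINT x|m. cmod (f x))"
proof -
  let ?A = "{g. integrable m g \<and> (AE x in m. g x = f x)}"
  have "(LINT x|m. cmod (g x)) = (LINT x|m. cmod (f x))" if "g \<in> ?A" for g
    using that assms by (intro integral_cong_AE) auto
  then have "(\<lambda>g. LINT x|m. cmod (g x)) ` ?A = (\<lambda>g. LINT x|m. cmod (f x)) ` ?A"
    by (rule image_cong[OF refl])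
  also have "\<dots> = {LINT x|m. cmod (f x)}"
    using assms by auto
  finally have "(INF g\<in>?A. LINT x|m. cmod (g x)) = (LINT x|m. cmod (f x))"
    by simp
  then show ?thesis
    unfolding L1_space_def L1_class_eq[OF assms]
    by (simp add: quotient_space_def integrable_functions_def)
qed

definition C_spectral ::
    "'g::topological_ab_group_add measure \<Rightarrow> ('g \<Rightarrow> complex) set \<Rightarrow> ('g \<Rightarrow> complex) set"
  where "C_spectral m \<Theta> =
    {f \<in> carrier C_space. \<forall>\<gamma>\<in>dual_group - \<Theta>. fourier_coeff m f \<gamma> = 0}"

definition L1_spectral ::
    "'g::topological_ab_group_add measure \<Rightarrow> ('g \<Rightarrow> complex) set \<Rightarrow> ('g \<Rightarrow> complex) set set"
  where "L1_spectral m \<Theta> =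
    {F \<in> carrier (L1_space m). \<forall>\<gamma>\<in>dual_group - \<Theta>. \<forall>f\<in>F. fourier_coeff m f \<gamma> = 0}"

end

theory Submission
  imports Defs
begin

text \<open>
  By weak-star density of \<open>L1\<close> functions with spectrum off \<open>\<Lambda>\<inverse>\<close> in the annihilator of \<open>C_\<Lambda>\<close>, the
  norm of a class \<open>[e]\<close> in \<open>C / C_\<Lambda>\<close> is almost attained at a function \<open>g\<close> of this kind. Richness allows
  \<open>g\<close> to be replaced, without changing \<open>\<integral> e g\<close> or the distance to these functions by much, by a function \<open>z\<close>
  concentrated on a set of small measure. For a functional \<open>\<Phi>\<close> on \<open>C / C_\<Lambda>\<close>, such a \<open>z\<close> is almost
  disjoint from the measure representing \<open>\<Phi>\<close>, so that some \<open>y\<close> in the unit ball of \<open>C\<close> almost norms both \<open>\<Phi>\<close>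
  and \<open>z\<close>; testing \<open>[y] + \<Phi>(y) [e]\<close> against \<open>z\<close> gives the Daugavet equation.

  That a continuous function is determined by its Fourier coefficients is needed to see that these functions
  annihilate \<open>C_\<Lambda>\<close>. It is proved by splitting convolution idempotents down to minimal ones, which are
  multiples of characters.
\<close>

section \<open>Integration against the Haar measure\<close>

text \<open>Functions are paired by \<integral> f g without conjugation, so that \<integral> g
  \<gamma> is the Fourier coefficient of g at the inverse of \<gamma>. This is why the annihilator
  of C_\<Lambda> in L1 is the space with spectrum off the inverses. The equation needs two large
  terms at once: \<integral> y z near 1 and \<Phi>(y) \<integral> e z near the norm of \<Phi>. One y
  can serve both only if z lives where \<Phi> has almost no mass. Small measure ensures this for the
  absolutely continuous part of \<Phi>, but a singular part can sit on a null set, and a set almost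
  carrying it has to be cut out of the support of z by hand. The group need not be metrizable. The
  functional \<Phi> is never turned into a measure, and iterated integrals are compared through
  uniform approximation by finite sums; regularity of m enters through compact sets, open sets and
  Urysohn functions between them. Since z is only close to the annihilator, its distance to it must
  be small relative to the norm of \<Phi>, which fixes the order in which the constants are
  chosen.\<close>

lemma tube_metric:
  fixes F :: "'a::topological_space \<times> 'b::topological_space \<Rightarrow> 'c::metric_space"
  assumes "compact (UNIV :: 'a set)" and F: "continuous_on UNIV F" and "0 < e"
  obtains V where "open V" "y0 \<in> V" "\<And>x y. y \<in> V \<Longrightarrow> dist (F (x, y)) (F (x, y0)) < e"
proof -
  \<comment> \<open>Swapping the factors puts the compact one where the tube lemma expects it;
    \<open>e / 2\<close> turns its weak inequality into a strict one.\<close>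
  have "continuous_on (UNIV \<times> UNIV) (F \<circ> prod.swap)"
    using continuous_on_compose[OF continuous_on_swap] continuous_on_subset[OF F subset_UNIV] by auto
  from continuous_on_prod_compactE[OF this assms(1) UNIV_I half_gt_zero[OF \<open>0 < e\<close>], of y0]
  obtain V where V: "y0 \<in> V" "open V" "\<forall>y\<in>V \<inter> UNIV. \<forall>x\<in>UNIV. dist ((F \<circ> prod.swap) (y, x)) ((F \<circ> prod.swap) (y0, x)) \<le> e / 2"
    by blast
  show thesis
  proof (rule that[OF V(2,1)])
    fix x y assume "y \<in> V"
    then have "dist (F (x, y)) (F (x, y0)) \<le> e / 2" using V(3) by auto
    then show "dist (F (x, y)) (F (x, y0)) < e" using \<open>0 < e\<close> by linarith
  qed
qed

text \<open>Makes a finite open cover into a Borel partition: overlaps are resolved in favour of the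
  centre inserted last, and points outside the cover get an arbitrary value. Finite range and Borel
  fibres turn an integrand composed with \<open>c\<close> into a finite sum of indicators.\<close>

lemma finite_valued_selection:
  fixes V :: "'b \<Rightarrow> 'b::topological_space set"
  assumes "finite D" and "\<And>d. open (V d)"
  obtains c where "finite (range c)" "\<And>v. c -` {v} \<in> sets borel" "\<And>y. y \<in> \<Union>(V ` D) \<Longrightarrow> y \<in> V (c y)"
proof -
  have "\<exists>c. finite (range c) \<and> (\<forall>v. c -` {v} \<in> sets borel) \<and> (\<forall>y\<in>\<Union>(V ` D). y \<in> V (c y))"
    using \<open>finite D\<close>
  proof induction
    case empty
    have "(\<lambda>_. undefined :: 'b) -` {v} \<in> sets (borel :: 'b measure)" for v
      by (cases "v = undefined") (auto simp: vimage_def)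
    then show ?case by (intro exI[of _ "\<lambda>_. undefined"]) auto
  next
    case (insert d D)
    then obtain c where c: "finite (range c)" "\<And>v. c -` {v} \<in> sets borel" "\<forall>y\<in>\<Union>(V ` D). y \<in> V (c y)"
      by blast
    let ?c = "\<lambda>y. if y \<in> V d then d else c y"
    have V: "V d \<in> sets borel" using assms(2) by auto
    have eq: "?c -` {v} = (if v = d then V d \<union> c -` {v} else c -` {v} - V d)" for v
      by auto
    have "?c -` {v} \<in> sets borel" for v
      unfolding eq using V c(2) by auto
    moreover have "finite (range ?c)"
      by (rule finite_subset[of _ "insert d (range c)"]) (use c(1) in auto)
    ultimately show ?case using c(3) by (intro exI[of _ ?c]) auto
  qed
  then show thesis using that by blast
qed

text \<open>Plays the role of a complex measure of total variation at most \<open>N\<close>.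
  Quantifying over every pointwise bound \<open>M\<close> avoids suprema, and the operations are
  written out pointwise so that no carrier is involved.\<close>

definition C_functional :: "(('a::topological_space \<Rightarrow> complex) \<Rightarrow> complex) \<Rightarrow> real \<Rightarrow> bool"
  where "C_functional \<Phi> N \<longleftrightarrow> 0 \<le> N \<and>
    (\<forall>f g. continuous_on UNIV f \<longrightarrow> continuous_on UNIV g \<longrightarrow> \<Phi> (\<lambda>x. f x + g x) = \<Phi> f + \<Phi> g) \<and>
    (\<forall>c f. continuous_on UNIV f \<longrightarrow> \<Phi> (\<lambda>x. c * f x) = c * \<Phi> f) \<and>
    (\<forall>f M. continuous_on UNIV f \<longrightarrow> (\<forall>x. cmod (f x) \<le> M) \<longrightarrow> cmod (\<Phi> f) \<le> N * M)"

lemma C_functional_add: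
  "C_functional \<Phi> N \<Longrightarrow> continuous_on UNIV f \<Longrightarrow> continuous_on UNIV g \<Longrightarrow> \<Phi> (\<lambda>x. f x + g x) = \<Phi> f + \<Phi> g"
  and C_functional_scale:
  "C_functional \<Phi> N \<Longrightarrow> continuous_on UNIV f \<Longrightarrow> \<Phi> (\<lambda>x. c * f x) = c * \<Phi> f"
  and C_functional_bound:
  "C_functional \<Phi> N \<Longrightarrow> continuous_on UNIV f \<Longrightarrow> (\<And>x. cmod (f x) \<le> M) \<Longrightarrow> cmod (\<Phi> f) \<le> N * M"
  and C_functional_nonneg: "C_functional \<Phi> N \<Longrightarrow> 0 \<le> N"
  unfolding C_functional_def by blast+

lemma C_functional_diff:
  assumes "C_functional \<Phi> N" "continuous_on UNIV f" "continuous_on UNIV g"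
  shows "\<Phi> (\<lambda>x. f x - g x) = \<Phi> f - \<Phi> g"
proof -
  have "\<Phi> (\<lambda>x. f x + (-1) * g x) = \<Phi> f + \<Phi> (\<lambda>x. (-1) * g x)"
    using assms by (intro C_functional_add continuous_intros)
  then show ?thesis
    using C_functional_scale[OF assms(1,3), of "-1"] by simp
qed

lemma C_functional_sum:
  assumes "C_functional \<Phi> N" "finite I" "\<And>i. i \<in> I \<Longrightarrow> continuous_on UNIV (f i)"
  shows "\<Phi> (\<lambda>x. \<Sum>i\<in>I. f i x) = (\<Sum>i\<in>I. \<Phi> (f i))"
  using assms(2,3)
proof (induction I)
  case empty
  show ?case using C_functional_scale[OF assms(1), of "\<lambda>_. 0" 0] by simp
next
  case (insert i I)
  then show ?case
    by (simp add: C_functional_add[OF assms(1)] continuous_on_sum)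
qed

section \<open>Haar measure as an invariant probability measure\<close>

locale compact_haar =
  fixes m :: "'g::{topological_ab_group_add,t2_space} measure"
  assumes compact_UNIV: "compact (UNIV :: 'g set)" and haar: "normalized_haar_measure m"
begin

lemma sets_m [simp, measurable_cong]: "sets m = sets borel"
  using haar by (simp add: normalized_haar_measure_def)

lemma space_m [simp]: "space m = UNIV"
  using sets_eq_imp_space_eq[OF sets_m] by simp

lemma emeasure_UNIV: "emeasure m UNIV = 1"
  using haar by (simp add: normalized_haar_measure_def)

sublocale finite_measure m
  by standard (simp add: emeasure_UNIV)

lemma measure_UNIV [simp]: "measure m UNIV = 1"
  by (simp add: measure_def emeasure_UNIV)

lemma measurable_continuous [intro]: "continuous_on UNIV f \<Longrightarrow> f \<in> borel_measurable m"
  using borel_measurable_continuous_onI by (simp cong: measurable_cong_sets)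

lemma continuous_bounded:
  fixes f :: "'g \<Rightarrow> 'b::real_normed_vector"
  assumes "continuous_on UNIV f"
  obtains B where "0 < B" "\<And>x. norm (f x) \<le> B"
proof -
  have "bounded (range f)"
    by (intro compact_imp_bounded compact_continuous_image assms compact_UNIV)
  then obtain B where "0 < B" "\<forall>x\<in>range f. norm x \<le> B" by (auto simp: bounded_pos)
  then show thesis using that by auto
qed

lemma integrable_bounded:
  fixes f :: "'g \<Rightarrow> 'b::{banach,second_countable_topology}"
  assumes "f \<in> borel_measurable m" "\<And>x. norm (f x) \<le> B"
  shows "integrable m f"
  by (rule integrable_const_bound[of _ B]) (use assms in auto)

lemma integrable_continuous [intro]:
  fixes f :: "'g \<Rightarrow> 'b::{banach,second_countable_topology}"
  assumes "continuous_on UNIV f" shows "integrable m f"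
  using continuous_bounded[OF assms] integrable_bounded[of f] measurable_continuous[OF assms] by metis

lemma integrable_bounded_mult:
  fixes f u :: "'g \<Rightarrow> complex"
  assumes "f \<in> borel_measurable m" "\<And>x. cmod (f x) \<le> B" "integrable m u"
  shows "integrable m (\<lambda>x. f x * u x)"
proof (rule Bochner_Integration.integrable_bound[of _ "\<lambda>x. of_real B * u x"])
  show "integrable m (\<lambda>x. of_real B * u x)" using assms by simp
  show "(\<lambda>x. f x * u x) \<in> borel_measurable m" using assms by measurable
  have "0 \<le> B" using order_trans[OF norm_ge_zero assms(2)] .
  then show "AE x in m. norm (f x * u x) \<le> norm (of_real B * u x)"
    using assms(2) by (auto simp: norm_mult intro!: mult_right_mono)
qed

lemma integrable_continuous_mult:
  fixes f u :: "'g \<Rightarrow> complex"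
  assumes "continuous_on UNIV f" "integrable m u"
  shows "integrable m (\<lambda>x. f x * u x)"
  using continuous_bounded[OF assms(1)] integrable_bounded_mult[of f _ u] measurable_continuous[OF assms(1)] assms(2)
  by metis

lemma integral_bounded_mult_le:
  fixes f u :: "'g \<Rightarrow> complex"
  assumes "f \<in> borel_measurable m" "\<And>x. cmod (f x) \<le> B" "integrable m u"
  shows "cmod (LINT x|m. f x * u x) \<le> B * (LINT x|m. cmod (u x))"
proof -
  have "cmod (LINT x|m. f x * u x) \<le> (LINT x|m. cmod (f x * u x))"
    by (rule integral_norm_bound)
  also have "\<dots> \<le> (LINT x|m. B * cmod (u x))"
    by (intro integral_mono integrable_norm integrable_mult_right integrable_bounded_mult[OF assms] assms(3))
      (auto simp: norm_mult intro!: mult_right_mono assms(2))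
  finally show ?thesis by simp
qed

lemma integral_bound_prob:
  fixes f :: "'g \<Rightarrow> 'b::{banach,second_countable_topology}"
  assumes "integrable m f" "\<And>x. norm (f x) \<le> B"
  shows "norm (LINT x|m. f x) \<le> B"
proof -
  have "norm (LINT x|m. f x) \<le> (LINT x|m. norm (f x))"
    by (rule integral_norm_bound)
  also have "\<dots> \<le> (LINT x|m. B)"
    using assms by (intro integral_mono) auto
  finally show ?thesis by simp
qed

lemma emeasure_translation: "A \<in> sets borel \<Longrightarrow> emeasure m ((\<lambda>y. x + y) ` A) = emeasure m A"
  using haar unfolding normalized_haar_measure_def by blast

lemma distr_translation: "distr m borel (\<lambda>x. a + x) = m"
proof (rule measure_eqI)
  fix A :: "'g set" assume "A \<in> sets (distr m borel (\<lambda>x. a + x))"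
  then have A: "A \<in> sets borel" by simp
  have c: "continuous_on UNIV (\<lambda>x::'g. a + x)" by (intro continuous_intros)
  have "(\<lambda>x. a + x) -` A = (\<lambda>x. (- a) + x) ` A"
    by (force simp: image_iff)
  then show "emeasure (distr m borel (\<lambda>x. a + x)) A = emeasure m A"
    using A measurable_continuous[OF c] emeasure_translation[OF A, of "- a"] by (simp add: emeasure_distr)
qed simp

lemma integral_translation:
  fixes f :: "'g \<Rightarrow> 'b::{banach,second_countable_topology}"
  assumes "f \<in> borel_measurable m"
  shows "(LINT x|m. f (a + x)) = (LINT x|m. f x)"
proof -
  have c: "continuous_on UNIV (\<lambda>x::'g. a + x)" by (intro continuous_intros)
  have "(LINT x|distr m borel (\<lambda>x. a + x). f x) = (LINT x|m. f (a + x))"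
    using measurable_continuous[OF c] assms by (intro integral_distr) (auto cong: measurable_cong_sets)
  then show ?thesis by (simp add: distr_translation)
qed

text \<open>The tube lemma gives around each point a neighbourhood good for all \<open>x\<close> at
  once, and compactness leaves finitely many of them. Replacing \<open>y\<close> by
  \<open>c y\<close> turns an integral over \<open>y\<close> into a finite sum with an error uniform
  in \<open>x\<close>.\<close>

lemma uniform_partition:
  fixes F :: "'a::topological_space \<times> 'g \<Rightarrow> 'b::metric_space"
  assumes "compact (UNIV :: 'a set)" "continuous_on UNIV F" "0 < e"
  obtains c where "finite (range c)" "\<And>v. c -` {v} \<in> sets borel" "\<And>x y. dist (F (x, y)) (F (x, c y)) < e"
proof -
  have "\<exists>V. open V \<and> d \<in> V \<and> (\<forall>x. \<forall>y\<in>V. dist (F (x, y)) (F (x, d)) < e)" for d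
    by (rule tube_metric[OF assms, of d]) blast
  then obtain V where V: "\<And>d. open (V d)" "\<And>d. d \<in> V d" "\<And>d x y. y \<in> V d \<Longrightarrow> dist (F (x, y)) (F (x, d)) < e"
    by metis
  obtain D where D: "finite D" "UNIV \<subseteq> \<Union>(V ` D)"
  proof (rule compactE_image[OF compact_UNIV, of UNIV V])
    show "open (V d)" for d by (rule V(1))
    show "UNIV \<subseteq> (\<Union>d. V d)" using V(2) by blast
  qed
  obtain c where c: "finite (range c)" "\<And>v. c -` {v} \<in> sets borel" "\<And>y. y \<in> \<Union>(V ` D) \<Longrightarrow> y \<in> V (c y)"
    by (rule finite_valued_selection[of D V, OF D(1) V(1)]) blast
  show thesis
  proof (rule that[OF c(1,2)])
    fix x y
    have "y \<in> V (c y)" using c(3) D(2) by blast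
    then show "dist (F (x, y)) (F (x, c y)) < e" by (rule V(3))
  qed
qed

lemma integral_finite_valued:
  fixes H u :: "'g \<Rightarrow> complex"
  assumes c: "finite (range c)" "\<And>v. c -` {v} \<in> sets borel" and u: "integrable m u"
  shows "integrable m (\<lambda>y. H (c y) * u y)"
    and "(LINT y|m. H (c y) * u y) = (\<Sum>v\<in>range c. H v * (LINT y|m. indicator (c -` {v}) y * u y))"
proof -
  have eq: "H (c y) * u y = (\<Sum>v\<in>range c. H v * (indicator (c -` {v}) y * u y))" for y
  proof -
    have "(\<Sum>v\<in>range c. H v * (indicator (c -` {v}) y * u y)) = (\<Sum>v\<in>range c. if v = c y then H v * u y else 0)"
      by (intro sum.cong) (auto simp: indicator_def)
    then show ?thesis using c(1) by simp
  qed
  have int: "integrable m (\<lambda>y. H v * (indicator (c -` {v}) y * u y))" for v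
    using c(2) by (intro integrable_mult_right integrable_bounded_mult[of _ 1] u borel_measurable_indicator) (auto simp: indicator_def)
  show "integrable m (\<lambda>y. H (c y) * u y)"
    unfolding eq using int by (intro Bochner_Integration.integrable_sum)
  show "(LINT y|m. H (c y) * u y) = (\<Sum>v\<in>range c. H v * (LINT y|m. indicator (c -` {v}) y * u y))"
    unfolding eq using int by (subst Bochner_Integration.integral_sum) simp_all
qed

lemma integral_finite_valued_approx:
  fixes H u :: "'g \<Rightarrow> complex"
  assumes c: "finite (range c)" "\<And>v. c -` {v} \<in> sets borel" and u: "integrable m u"
    and H: "continuous_on UNIV H" "\<And>y. cmod (H y - H (c y)) \<le> e"
  shows "cmod ((LINT y|m. H y * u y) - (LINT y|m. H (c y) * u y)) \<le> e * (LINT y|m. cmod (u y))"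
proof -
  note int = integrable_continuous_mult[OF H(1) u] integral_finite_valued(1)[OF c u, of H]
  have "(LINT y|m. H y * u y) - (LINT y|m. H (c y) * u y) = (LINT y|m. H y * u y - H (c y) * u y)"
    using int by simp
  also have "cmod \<dots> \<le> (LINT y|m. cmod (H y * u y - H (c y) * u y))"
    by (rule integral_norm_bound)
  also have "\<dots> \<le> (LINT y|m. e * cmod (u y))"
    by (intro integral_mono integrable_norm Bochner_Integration.integrable_diff int integrable_mult_right u)
      (auto simp: norm_mult simp flip: left_diff_distrib intro!: mult_right_mono H(2))
  finally show ?thesis by simp
qed

text \<open>By the tube lemma the section of \<open>F\<close> at \<open>y\<close> depends on
  \<open>y\<close> continuously in the sup norm, which \<open>\<Phi>\<close> respects.\<close>

lemma continuous_functional: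
  fixes F :: "'a::topological_space \<times> 'b::t2_space \<Rightarrow> complex"
  assumes "compact (UNIV :: 'a set)" "continuous_on UNIV F" and \<Phi>: "C_functional \<Phi> N"
  shows "continuous_on UNIV (\<lambda>y. \<Phi> (\<lambda>x. F (x, y)))"
proof -
  have Fy: "continuous_on UNIV (\<lambda>x. F (x, y))" for y
    by (rule continuous_on_compose2[OF assms(2)]) (auto intro!: continuous_intros)
  have "isCont (\<lambda>y. \<Phi> (\<lambda>x. F (x, y))) y0" for y0
    unfolding isCont_def tendsto_iff eventually_at_topological
  proof (intro allI impI)
    fix e :: real assume "0 < e"
    \<comment> \<open>\<open>N + 1\<close> instead of \<open>N\<close> covers the case
      \<open>N = 0\<close>.\<close>
    define e' where "e' = e / (N + 1)"
    have N: "0 \<le> N" using C_functional_nonneg[OF \<Phi>] .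
    then have e': "0 < e'" "N * e' < e" using \<open>0 < e\<close> by (auto simp: e'_def field_simps)
    obtain V where V: "open V" "y0 \<in> V" "\<And>x y. y \<in> V \<Longrightarrow> dist (F (x, y)) (F (x, y0)) < e'"
      using tube_metric[OF assms(1,2) e'(1), of y0] by metis
    have "dist (\<Phi> (\<lambda>x. F (x, y))) (\<Phi> (\<lambda>x. F (x, y0))) < e" if "y \<in> V" for y
    proof -
      have "cmod (\<Phi> (\<lambda>x. F (x, y) - F (x, y0))) \<le> N * e'"
        using V(3)[OF that] by (intro C_functional_bound[OF \<Phi>] continuous_intros Fy) (auto simp: dist_norm less_imp_le)
      then show ?thesis using e' C_functional_diff[OF \<Phi> Fy Fy] by (simp add: dist_norm)
    qed
    then show "\<exists>S. open S \<and> y0 \<in> S \<and> (\<forall>x\<in>S. x \<noteq> y0 \<longrightarrow> x \<in> UNIV \<longrightarrow> dist (\<Phi> (\<lambda>xa. F (xa, x))) (\<Phi> (\<lambda>x. F (x, y0))) < e)"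
      using V by blast
  qed
  then show ?thesis by (simp add: continuous_on_eq_continuous_at)
qed

lemma C_functional_integral:
  fixes u :: "'g \<Rightarrow> complex"
  assumes u: "integrable m u"
  shows "C_functional (\<lambda>f. LINT x|m. f x * u x) (LINT x|m. cmod (u x))"
  unfolding C_functional_def
proof (intro conjI allI impI)
  fix f g :: "'g \<Rightarrow> complex" assume "continuous_on UNIV f" "continuous_on UNIV g"
  then show "(LINT x|m. (f x + g x) * u x) = (LINT x|m. f x * u x) + (LINT x|m. g x * u x)"
    using u by (simp add: distrib_right integrable_continuous_mult)
next
  fix f :: "'g \<Rightarrow> complex" and M
  assume "continuous_on UNIV f" "\<forall>x. cmod (f x) \<le> M"
  then show "cmod (LINT x|m. f x * u x) \<le> (LINT x|m. cmod (u x)) * M"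
    using integral_bounded_mult_le[of f M u] u measurable_continuous[of f] by (simp add: mult.commute)
qed (simp_all add: mult.assoc)

lemma continuous_integral_right:
  fixes F :: "'a::t2_space \<times> 'g \<Rightarrow> complex"
  assumes F: "continuous_on UNIV F" and u: "integrable m u"
  shows "continuous_on UNIV (\<lambda>x. LINT y|m. F (x, y) * u y)"
  using continuous_functional[OF compact_UNIV _ C_functional_integral[OF u], of "F \<circ> prod.swap"]
    continuous_on_compose[OF continuous_on_swap, of UNIV F] continuous_on_subset[OF F subset_UNIV]
  by simp

text \<open>Replaces Fubini's theorem, which is not available because \<open>borel\<close> on a product of non-metrizable
  spaces may exceed the product algebra.\<close>

theorem functional_integral_swap:
  fixes F :: "'a::t2_space \<times> 'g \<Rightarrow> complex" and u :: "'g \<Rightarrow> complex"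
  assumes K: "compact (UNIV :: 'a set)" and F: "continuous_on UNIV F" and \<Phi>: "C_functional \<Phi> N"
    and u: "integrable m u"
  shows "\<Phi> (\<lambda>x. LINT y|m. F (x, y) * u y) = (LINT y|m. \<Phi> (\<lambda>x. F (x, y)) * u y)"
proof -
  define U where "U = (LINT y|m. cmod (u y))"
  have U: "0 \<le> U" by (simp add: U_def)
  have N: "0 \<le> N" using C_functional_nonneg[OF \<Phi>] .
  have Fy: "continuous_on UNIV (\<lambda>x. F (x, y))" for y
    by (rule continuous_on_compose2[OF F]) (auto intro!: continuous_intros)
  have Fx: "continuous_on UNIV (\<lambda>y. F (x, y))" for x
    by (rule continuous_on_compose2[OF F]) (auto intro!: continuous_intros)
  have G: "continuous_on UNIV (\<lambda>y. \<Phi> (\<lambda>x. F (x, y)))"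
    by (rule continuous_functional[OF K F \<Phi>])
  define D where "D = \<Phi> (\<lambda>x. LINT y|m. F (x, y) * u y) - (LINT y|m. \<Phi> (\<lambda>x. F (x, y)) * u y)"
  have bound: "cmod D \<le> (2 * N * U) * e" if e: "0 < e" for e
  proof -
    obtain c where c: "finite (range c)" "\<And>v. c -` {v} \<in> sets borel" "\<And>x y. dist (F (x, y)) (F (x, c y)) < e"
      using uniform_partition[OF K F e] by metis
    define w where "w v = (LINT y|m. indicator (c -` {v}) y * u y)" for v
    \<comment> \<open>A finite sum uniformly close to the inner integral. For it the interchange is
      mere linearity of \<open>\<Phi>\<close>, so both sides of the claim lie within
      \<open>N * U * e\<close> of \<open>\<Phi> ?S\<close>.\<close>
    let ?S = "\<lambda>x. \<Sum>v\<in>range c. F (x, v) * w v"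
    have S: "continuous_on UNIV ?S" by (intro continuous_intros Fy)
    have *: "cmod ((LINT y|m. F (x, y) * u y) - ?S x) \<le> e * U" for x
      using integral_finite_valued_approx[OF c(1,2) u Fx, of x e] c(3)[of x]
        integral_finite_valued(2)[OF c(1,2) u, of "\<lambda>y. F (x, y)"]
      by (auto simp: w_def U_def dist_norm less_imp_le)
    have "\<Phi> (\<lambda>x. (LINT y|m. F (x, y) * u y) - ?S x) = \<Phi> (\<lambda>x. LINT y|m. F (x, y) * u y) - \<Phi> ?S"
      by (rule C_functional_diff[OF \<Phi> continuous_integral_right[OF F u] S])
    moreover have "cmod (\<Phi> (\<lambda>x. (LINT y|m. F (x, y) * u y) - ?S x)) \<le> N * (e * U)"
      using * by (intro C_functional_bound[OF \<Phi>] continuous_intros continuous_integral_right F u S)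
    ultimately have 1: "cmod (\<Phi> (\<lambda>x. LINT y|m. F (x, y) * u y) - \<Phi> ?S) \<le> N * (e * U)" by simp
    have "\<Phi> ?S = (\<Sum>v\<in>range c. \<Phi> (\<lambda>x. F (x, v) * w v))"
      by (intro C_functional_sum[OF \<Phi> c(1)] continuous_intros Fy)
    also have "\<dots> = (\<Sum>v\<in>range c. \<Phi> (\<lambda>x. F (x, v)) * w v)"
      using C_functional_scale[OF \<Phi> Fy] by (simp add: mult.commute)
    also have "\<dots> = (LINT y|m. \<Phi> (\<lambda>x. F (x, c y)) * u y)"
      using integral_finite_valued(2)[OF c(1,2) u, of "\<lambda>y. \<Phi> (\<lambda>x. F (x, y))"] by (simp add: w_def)
    finally have S2: "\<Phi> ?S = (LINT y|m. \<Phi> (\<lambda>x. F (x, c y)) * u y)" .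
    have "cmod (\<Phi> (\<lambda>x. F (x, y)) - \<Phi> (\<lambda>x. F (x, c y))) \<le> N * e" for y
    proof -
      have "cmod (\<Phi> (\<lambda>x. F (x, y) - F (x, c y))) \<le> N * e"
        using c(3) by (intro C_functional_bound[OF \<Phi>] continuous_intros Fy) (auto simp: dist_norm less_imp_le)
      then show ?thesis using C_functional_diff[OF \<Phi> Fy Fy] by simp
    qed
    from integral_finite_valued_approx[OF c(1,2) u G this]
    have 2: "cmod ((LINT y|m. \<Phi> (\<lambda>x. F (x, y)) * u y) - \<Phi> ?S) \<le> N * e * U"
      unfolding S2 U_def .
    have "cmod D \<le> cmod (\<Phi> (\<lambda>x. LINT y|m. F (x, y) * u y) - \<Phi> ?S) + cmod ((LINT y|m. \<Phi> (\<lambda>x. F (x, y)) * u y) - \<Phi> ?S)"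
      using norm_triangle_ineq4[of "\<Phi> (\<lambda>x. LINT y|m. F (x, y) * u y) - \<Phi> ?S" "(LINT y|m. \<Phi> (\<lambda>x. F (x, y)) * u y) - \<Phi> ?S"]
      by (simp add: D_def)
    then show ?thesis using 1 2 by (simp add: algebra_simps)
  qed
  have "cmod D \<le> 0"
  proof (rule field_le_epsilon)
    fix e :: real assume "0 < e"
    have "0 \<le> 2 * N * U" using N U by simp
    have "cmod D \<le> (2 * N * U) * (e / (2 * N * U + 1))"
      using \<open>0 < e\<close> \<open>0 \<le> 2 * N * U\<close> by (intro bound divide_pos_pos) linarith+
    also have "\<dots> \<le> e"
      using \<open>0 < e\<close> \<open>0 \<le> 2 * N * U\<close> by (simp add: field_simps)
    finally show "cmod D \<le> 0 + e" by simp
  qed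
  then show ?thesis by (simp add: D_def)
qed

end

section \<open>The convolution algebra of continuous functions\<close>

context compact_haar
begin

abbreviation cont :: "('g \<Rightarrow> complex) \<Rightarrow> bool" where "cont f \<equiv> continuous_on UNIV f"

definition conv :: "('g \<Rightarrow> complex) \<Rightarrow> ('g \<Rightarrow> complex) \<Rightarrow> 'g \<Rightarrow> complex"
  where "conv f g = (\<lambda>x. LINT y|m. f (x - y) * g y)"

text \<open>The involution of the group algebra: convolution with \<open>star f\<close> is the L2
  adjoint of convolution with \<open>f\<close>.\<close>

definition star :: "('g \<Rightarrow> complex) \<Rightarrow> 'g \<Rightarrow> complex"
  where "star f = (\<lambda>x. cnj (f (- x)))"

definition sqnorm :: "('g \<Rightarrow> complex) \<Rightarrow> real"
  where "sqnorm f = (LINT x|m. (cmod (f x))\<^sup>2)"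

lemma cont_compose_diff: "cont f \<Longrightarrow> continuous_on UNIV (\<lambda>p::'g \<times> 'g. f (fst p - snd p))"
  by (rule continuous_on_compose2[of UNIV f]) (auto intro!: continuous_intros)

lemma cont_reflect: "cont f \<Longrightarrow> cont (\<lambda>y. f (x - y))"
  by (rule continuous_on_compose2[of UNIV f]) (auto intro!: continuous_intros)

lemma cont_minus: "cont f \<Longrightarrow> cont (\<lambda>y. f (- y))"
  by (rule continuous_on_compose2[of UNIV f]) (auto intro!: continuous_intros)

lemma cont_translate: "cont f \<Longrightarrow> cont (\<lambda>y. f (y - x))"
  by (rule continuous_on_compose2[of UNIV f]) (auto intro!: continuous_intros)

lemma fubini_weighted:
  fixes u v :: "'g \<Rightarrow> complex"
  assumes "continuous_on UNIV (F :: 'g \<times> 'g \<Rightarrow> complex)" "integrable m u" "integrable m v"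
  shows "(LINT x|m. (LINT y|m. F (x, y) * u y) * v x) = (LINT y|m. (LINT x|m. F (x, y) * v x) * u y)"
  using functional_integral_swap[OF compact_UNIV assms(1) C_functional_integral[OF assms(3)] assms(2)] .

text \<open>Invariance under inversion follows from invariance under translation: integrating
  \<open>f (x - y)\<close> over both variables gives the integral of \<open>f (- y)\<close> in one
  order and that of \<open>f\<close> in the other.\<close>

lemma integral_reflection:
  assumes f: "cont f"
  shows "(LINT x|m. f (- x)) = (LINT x|m. f x)"
proof -
  have "(LINT y|m. f (x - y)) = (LINT y|m. f (- y))" for x
    using integral_translation[of "\<lambda>y. f (x - y)" x] measurable_continuous[OF cont_reflect[OF f]] by simp
  moreover have "(LINT x|m. f (x - y)) = (LINT x|m. f x)" for y
    using integral_translation[of f "- y"] measurable_continuous[OF f] by simp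
  ultimately show ?thesis
    using fubini_weighted[OF cont_compose_diff[OF f], of "\<lambda>_. 1" "\<lambda>_. 1"] by simp
qed

lemma integral_reflect_translate: "cont f \<Longrightarrow> (LINT y|m. f (x - y)) = (LINT y|m. f y)"
  using integral_translation[of "\<lambda>y. f (x - y)" x] measurable_continuous[OF cont_reflect[of f x]]
    integral_reflection[of f] by simp

lemma cont_conv [simp, continuous_intros]:
  assumes "cont f" "cont g" shows "cont (conv f g)"
  unfolding conv_def
  using continuous_integral_right[OF cont_compose_diff[OF assms(1)], of g] assms(2) by auto

lemma cont_star [simp, continuous_intros]: "cont f \<Longrightarrow> cont (star f)"
  unfolding star_def by (intro continuous_intros cont_minus)

lemma conv_commute:
  assumes "cont f" "cont g" shows "conv f g = conv g f"
proof
  fix x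
  show "conv f g x = conv g f x"
    unfolding conv_def
    by (subst integral_reflect_translate[of "\<lambda>y. g (x - y) * f y" x, symmetric])
      (auto intro!: continuous_intros cont_reflect assms simp: mult.commute)
qed

lemma conv_assoc:
  assumes f: "cont f" and g: "cont g" and h: "cont h"
  shows "conv (conv f g) h = conv f (conv g h)"
proof
  fix x
  \<comment> \<open>Translating \<open>z\<close> moves the dependence on \<open>y\<close> from
    \<open>f\<close> to \<open>g\<close>, after which the integral over \<open>y\<close> concerns
    only \<open>g\<close> and \<open>h\<close>. The factor 1 is the weight that
    \<open>fubini_weighted\<close> expects.\<close>
  have inner: "(LINT z|m. f (x - y - z) * g z) = (LINT z|m. (f (x - z) * g (z - y)) * 1)" for y
  proof -
    have "cont (\<lambda>z. f (x - y - z) * g z)"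
      by (intro continuous_intros cont_reflect f g)
    from integral_translation[OF measurable_continuous[OF this], of "- y"]
    show ?thesis by (simp add: algebra_simps)
  qed
  have F: "continuous_on UNIV (\<lambda>p. f (x - snd p) * g (snd p - fst p))"
    by (intro continuous_intros continuous_on_compose2[OF f] continuous_on_compose2[OF g]) auto
  have "conv (conv f g) h x = (LINT y|m. (LINT z|m. (f (x - z) * g (z - y)) * 1) * h y)"
    unfolding conv_def inner ..
  also have "\<dots> = (LINT z|m. (LINT y|m. (f (x - z) * g (z - y)) * h y) * 1)"
    using fubini_weighted[OF F, of "\<lambda>_. 1" h] h by auto
  also have "\<dots> = conv f (conv g h) x"
    unfolding conv_def by (simp add: mult.assoc)
  finally show "conv (conv f g) h x = conv f (conv g h) x" .
qed

lemma conv_diff_left: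
  "cont f \<Longrightarrow> cont g \<Longrightarrow> cont h \<Longrightarrow> conv (\<lambda>x. f x - g x) h = (\<lambda>x. conv f h x - conv g h x)"
  unfolding conv_def
  by (auto simp: left_diff_distrib integrable_continuous cont_reflect continuous_intros)

lemma conv_add_right: "cont f \<Longrightarrow> cont g \<Longrightarrow> cont h \<Longrightarrow> conv h (\<lambda>x. f x + g x) = (\<lambda>x. conv h f x + conv h g x)"
  and conv_diff_right: "cont f \<Longrightarrow> cont g \<Longrightarrow> cont h \<Longrightarrow> conv h (\<lambda>x. f x - g x) = (\<lambda>x. conv h f x - conv h g x)"
  unfolding conv_def
  by (auto simp: distrib_left right_diff_distrib integrable_continuous cont_reflect continuous_intros)

lemma conv_scale_left: "conv (\<lambda>x. c * f x) g = (\<lambda>x. c * conv f g x)"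
  and conv_scale_right: "conv f (\<lambda>x. c * g x) = (\<lambda>x. c * conv f g x)"
  unfolding conv_def by (auto simp: mult.assoc mult.left_commute)

lemma conv_zero [simp]: "conv (\<lambda>x. 0) g = (\<lambda>x. 0)" "conv g (\<lambda>x. 0) = (\<lambda>x. 0)"
  by (simp_all add: conv_def)

lemma conv_translate: "conv (\<lambda>t. f (t - x)) g = (\<lambda>t. conv f g (t - x))"
  unfolding conv_def by (simp add: algebra_simps)

lemma star_conv:
  assumes "cont f" "cont g" shows "star (conv f g) = conv (star f) (star g)"
proof
  fix x
  have "cont (\<lambda>y. cnj (f (y - x) * g (- y)))"
    by (intro continuous_intros cont_translate cont_minus assms)
  from integral_reflection[OF this]
  have "conv (star f) (star g) x = (LINT y|m. cnj (f (- y - x) * g y))"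
    unfolding conv_def star_def by (simp add: mult.commute)
  also have "\<dots> = (LINT y|m. cnj (f (- x - y) * g y))"
    by (simp add: minus_diff_commute[of _ x])
  finally have "conv (star f) (star g) x = (LINT y|m. cnj (f (- x - y) * g y))" .
  moreover have "star (conv f g) x = (LINT y|m. cnj (f (- x - y) * g y))"
    by (simp only: star_def conv_def Bochner_Integration.integral_cnj)
  ultimately show "star (conv f g) x = conv (star f) (star g) x" by (simp only:)
qed

lemma star_star [simp]: "star (star f) = f"
  by (simp add: star_def)

lemma star_diff: "star (\<lambda>x. f x - g x) = (\<lambda>x. star f x - star g x)"
  and star_scale: "star (\<lambda>x. c * f x) = (\<lambda>x. cnj c * star f x)"
  by (simp_all add: star_def)

lemma sqnorm_nonneg: "0 \<le> sqnorm f"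
  unfolding sqnorm_def by simp

text \<open>The value at 0 acts as a trace: it converts identities between convolutions into
  identities between L2 norms.\<close>

lemma conv_star_0: "cont f \<Longrightarrow> conv f (star f) 0 = of_real (sqnorm f)"
  using integral_reflection[of "\<lambda>y. f y * cnj (f y)"] continuous_on_mult[of UNIV f "\<lambda>x. cnj (f x)"] continuous_on_cnj[of UNIV f]
  by (simp add: conv_def star_def sqnorm_def flip: complex_norm_square integral_complex_of_real del: of_real_power)

text \<open>Nonempty open sets have positive measure, since finitely many translates of such a set
  cover the compact group. Hence a continuous function that vanishes almost everywhere
  vanishes.\<close>

lemma sqnorm_eq_0:
  assumes f: "cont f" and "sqnorm f = 0" shows "f = (\<lambda>x. 0)"
proof (rule ccontr)
  assume "f \<noteq> (\<lambda>x. 0)"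
  then obtain x0 where x0: "f x0 \<noteq> 0" by auto
  define U where "U = {x. cmod (f x0) / 2 < cmod (f x)}"
  have U: "open U" unfolding U_def by (intro open_Collect_less continuous_intros f)
  have x0U: "x0 \<in> U" using x0 by (simp add: U_def)
  have ae: "AE x in m. (cmod (f x))\<^sup>2 = 0"
    using assms unfolding sqnorm_def
    by (subst (asm) integral_nonneg_eq_0_iff_AE) (auto intro!: integrable_continuous continuous_intros)
  have U0: "emeasure m U = 0"
  proof -
    obtain N where N: "N \<in> sets m" "emeasure m N = 0" "{x. f x \<noteq> 0} \<subseteq> N"
      using ae by (auto simp: eventually_ae_filter null_sets_def)
    have "U \<subseteq> N" using N(3) x0 by (force simp: U_def)
    then show ?thesis using N by (metis emeasure_eq_0)
  qed
  have op: "open ((\<lambda>y. x + y) ` U)" for x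
  proof -
    have "(\<lambda>y. x + y) ` U = (\<lambda>y. - x + y) -` U" by (force simp: image_iff)
    then show ?thesis using open_vimage[OF U, of "\<lambda>y. - x + y"] by (simp add: continuous_intros)
  qed
  have cov: "UNIV \<subseteq> (\<Union>x. (\<lambda>y. x + y) ` U)"
  proof
    fix z show "z \<in> (\<Union>x. (\<lambda>y. x + y) ` U)"
      using x0U by (auto intro!: exI[of _ "z - x0"] image_eqI[of _ _ x0])
  qed
  obtain D where D: "finite D" "UNIV \<subseteq> (\<Union>x\<in>D. (\<lambda>y. x + y) ` U)"
    by (rule compactE_image[OF compact_UNIV, of UNIV "\<lambda>x. (\<lambda>y. x + y) ` U"]) (use op cov in auto)
  have "emeasure m UNIV \<le> emeasure m (\<Union>x\<in>D. (\<lambda>y. x + y) ` U)"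
    using D op by (intro emeasure_mono) auto
  also have "\<dots> \<le> (\<Sum>x\<in>D. emeasure m ((\<lambda>y. x + y) ` U))"
    using op D(1) by (intro emeasure_subadditive_finite) auto
  also have "\<dots> = 0" using emeasure_translation[of U] U U0 by simp
  finally show False by (simp add: emeasure_UNIV)
qed

lemma integral_Cauchy_Schwarz:
  assumes f: "cont f" and g: "cont g"
  shows "(cmod (LINT x|m. f x * g x))\<^sup>2 \<le> sqnorm f * sqnorm g"
proof -
  define c where "c = (LINT x|m. cmod (f x) * cmod (g x))"
  have int: "integrable m (\<lambda>x. cmod (f x) * cmod (g x))" "integrable m (\<lambda>x. (cmod (f x))\<^sup>2)"
    "integrable m (\<lambda>x. (cmod (g x))\<^sup>2)"
    by (auto intro!: integrable_continuous continuous_intros f g)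
  have quad: "0 \<le> sqnorm f * t\<^sup>2 - 2 * c * t + sqnorm g" for t
  proof -
    have "0 \<le> (LINT x|m. (cmod (f x) * t - cmod (g x))\<^sup>2)" by simp
    also have "\<dots> = (LINT x|m. ((cmod (f x))\<^sup>2 * t\<^sup>2 - (2 * t) * (cmod (f x) * cmod (g x))) + (cmod (g x))\<^sup>2)"
      by (simp add: power2_eq_square algebra_simps)
    also have "\<dots> = sqnorm f * t\<^sup>2 - (2 * t) * c + sqnorm g"
      using int by (simp add: sqnorm_def c_def)
    finally show ?thesis by (simp add: algebra_simps)
  qed
  have c0: "0 \<le> c" unfolding c_def by simp
  have "c\<^sup>2 \<le> sqnorm f * sqnorm g"
  proof (cases "sqnorm f = 0")
    case True
    have "c = 0"
    proof (rule ccontr)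
      assume "c \<noteq> 0"
      \<comment> \<open>At this \<open>t\<close> the quadratic, which is linear here, would take the
        value -1.\<close>
      then show False using quad[of "(sqnorm g + 1) / (2 * c)"] True by simp
    qed
    then show ?thesis using True by simp
  next
    case False
    then have "0 < sqnorm f" using sqnorm_nonneg[of f] by simp
    then show ?thesis using quad[of "c / sqnorm f"]
      by (simp add: field_simps power2_eq_square)
  qed
  moreover have "cmod (LINT x|m. f x * g x) \<le> c"
    using integral_norm_bound[of m "\<lambda>x. f x * g x"] by (simp add: c_def norm_mult)
  ultimately show ?thesis using power_mono[of "cmod (LINT x|m. f x * g x)" c 2] by simp
qed

lemma sqnorm_reflect: "cont f \<Longrightarrow> sqnorm (\<lambda>y. f (x - y)) = sqnorm f"
proof -
  assume f: "cont f"
  have "complex_of_real (sqnorm (\<lambda>y. f (x - y))) = complex_of_real (sqnorm f)"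
    unfolding sqnorm_def
    using integral_reflect_translate[of "\<lambda>y. complex_of_real ((cmod (f y))\<^sup>2)" x] f
    by (simp add: continuous_intros del: of_real_power)
  then show ?thesis by simp
qed

text \<open>Convolution with a fixed function maps L2 boundedly into the sup norm; this smoothing
  upgrades L2 estimates to uniform convergence.\<close>

lemma conv_bound:
  assumes "cont f" "cont g" shows "(cmod (conv f g x))\<^sup>2 \<le> sqnorm f * sqnorm g"
  unfolding conv_def
  using integral_Cauchy_Schwarz[OF cont_reflect[OF assms(1)] assms(2), of x] sqnorm_reflect[OF assms(1)] by simp

lemma sqnorm_le: 
  assumes "cont f" "\<And>x. (cmod (f x))\<^sup>2 \<le> B" shows "sqnorm f \<le> B"
  unfolding sqnorm_def
proof -
  have "integrable m (\<lambda>x. (cmod (f x))\<^sup>2)"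
    by (intro integrable_continuous continuous_intros assms)
  from integral_bound_prob[OF this, of B] show "(LINT x|m. (cmod (f x))\<^sup>2) \<le> B"
    using assms(2) by simp
qed

lemma sqnorm_conv: "cont f \<Longrightarrow> cont g \<Longrightarrow> sqnorm (conv f g) \<le> sqnorm f * sqnorm g"
  by (intro sqnorm_le cont_conv conv_bound)

lemma conv_uniform_limit:
  assumes "\<And>n. cont (f n)" "cont g" "uniform_limit UNIV f p sequentially"
  shows "(\<lambda>n. conv (f n) g x) \<longlonglongrightarrow> conv p g x"
proof -
  have p: "cont p" by (rule uniform_limit_theorem[OF _ assms(3)]) (use assms(1) in auto)
  have g: "integrable m (\<lambda>y. cmod (g y))"
    by (intro integrable_continuous continuous_intros assms)
  show ?thesis
  proof (rule tendstoI)
    fix e :: real assume e: "0 < e"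
    define I where "I = (LINT y|m. cmod (g y))"
    have I: "0 \<le> I" by (simp add: I_def)
    have "\<forall>\<^sub>F n in sequentially. \<forall>x\<in>UNIV. dist (f n x) (p x) < e / (I + 1)"
      using e I by (intro uniform_limitD[OF assms(3)]) auto
    then show "\<forall>\<^sub>F n in sequentially. dist (conv (f n) g x) (conv p g x) < e"
    proof eventually_elim
      case (elim n)
      have "dist (conv (f n) g x) (conv p g x) = cmod (conv (\<lambda>x. f n x - p x) g x)"
        using assms p by (simp add: conv_diff_left dist_norm)
      also have "\<dots> \<le> e / (I + 1) * I"
        unfolding conv_def I_def[symmetric]
        using elim by (intro integral_bounded_mult_le[of "\<lambda>y. f n (x - y) - p (x - y)" _ g, folded I_def] measurable_continuous
            continuous_intros cont_reflect assms p integrable_continuous) (auto simp: dist_norm less_imp_le)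
      also have "\<dots> < e" using e I by (simp add: field_simps)
      finally show ?case .
    qed
  qed
qed

end

section \<open>Uniqueness of Fourier coefficients\<close>

text \<open>The model is the sum of \<lambda>^(2 n + 2) over the eigenvalues \<lambda> of a
  self-adjoint operator: \<open>L\<close> is then the largest \<lambda>^2 and \<open>c\<close>
  counts the eigenvalues attaining it. Log-convexity makes the ratios increase to \<open>L\<close>;
  submultiplicativity bounds them and yields \<open>L ^ Suc n \<le> s n\<close>, which keeps
  \<open>c\<close> away from 0.\<close>

lemma geometric_growth_limit:
  fixes s :: "nat \<Rightarrow> real"
  assumes pos: "\<And>n. 0 < s n" and convex: "\<And>n. (s (Suc n))\<^sup>2 \<le> s n * s (Suc (Suc n))"
    and submult: "\<And>k n. s (Suc (k + n)) \<le> s k * s n"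
  obtains L c where "0 < L" "0 < c" "(\<lambda>n. s n / L ^ Suc n) \<longlonglongrightarrow> c"
proof -
  define r where "r n = s (Suc n) / s n" for n
  have "incseq r"
    using convex pos by (intro incseq_SucI) (simp add: r_def field_simps power2_eq_square)
  moreover have r_le: "r n \<le> s 0" for n
    using submult[of 0 n] pos[of n] by (simp add: r_def divide_le_eq)
  ultimately obtain L where L: "r \<longlonglongrightarrow> L" "\<And>n. r n \<le> L"
    using incseq_convergent[of r "s 0"] by blast
  have L0: "0 < L"
    using L(2)[of 0] pos[of 0] pos[of 1] by (auto simp: r_def intro: less_le_trans[rotated])
  \<comment> \<open>The quotient is a product of \<open>Suc n\<close> consecutive ratios, each
    tending to \<open>L\<close>.\<close>
  have lim: "(\<lambda>N. s (Suc (N + n)) / s N) \<longlonglongrightarrow> L ^ Suc n" for n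
  proof (induction n)
    case 0
    then show ?case using L(1) by (simp add: r_def[abs_def])
  next
    case (Suc n)
    have "(\<lambda>N. r (N + Suc n) * (s (Suc (N + n)) / s N)) \<longlonglongrightarrow> L * L ^ Suc n"
      by (intro tendsto_mult LIMSEQ_ignore_initial_segment L Suc)
    moreover have "r (N + Suc n) * (s (Suc (N + n)) / s N) = s (Suc (N + Suc n)) / s N" for N
      using pos[of "Suc (N + n)"] by (simp add: r_def)
    ultimately show ?case by (simp only: power_Suc)
  qed
  have ge: "L ^ Suc n \<le> s n" for n
  proof (rule LIMSEQ_le_const2[OF lim])
    show "\<exists>N. \<forall>k\<ge>N. s (Suc (k + n)) / s k \<le> s n"
      using submult[of _ n] pos by (intro exI[of _ 0]) (simp add: divide_le_eq mult.commute)
  qed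
  define d where "d n = s n / L ^ Suc n" for n
  have "decseq d"
  proof (rule decseq_SucI)
    fix n
    have "s (Suc n) \<le> L * s n" using L(2)[of n] pos[of n] by (simp add: r_def divide_le_eq)
    then show "d (Suc n) \<le> d n" using L0 by (simp add: d_def field_simps)
  qed
  moreover have d1: "1 \<le> d n" for n
    using ge[of n] L0 by (simp add: d_def le_divide_eq)
  ultimately obtain c where c: "d \<longlonglongrightarrow> c"
    using decseq_convergent[of d 1] by blast
  have "1 \<le> c" by (rule LIMSEQ_le_const[OF c]) (use d1 in blast)
  then show thesis using that[OF L0, of c] c unfolding d_def by simp
qed

section \<open>Idempotents from convolution powers\<close>

context compact_haar
begin

text \<open>The index is one less than the number of factors: the convolution algebra need not have
  a unit to serve as a zeroth power.\<close>

primrec conv_power :: "('g \<Rightarrow> complex) \<Rightarrow> nat \<Rightarrow> 'g \<Rightarrow> complex" where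
  "conv_power a 0 = a"
| "conv_power a (Suc n) = conv a (conv_power a n)"

lemma cont_conv_power [simp]: "cont a \<Longrightarrow> cont (conv_power a n)"
  by (induction n) auto

lemma star_conv_power: "cont a \<Longrightarrow> star a = a \<Longrightarrow> star (conv_power a n) = conv_power a n"
  by (induction n) (auto simp: star_conv)

lemma conv_conv_power: "cont a \<Longrightarrow> conv (conv_power a k) (conv_power a n) = conv_power a (Suc (k + n))"
  by (induction k) (auto simp: conv_assoc)

lemma selfadjoint_conv_0: "cont a \<Longrightarrow> star a = a \<Longrightarrow> conv a a 0 = of_real (sqnorm a)"
  using conv_star_0[of a] by simp

text \<open>A self-adjoint element is not nilpotent: the squared norm of
  \<open>conv_power a k\<close> is the value at 0 of \<open>conv_power a (Suc (k + k))\<close>,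
  which has \<open>conv_power a (Suc k)\<close> as a factor, or equals it when
  \<open>k = 0\<close>.\<close>

lemma conv_power_nonzero:
  assumes a: "cont a" "star a = a" "a \<noteq> (\<lambda>x. 0)"
  shows "conv_power a n \<noteq> (\<lambda>x. 0)"
proof (induction n)
  case (Suc k)
  have "sqnorm (conv_power a k) \<noteq> 0"
    using sqnorm_eq_0[of "conv_power a k"] Suc a by auto
  then have nz: "conv_power a (Suc (k + k)) 0 \<noteq> 0"
    using selfadjoint_conv_0[of "conv_power a k"] a by (simp add: star_conv_power conv_conv_power del: conv_power.simps)
  show ?case
  proof
    assume 0: "conv_power a (Suc k) = (\<lambda>x. 0)"
    show False
    proof (cases k)
      case 0
      then show ?thesis using nz \<open>conv_power a (Suc k) = _\<close> by simp
    next
      case (Suc j)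
      then have "conv_power a (Suc (k + k)) = conv (conv_power a (Suc k)) (conv_power a j)"
        using conv_conv_power[OF a(1), of "Suc k" j] by simp
      then show ?thesis using nz 0 by simp
    qed
  qed
qed (use a in simp)

text \<open>The even powers of \<open>a\<close>, rescaled by the growth rate of their norms, converge uniformly: this replaces
  the spectral theorem for the compact operator of convolution with \<open>a\<close>, and the limit is the
  projection onto its top eigenspace.\<close>

lemma conv_idempotent_exists:
  assumes a: "cont a" "star a = a" "a \<noteq> (\<lambda>x. 0)"
  obtains p L where "cont p" "star p = p" "conv p p = p" "p \<noteq> (\<lambda>x. 0)" "0 < L"
    "conv (conv a a) p = (\<lambda>x. of_real L * p x)"
    "\<And>u. cont u \<Longrightarrow> conv u a = a \<Longrightarrow> conv u p = p"
proof -
  let ?A = "conv_power a"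
  note A = cont_conv_power[OF a(1)] star_conv_power[OF a(1,2)] conv_conv_power[OF a(1)]
  define s where "s n = sqnorm (?A n)" for n
  have A0: "?A (Suc (n + n)) 0 = of_real (s n)" for n
    using selfadjoint_conv_0[of "?A n"] A by (simp add: s_def del: conv_power.simps)
  have s_pos: "0 < s n" for n
    using sqnorm_eq_0[of "?A n"] sqnorm_nonneg[of "?A n"] conv_power_nonzero[OF a, of n] A(1)
    by (force simp: s_def order_less_le)
  have "(s (Suc n))\<^sup>2 \<le> s n * s (Suc (Suc n))" for n
  proof -
    \<comment> \<open>Log-convexity is Cauchy-Schwarz: the same power is split once evenly and once
      with indices \<open>n\<close> and \<open>n + 2\<close>.\<close>
    have "?A (Suc (Suc n + Suc n)) 0 = conv (?A n) (?A (Suc (Suc n))) 0"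
      using A(3)[of n "Suc (Suc n)"] by (simp del: conv_power.simps)
    then have "complex_of_real (s (Suc n)) = conv (?A n) (?A (Suc (Suc n))) 0"
      using A0[of "Suc n"] by (simp del: conv_power.simps)
    then have "(cmod (complex_of_real (s (Suc n))))\<^sup>2 \<le> s n * s (Suc (Suc n))"
      unfolding s_def using conv_bound[OF A(1) A(1)] by metis
    then show ?thesis by simp
  qed
  moreover have "s (Suc (k + n)) \<le> s k * s n" for k n
    unfolding s_def A(3)[symmetric] by (intro sqnorm_conv A)
  ultimately obtain L c where L: "0 < L" "0 < c" "(\<lambda>n. s n / L ^ Suc n) \<longlonglongrightarrow> c"
    using geometric_growth_limit[of s] s_pos by metis
  define d where "d n = s n / L ^ Suc n" for n
  have d: "d \<longlonglongrightarrow> c" using L(3) by (simp add: d_def[abs_def])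
  \<comment> \<open>This is the power \<open>n + 1\<close> of \<open>conv a a\<close>, scaled so
    that the largest eigenvalue becomes 1. Even powers are taken because an eigenvalue of
    \<open>a\<close> of largest modulus may be negative.\<close>
  define f where "f n = (\<lambda>x. of_real (1 / L ^ Suc n) * ?A (Suc (n + n)) x)" for n
  have f_cont: "cont (f n)" for n unfolding f_def by (intro continuous_intros A)
  have f_star: "star (f n) = f n" for n unfolding f_def star_scale A(2) by simp
  have f_conv: "conv (f k) (f n) = f (Suc (k + n))" for k n
    unfolding f_def conv_scale_left conv_scale_right A(3)
    by (simp add: power_add ac_simps del: conv_power.simps)
  have f0: "f n 0 = of_real (d n)" for n
    unfolding f_def A0 by (simp add: d_def)
  \<comment> \<open>The squared norm is the value at 0 of the square, so \<open>f_conv\<close>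
    reduces the Cauchy property to the convergence of \<open>d\<close>.\<close>
  have sq: "sqnorm (\<lambda>x. f n x - f k x) = d (Suc (n + n)) - 2 * d (Suc (n + k)) + d (Suc (k + k))" for n k
  proof -
    have "complex_of_real (sqnorm (\<lambda>x. f n x - f k x)) = conv (\<lambda>x. f n x - f k x) (\<lambda>x. f n x - f k x) 0"
      by (rule selfadjoint_conv_0[symmetric]) (auto intro!: continuous_intros f_cont simp: star_diff f_star)
    also have "\<dots> = of_real (d (Suc (n + n)) - 2 * d (Suc (n + k)) + d (Suc (k + k)))"
      using f_cont f0 by (simp add: conv_diff_left conv_diff_right f_conv continuous_intros add.commute)
    finally show ?thesis by (simp only: of_real_eq_iff)
  qed
  define B where "B = sqnorm (f 0)"
  have B: "0 \<le> B" unfolding B_def by (rule sqnorm_nonneg)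
  \<comment> \<open>One factor \<open>f 0\<close> is spent on passing from the L2 norm to the sup
    norm, hence the shift to \<open>Suc n\<close>.\<close>
  have diff_bound: "(cmod (f (Suc n) x - f (Suc k) x))\<^sup>2 \<le> B * (d (Suc (n + n)) - 2 * d (Suc (n + k)) + d (Suc (k + k)))" for n k x
  proof -
    have "f (Suc n) x - f (Suc k) x = conv (f 0) (\<lambda>x. f n x - f k x) x"
      using f_conv[of 0] f_cont by (simp add: conv_diff_right)
    then show ?thesis
      using conv_bound[OF f_cont, of "\<lambda>x. f n x - f k x" 0 x] f_cont by (simp add: sq B_def continuous_intros)
  qed
  have "uniformly_Cauchy_on UNIV (\<lambda>n. f (Suc n))"
  proof (rule uniformly_Cauchy_onI)
    fix e :: real assume e: "0 < e"
    \<comment> \<open>The coefficients 1, 2, 1 of the second difference account for the 4;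
      \<open>B + 1\<close> allows \<open>B = 0\<close>.\<close>
    define e' where "e' = e\<^sup>2 / (4 * (B + 1))"
    have e': "0 < e'" using e B by (simp add: e'_def)
    obtain N where N: "\<And>n. n \<ge> N \<Longrightarrow> \<bar>d n - c\<bar> < e'"
      using LIMSEQ_D[OF d e'] by auto
    have "dist (f (Suc n) x) (f (Suc k) x) < e" if "n \<ge> N" "k \<ge> N" for n k x
    proof -
      have "d (Suc (n + n)) - 2 * d (Suc (n + k)) + d (Suc (k + k)) < 4 * e'"
        using N[of "Suc (n + n)"] N[of "Suc (n + k)"] N[of "Suc (k + k)"] that by linarith
      then have "(cmod (f (Suc n) x - f (Suc k) x))\<^sup>2 \<le> B * (4 * e')"
        using diff_bound[of n x k] B by (meson less_imp_le mult_left_mono order_trans)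
      also have "\<dots> < (B + 1) * (4 * e')" using e' by simp
      also have "\<dots> = e\<^sup>2" using B by (simp add: e'_def field_simps)
      finally show ?thesis
        using e by (simp add: dist_norm power_less_imp_less_base[of _ 2])
    qed
    then show "\<exists>M. \<forall>x\<in>UNIV. \<forall>k\<ge>M. \<forall>n\<ge>M. dist (f (Suc k) x) (f (Suc n) x) < e" by blast
  qed
  then obtain p where p: "uniform_limit UNIV (\<lambda>n. f (Suc n)) p sequentially"
    using Cauchy_uniformly_convergent uniformly_convergent_on_def by blast
  have p_cont: "cont p" by (rule uniform_limit_theorem[OF _ p]) (use f_cont in auto)
  have p_lim: "(\<lambda>n. f n x) \<longlonglongrightarrow> p x" for x
    using tendsto_uniform_limitI[OF p, of x] by (intro LIMSEQ_imp_Suc[of "\<lambda>n. f n x"]) simp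
  note unique = LIMSEQ_unique
  have "p 0 = of_real c"
    using unique[OF p_lim[of 0]] tendsto_of_real[OF d] by (simp add: f0)
  then have p_nz: "p \<noteq> (\<lambda>x. 0)" using L(2) by auto
  have p_star: "star p = p"
  proof
    fix x
    have "(\<lambda>n. star (f n) x) \<longlonglongrightarrow> star p x"
      unfolding star_def by (intro tendsto_intros p_lim)
    then show "star p x = p x" unfolding f_star using unique p_lim by blast
  qed
  have conv_lim: "(\<lambda>n. conv (f (Suc n)) g x) \<longlonglongrightarrow> conv p g x" if "cont g" for g x
    by (rule conv_uniform_limit[OF f_cont that p])
  have pf: "conv p (f k) = p" for k
  proof
    fix x
    have "(\<lambda>n. f (Suc (Suc n + k)) x) \<longlonglongrightarrow> p x"
      using LIMSEQ_ignore_initial_segment[OF p_lim, of "Suc (Suc k)" x] by simp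
    then show "conv p (f k) x = p x" using unique[OF conv_lim[OF f_cont, of k x]] by (simp add: f_conv)
  qed
  have fp: "conv (f k) p = p" for k using pf[of k] conv_commute[OF f_cont p_cont] by simp
  have pp: "conv p p = p"
  proof
    fix x
    have "(\<lambda>n. p x) \<longlonglongrightarrow> conv p p x" using conv_lim[OF p_cont, of x] by (simp add: fp)
    then show "conv p p x = p x" using unique tendsto_const by blast
  qed
  have "f 0 = (\<lambda>x. of_real (1 / L) * conv a a x)" by (simp add: f_def)
  then have "(\<lambda>x. of_real (1 / L) * conv (conv a a) p x) = p"
    using fp[of 0] by (simp only: conv_scale_left)
  then have eig: "conv (conv a a) p = (\<lambda>x. of_real L * p x)"
    using L(1) by (auto simp: fun_eq_iff field_simps)
  \<comment> \<open>Since \<open>p\<close> is a limit of scaled powers of \<open>a\<close>, whatever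
    acts as a unit on \<open>a\<close> does so on \<open>p\<close>. This later places
    \<open>p\<close> below a given projection.\<close>
  have fix_p: "conv u p = p" if u: "cont u" "conv u a = a" for u
  proof -
    have uA: "conv u (?A n) = ?A n" for n
      by (cases n) (auto simp: u a(1) simp flip: conv_assoc)
    have "conv (f n) u = f n" for n
      unfolding conv_commute[OF f_cont u(1)] unfolding f_def conv_scale_right uA ..
    then have "conv p u x = p x" for x
      using conv_lim[OF u(1), of x] LIMSEQ_ignore_initial_segment[OF p_lim, of 1 x] unique by fastforce
    then show ?thesis using conv_commute[OF p_cont u(1)] by auto
  qed
  show thesis by (rule that[OF p_cont p_star pp p_nz L(1) eig fix_p])
qed

section \<open>Minimal projections and characters\<close>

definition projection :: "('g \<Rightarrow> complex) \<Rightarrow> bool"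
  where "projection q \<longleftrightarrow> cont q \<and> star q = q \<and> conv q q = q \<and> q \<noteq> (\<lambda>x. 0)"

text \<open>The number \<open>q 0 = sqnorm q\<close> is the rank of convolution with
  \<open>q\<close>. It is at least 1 because the pointwise bound of \<open>q\<close> by
  \<open>sqnorm q\<close> makes \<open>sqnorm q\<close> at most its own square; this gap lets a
  descent to smaller projections stop.\<close>

lemma projectionD:
  assumes "projection q"
  shows "cont q" "star q = q" "conv q q = q" "q \<noteq> (\<lambda>x. 0)" "q 0 = of_real (sqnorm q)"
    "cmod (q x) \<le> sqnorm q" "1 \<le> sqnorm q"
proof -
  show q: "cont q" "star q = q" "conv q q = q" "q \<noteq> (\<lambda>x. 0)"
    using assms by (simp_all add: projection_def)
  show "q 0 = of_real (sqnorm q)"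
    using selfadjoint_conv_0[OF q(1,2)] q(3) by simp
  have le: "(cmod (q x))\<^sup>2 \<le> (sqnorm q)\<^sup>2" for x
    using conv_bound[OF q(1) q(1), of x] q(3) by (simp add: power2_eq_square)
  show "cmod (q x) \<le> sqnorm q"
    using le sqnorm_nonneg by (rule power2_le_imp_le)
  have "sqnorm q \<le> sqnorm q * sqnorm q"
    using sqnorm_le[OF q(1) le] by (simp add: power2_eq_square)
  moreover have "0 < sqnorm q"
    using sqnorm_eq_0[OF q(1)] q(4) sqnorm_nonneg[of q] by force
  ultimately show "1 \<le> sqnorm q" by simp
qed

text \<open>The equation \<open>conv q p = p\<close> says that \<open>p\<close> lies below
  \<open>q\<close>. Ranks subtract because the rank is the value at 0.\<close>

lemma projection_diff:
  assumes q: "projection q" and p: "projection p" and le: "conv q p = p" and neq: "q \<noteq> p"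
  shows "projection (\<lambda>x. q x - p x)" "sqnorm (\<lambda>x. q x - p x) = sqnorm q - sqnorm p"
proof -
  note Q = projectionD[OF q] and P = projectionD[OF p]
  have "conv p q = p" using le conv_commute[OF Q(1) P(1)] by simp
  then show "projection (\<lambda>x. q x - p x)"
    unfolding projection_def
    using Q(1-3) P(1-3) neq le
    by (auto simp: continuous_intros star_diff conv_diff_left conv_diff_right fun_eq_iff)
  from projectionD(5)[OF this]
  have "complex_of_real (sqnorm (\<lambda>x. q x - p x)) = of_real (sqnorm q - sqnorm p)"
    using Q(5) P(5) by simp
  then show "sqnorm (\<lambda>x. q x - p x) = sqnorm q - sqnorm p"
    by (simp only: of_real_eq_iff)
qed

text \<open>The infimum of the ranks below \<open>p\<close> need not be known to be attained: any
  \<open>q\<close> within 1 of it is minimal, since a proper \<open>r\<close> below \<open>q\<close>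
  would leave \<open>q - r\<close> of rank at least 1.\<close>

lemma minimal_projection_exists:
  assumes p: "projection p"
  obtains q where "projection q" "conv q p = q"
    "\<And>r. projection r \<Longrightarrow> conv q r = r \<Longrightarrow> r = q"
proof -
  define S where "S = {sqnorm q | q. projection q \<and> conv q p = q}"
  have "sqnorm p \<in> S" using p projectionD(3)[OF p] by (auto simp: S_def)
  moreover have "bdd_below S" using sqnorm_nonneg by (auto simp: S_def intro!: bdd_belowI[of _ 0])
  ultimately have "\<exists>s\<in>S. s < Inf S + 1"
    using cInf_lessD[of S "Inf S + 1"] by auto
  then obtain q where q: "projection q" "conv q p = q" "sqnorm q < Inf S + 1"
    by (auto simp: S_def)
  show thesis
  proof (rule that[OF q(1,2)])
    fix r assume r: "projection r" "conv q r = r"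
    note Q = projectionD[OF q(1)] and R = projectionD[OF r(1)] and P = projectionD[OF p]
    show "r = q"
    proof (rule ccontr)
      assume "r \<noteq> q"
      then have "q \<noteq> r" by simp
      note d = projection_diff[OF q(1) r this]
      have rq: "conv r q = r" using r(2) conv_commute[OF Q(1) R(1)] by simp
      \<comment> \<open>\<open>r\<close> lies below \<open>q\<close>, hence below \<open>p\<close>,
        so its rank competes for the infimum.\<close>
      have "conv r p = conv (conv r q) p" by (simp only: rq)
      also have "\<dots> = conv r (conv q p)" by (rule conv_assoc[OF R(1) Q(1) P(1)])
      also have "\<dots> = r" by (simp only: q(2) rq)
      finally have "sqnorm r \<in> S" using r by (auto simp: S_def)
      then have "Inf S \<le> sqnorm r" using \<open>bdd_below S\<close> by (rule cInf_lower)
      then show False using d(2) projectionD(7)[OF d(1)] q(3) by simp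
    qed
  qed
qed

text \<open>In the corner cut out by \<open>q\<close>, the idempotent that
  \<open>conv_idempotent_exists\<close> extracts from a nonzero \<open>w\<close> must be
  \<open>q\<close> itself, so \<open>conv w w\<close> is a positive multiple of \<open>q\<close>.
  When \<open>conv u u\<close> is s^2 q, the product of u - s q and u + s q is 0; if the first
  factor is not 0, its square is a positive multiple of \<open>q\<close>, and the second factor
  vanishes.\<close>

lemma minimal_projection_selfadjoint:
  assumes q: "projection q" and min: "\<And>r. projection r \<Longrightarrow> conv q r = r \<Longrightarrow> r = q"
    and u: "cont u" "star u = u" "conv q u = u"
  shows "\<exists>c. u = (\<lambda>x. c * q x)"
proof -
  note Q = projectionD[OF q]
  have square: "\<exists>L>0. conv w w = (\<lambda>x. complex_of_real L * q x)"
    if w: "cont w" "star w = w" "conv q w = w" "w \<noteq> (\<lambda>x. 0)" for w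
  proof -
    obtain r L where r: "cont r" "star r = r" "conv r r = r" "r \<noteq> (\<lambda>x. 0)" "0 < L"
      "conv (conv w w) r = (\<lambda>x. of_real L * r x)" "\<And>u. cont u \<Longrightarrow> conv u w = w \<Longrightarrow> conv u r = r"
      using conv_idempotent_exists[OF w(1,2,4)] by metis
    have "r = q" using r Q w by (intro min) (auto simp: projection_def)
    moreover have "conv (conv w w) q = conv w w"
      using w conv_commute[OF w(1) Q(1)] by (simp add: conv_assoc Q)
    ultimately show ?thesis using r(5,6) by auto
  qed
  show ?thesis
  proof (cases "u = (\<lambda>x. 0)")
    case True
    then show ?thesis by (intro exI[of _ 0]) simp
  next
    case False
    then obtain L where L: "0 < L" "conv u u = (\<lambda>x. complex_of_real L * q x)" using square[OF u] by blast
    define s where "s = complex_of_real (sqrt L)"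
    have s: "s * s = of_real L" "cnj s = s" using L(1) by (simp_all add: s_def flip: of_real_mult)
    have qu: "conv u q = u" using u conv_commute[OF u(1) Q(1)] by simp
    let ?w = "\<lambda>x. u x - s * q x" and ?v = "\<lambda>x. u x + s * q x"
    have cont: "cont ?w" "cont ?v" "cont (\<lambda>x. s * q x)" by (intro continuous_intros u Q)+
    show ?thesis
    proof (cases "?w = (\<lambda>x. 0)")
      case True
      then show ?thesis by (intro exI[of _ s]) (simp add: fun_eq_iff)
    next
      case w0: False
      have "star ?w = ?w" by (simp add: star_diff star_scale u Q s)
      moreover have "conv q ?w = ?w" using u Q cont by (simp add: conv_diff_right conv_scale_right)
      ultimately obtain K where K: "0 < K" "conv ?w ?w = (\<lambda>x. complex_of_real K * q x)"
        using square[OF cont(1) _ _ w0] by blast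
      have wv: "conv ?w ?v = (\<lambda>x. 0)"
        using u Q cont qu L(2) s
        by (simp add: conv_diff_left conv_add_right conv_scale_right conv_scale_left fun_eq_iff algebra_simps flip: mult.assoc)
      have qv: "conv q ?v = ?v" using u Q cont by (simp add: conv_add_right conv_scale_right)
      have "conv (conv ?w ?w) ?v = (\<lambda>x. 0)" using wv cont by (simp add: conv_assoc)
      then have "(\<lambda>x. of_real K * ?v x) = (\<lambda>x. 0)" unfolding K(2) conv_scale_left qv .
      then have "?v x = 0" for x using K(1) by (simp add: fun_eq_iff)
      then have "u x = - s * q x" for x by (simp add: eq_neg_iff_add_eq_0)
      then show ?thesis by blast
    qed
  qed
qed

text \<open>A minimal projection is proportional to each of its translates, hence to a character.\<close>

lemma minimal_projection_character:
  assumes q: "projection q" and min: "\<And>r. projection r \<Longrightarrow> conv q r = r \<Longrightarrow> r = q"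
  shows "(\<lambda>x. q x / q 0) \<in> dual_group"
proof -
  note Q = projectionD[OF q]
  have q0: "q 0 \<noteq> 0" using Q(5,7) by auto
  have eq: "q (t - x) * q 0 = q (- x) * q t" for t x
  proof -
    \<comment> \<open>\<open>star\<close> sends the translate of \<open>q\<close> by
      \<open>x\<close> to the translate by \<open>- x\<close>. Up to constant factors these
      combinations are the real and imaginary parts of the translate for this involution.\<close>
    let ?u = "\<lambda>t. q (t - x) + q (t - (- x))" and ?v = "\<lambda>t. \<i> * (q (t - x) - q (t - (- x)))"
    have T: "cont (\<lambda>t. q (t - x))" for x by (rule cont_translate[OF Q(1)])
    have cT: "conv q (\<lambda>t. q (t - x)) = (\<lambda>t. q (t - x))" for x
      using conv_translate[of q x q] conv_commute[OF Q(1) T] Q(3) by simp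
    have sT: "star (\<lambda>t. q (t - x)) = (\<lambda>t. q (t - (- x)))" for x
      using fun_cong[OF Q(2)] by (auto simp: star_def fun_eq_iff) (metis minus_add_distrib diff_conv_add_uminus minus_minus)
    have sP: "star (\<lambda>t. q (t + x)) = (\<lambda>t. q (t - x))" for x
      using sT[of "- x"] by simp
    have star_uv: "star ?u = ?u" "star ?v = ?v"
      using sT[of x] sP[of x] by (auto simp: star_def fun_eq_iff algebra_simps)
    have conv_uv: "conv q ?u = ?u" "conv q ?v = ?v"
      using T[of x] T[of "- x"] cT[of x] cT[of "- x"] Q(1)
      by (simp_all add: conv_add_right conv_diff_right conv_scale_right)
    have cont_uv: "cont ?u" "cont ?v" by (intro continuous_intros T)+
    have span: "\<exists>c. u = (\<lambda>x. c * q x)" if "cont u" "star u = u" "conv q u = u" for u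
      using min by (intro minimal_projection_selfadjoint[OF q _ that]) auto
    obtain c where u: "?u = (\<lambda>x. c * q x)"
      using span[OF cont_uv(1) star_uv(1) conv_uv(1)] by blast
    obtain d where v: "?v = (\<lambda>x. d * q x)"
      using span[OF cont_uv(2) star_uv(2) conv_uv(2)] by blast
    note uv = u v
    have *: "2 * q (t - x) = (c - \<i> * d) * q t" for t
    proof -
      have "2 * q (t - x) = ?u t - \<i> * ?v t" by (simp add: algebra_simps)
      also have "\<dots> = c * q t - \<i> * (d * q t)" using fun_cong[OF uv(1), of t] fun_cong[OF uv(2), of t] by (simp only:)
      finally show ?thesis by (simp add: algebra_simps)
    qed
    \<comment> \<open>Evaluation at 0 identifies the scalar \<open>c - \<i> * d\<close> as
      \<open>2 * q (- x) / q 0\<close>.\<close>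
    have "2 * (q (t - x) * q 0) = (2 * q (0 - x)) * q t"
      using *[of t] *[of 0] by (simp del: diff_0)
    then show ?thesis by simp
  qed
  let ?c = "\<lambda>x. q x / q 0"
  have mult: "?c (x + y) = ?c x * ?c y" for x y
    using eq[of x "- y"] q0 by (simp add: field_simps)
  have le: "cmod (?c x) \<le> 1" for x
    using Q(6)[of x] Q(5,7) by (simp add: norm_divide divide_le_eq)
  \<comment> \<open>The values at \<open>x\<close> and \<open>- x\<close> have modulus at most 1 and
    product 1.\<close>
  have "cmod (?c x) = 1" for x
  proof -
    have "cmod (?c x) * cmod (?c (- x)) = 1"
      using mult[of x "- x"] q0 by (simp flip: norm_mult)
    then show ?thesis using le[of x] le[of "- x"]
      by (smt (verit) mult_left_le norm_ge_zero)
  qed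
  then show ?thesis
    unfolding dual_group_def using mult q0 by (auto intro!: continuous_intros Q)
qed

text \<open>Convolving \<open>h\<close> with its star gives a self-adjoint \<open>a\<close> with
  \<open>a 0 = sqnorm h\<close>. A minimal projection \<open>q\<close> below the idempotent of
  \<open>a\<close> is not annihilated by \<open>a\<close>; yet \<open>q\<close> is a multiple of a
  character, and convolving \<open>h\<close> with a character produces a Fourier
  coefficient.\<close>

theorem fourier_unique:
  assumes h: "cont h" and zero: "\<And>\<gamma>. \<gamma> \<in> dual_group \<Longrightarrow> fourier_coeff m h \<gamma> = 0"
  shows "h = (\<lambda>x. 0)"
proof (rule ccontr)
  assume h0: "h \<noteq> (\<lambda>x. 0)"
  define a where "a = conv h (star h)"
  have a: "cont a" "star a = a"
    using h by (simp_all add: a_def star_conv conv_commute)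
  have "a 0 \<noteq> 0"
    using sqnorm_eq_0[OF h] h0 h by (auto simp: a_def conv_star_0)
  then have "a \<noteq> (\<lambda>x. 0)" by auto
  then obtain p L where p: "cont p" "star p = p" "conv p p = p" "p \<noteq> (\<lambda>x. 0)" "0 < L"
      "conv (conv a a) p = (\<lambda>x. of_real L * p x)"
    using conv_idempotent_exists[OF a] by metis
  then have "projection p" by (simp add: projection_def)
  then obtain q where q: "projection q" "conv q p = q" "\<And>r. projection r \<Longrightarrow> conv q r = r \<Longrightarrow> r = q"
    using minimal_projection_exists by metis
  note Q = projectionD[OF q(1)]
  define \<eta> where "\<eta> x = q x / q 0" for x
  have \<eta>: "\<eta> \<in> dual_group"
    using minimal_projection_character[OF q(1,3)] by (simp add: \<eta>_def[abs_def])
  have q0: "q 0 \<noteq> 0" "cnj (q 0) = q 0" using Q(5,7) by auto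
  have q\<eta>: "q (x - y) = q x * cnj (\<eta> y)" for x y
  proof -
    have "\<eta> (x + (- y)) = \<eta> x * \<eta> (- y)" using \<eta> unfolding dual_group_def by blast
    moreover have "\<eta> (- y) = cnj (\<eta> y)"
      using fun_cong[OF Q(2), of "- y"] q0 by (simp add: \<eta>_def star_def)
    ultimately show ?thesis using q0 by (simp add: \<eta>_def field_simps)
  qed
  have "conv q h = (\<lambda>x. q x * fourier_coeff m h \<eta>)"
    unfolding conv_def q\<eta> fourier_coeff_def by (simp add: mult.assoc mult.commute[of "h _"])
  then have "conv h q = (\<lambda>x. 0)"
    using zero[OF \<eta>] conv_commute[OF Q(1) h] by simp
  then have "conv a q = (\<lambda>x. 0)"
    using conv_commute[OF h cont_star[OF h]] h Q(1) by (simp add: a_def conv_assoc)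
  then have "conv (conv a a) q = (\<lambda>x. 0)"
    by (simp add: conv_assoc a Q)
  moreover have "conv (conv a a) q = (\<lambda>x. of_real L * q x)"
  proof -
    \<comment> \<open>On everything below \<open>p\<close>, convolution with \<open>conv a a\<close>
      is multiplication by \<open>L\<close>.\<close>
    have "q = conv p q" using q(2) conv_commute[OF Q(1) p(1)] by simp
    then have "conv (conv a a) q = conv (conv (conv a a) p) q"
      using a p(1) Q(1) by (simp add: conv_assoc)
    also have "\<dots> = (\<lambda>x. of_real L * q x)"
      unfolding p(6) conv_scale_left \<open>q = conv p q\<close>[symmetric] ..
    finally show ?thesis .
  qed
  ultimately have "of_real L * q 0 = 0" by metis
  then show False using q0 p(5) by simp
qed

end

section \<open>Duality between the quotient norm and integrable functions\<close>

definition sublinear :: "('v::real_vector \<Rightarrow> real) \<Rightarrow> bool"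
  where "sublinear p \<longleftrightarrow> (\<forall>x y. p (x + y) \<le> p x + p y) \<and> (\<forall>r x. 0 \<le> r \<longrightarrow> p (r *\<^sub>R x) = r * p x)"

lemma sublinearD:
  assumes "sublinear p"
  shows "p (x + y) \<le> p x + p y" "0 \<le> r \<Longrightarrow> p (r *\<^sub>R x) = r * p x" "p 0 = 0" "- p (- x) \<le> p x"
proof -
  show add: "p (x + y) \<le> p x + p y" for x y using assms by (simp add: sublinear_def)
  show "0 \<le> r \<Longrightarrow> p (r *\<^sub>R x) = r * p x" for r x using assms by (simp add: sublinear_def)
  from this[of 0 0] show "p 0 = 0" by simp
  then show "- p (- x) \<le> p x" using add[of x "- x"] by simp
qed

text \<open>One inequality for scaling is enough, because scaling by \<open>1 / r\<close> reverses
  it.\<close>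

lemma sublinearI:
  assumes add: "\<And>x y. p (x + y) \<le> p x + p y" and zero: "p 0 = 0"
    and scale: "\<And>r x. 0 < r \<Longrightarrow> p (r *\<^sub>R x) \<le> r * p x"
  shows "sublinear p"
  unfolding sublinear_def
proof (intro conjI allI impI)
  fix r :: real and x assume "0 \<le> r"
  show "p (r *\<^sub>R x) = r * p x"
  proof (cases "r = 0")
    case True
    then show ?thesis by (simp add: zero)
  next
    case False
    then have "0 < r" using \<open>0 \<le> r\<close> by simp
    have "p x \<le> p (r *\<^sub>R x) / r"
      using scale[of "1 / r" "r *\<^sub>R x"] \<open>0 < r\<close> by simp
    then show ?thesis using scale[OF \<open>0 < r\<close>, of x] \<open>0 < r\<close> by (simp add: field_simps)
  qed
qed (rule add)

text \<open>\<open>p\<close> is pushed down along \<open>y\<close> until its value at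
  \<open>- y\<close> is what a linear functional agreeing with \<open>p\<close> at \<open>y\<close>
  would have. The infimum is finite since \<open>- p (- x)\<close> bounds every term from
  below.\<close>

lemma sublinear_shift:
  assumes p: "sublinear p"
  obtains q where "sublinear q" "q \<le> p" "q (- y) \<le> - p y"
proof -
  define q where "q x = (INF t\<in>{0..}. p (x + t *\<^sub>R y) - t * p y)" for x
  have bdd: "bdd_below ((\<lambda>t. p (x + t *\<^sub>R y) - t * p y) ` {0..})" for x
  proof (rule bdd_belowI2)
    fix t :: real assume "t \<in> {0..}"
    then show "- p (- x) \<le> p (x + t *\<^sub>R y) - t * p y"
      using sublinearD(1)[OF p, of "x + t *\<^sub>R y" "- x"] sublinearD(2)[OF p, of t y] by simp
  qed
  have le: "q x \<le> p (x + t *\<^sub>R y) - t * p y" if "0 \<le> t" for x t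
    unfolding q_def by (rule cINF_lower[OF bdd]) (use that in auto)
  have ge: "z \<le> q x" if "\<And>t. 0 \<le> t \<Longrightarrow> z \<le> p (x + t *\<^sub>R y) - t * p y" for x z
    unfolding q_def by (rule cINF_greatest) (use that in auto)
  have "sublinear q"
  proof (rule sublinearI)
    fix x1 x2
    have "q (x1 + x2) - (p (x2 + t *\<^sub>R y) - t * p y) \<le> q x1" if t: "0 \<le> t" for t
    proof (rule ge)
      fix s :: real assume s: "0 \<le> s"
      have "p (x1 + x2 + (s + t) *\<^sub>R y) \<le> p (x1 + s *\<^sub>R y) + p (x2 + t *\<^sub>R y)"
        using sublinearD(1)[OF p, of "x1 + s *\<^sub>R y" "x2 + t *\<^sub>R y"] by (simp add: algebra_simps)
      then show "q (x1 + x2) - (p (x2 + t *\<^sub>R y) - t * p y) \<le> p (x1 + s *\<^sub>R y) - s * p y"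
        using le[of "s + t" "x1 + x2"] s t by (simp add: algebra_simps)
    qed
    then have "q (x1 + x2) - q x1 \<le> q x2"
      by (intro ge) (simp add: algebra_simps)
    then show "q (x1 + x2) \<le> q x1 + q x2" by simp
  next
    have "q 0 \<le> 0" using le[of 0 0] sublinearD(3)[OF p] by simp
    moreover have "0 \<le> q 0" by (rule ge) (simp add: sublinearD(2)[OF p])
    ultimately show "q 0 = 0" by simp
  next
    fix r :: real and x assume r: "0 < r"
    have "q (r *\<^sub>R x) / r \<le> q x"
    proof (rule ge)
      fix t :: real assume "0 \<le> t"
      have "q (r *\<^sub>R x) \<le> p (r *\<^sub>R (x + t *\<^sub>R y)) - r * t * p y"
        using le[of "r * t" "r *\<^sub>R x"] r \<open>0 \<le> t\<close> by (simp add: algebra_simps)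
      then show "q (r *\<^sub>R x) / r \<le> p (x + t *\<^sub>R y) - t * p y"
        using r sublinearD(2)[OF p, of r "x + t *\<^sub>R y"] by (simp add: field_simps)
    qed
    then show "q (r *\<^sub>R x) \<le> r * q x" using r by (simp add: field_simps)
  qed
  moreover have "q \<le> p" using le[of 0] by (auto simp: le_fun_def)
  moreover have "q (- y) \<le> - p y" using le[of 1 "- y"] sublinearD(3)[OF p] by simp
  ultimately show thesis by (rule that)
qed

text \<open>Zorn's lemma for the reversed pointwise order. The infimum of a chain is finite because
  all members stay above \<open>- p (- x)\<close>.\<close>

lemma minimal_sublinear:
  assumes p: "sublinear p"
  obtains q where "sublinear q" "q \<le> p" "\<And>r. sublinear r \<Longrightarrow> r \<le> q \<Longrightarrow> r = q"
proof -
  define A where "A = {q. sublinear q \<and> q \<le> p}"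
  let ?P = "\<lambda>q r :: 'a \<Rightarrow> real. r \<le> q"
  have "\<exists>q\<in>A. \<forall>r\<in>A. ?P q r \<longrightarrow> r = q"
  proof (rule predicate_Zorn)
    show "partial_order_on A (relation_of ?P A)"
      by (rule partial_order_on_relation_ofI) auto
  next
    fix C assume "C \<in> Chains (relation_of ?P A)"
    then have CA: "C \<subseteq> A" and chain: "\<And>q r. q \<in> C \<Longrightarrow> r \<in> C \<Longrightarrow> q \<le> r \<or> r \<le> q"
      by (auto simp: Chains_def relation_of_def)
    show "\<exists>u\<in>A. \<forall>a\<in>C. u \<le> a"
    proof (cases "C = {}")
      case True
      then show ?thesis using p by (auto simp: A_def)
    next
      case False
      define u where "u x = (INF q\<in>C. q x)" for x
      have bdd: "bdd_below ((\<lambda>q. q x) ` C)" for x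
      proof (rule bdd_belowI2)
        fix q assume "q \<in> C"
        then have "sublinear q" "q (- x) \<le> p (- x)" using CA by (auto simp: A_def le_fun_def)
        then show "- p (- x) \<le> q x" using sublinearD(4)[of q x] by simp
      qed
      have le: "u x \<le> q x" if "q \<in> C" for x q
        unfolding u_def by (rule cINF_lower[OF bdd that])
      have ge: "z \<le> u x" if "\<And>q. q \<in> C \<Longrightarrow> z \<le> q x" for z x
        unfolding u_def by (rule cINF_greatest[OF False that])
      have sub: "sublinear q" if "q \<in> C" for q using that CA by (auto simp: A_def)
      have "sublinear u"
      proof (rule sublinearI)
        fix x y
        \<comment> \<open>Subadditivity of the infimum uses the chain condition: \<open>q\<close>
          and \<open>r\<close> are both replaced by the smaller one.\<close>
        have both: "u (x + y) \<le> q x + r y" if "q \<in> C" "r \<in> C" for q r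
        proof -
          obtain s where s: "s \<in> C" "s \<le> q" "s \<le> r" using chain[of q r] \<open>q \<in> C\<close> \<open>r \<in> C\<close> by blast
          have "u (x + y) \<le> s x + s y"
            using le[OF s(1), of "x + y"] sublinearD(1)[OF sub[OF s(1)], of x y] by simp
          then show ?thesis using s(2,3) by (meson add_mono le_funD order_trans)
        qed
        have "u (x + y) - r y \<le> u x" if "r \<in> C" for r
          using both[OF _ that] by (intro ge) (simp add: algebra_simps)
        then have "u (x + y) - u x \<le> u y" by (intro ge) (simp add: algebra_simps)
        then show "u (x + y) \<le> u x + u y" by simp
      next
        obtain q where "q \<in> C" using False by blast
        then have "u 0 \<le> 0" using le[of q 0] sublinearD(3)[OF sub[of q]] by simp
        moreover have "0 \<le> u 0" by (rule ge) (simp add: sublinearD(3)[OF sub])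
        ultimately show "u 0 = 0" by simp
      next
        fix r :: real and x assume r: "0 < r"
        have "u (r *\<^sub>R x) / r \<le> u x"
        proof (rule ge)
          fix q assume "q \<in> C"
          then show "u (r *\<^sub>R x) / r \<le> q x"
            using le[of q "r *\<^sub>R x"] sublinearD(2)[OF sub, of q r x] r by (simp add: field_simps)
        qed
        then show "u (r *\<^sub>R x) \<le> r * u x" using r by (simp add: field_simps)
      qed
      moreover have "u \<le> p"
      proof -
        obtain q where "q \<in> C" using False by blast
        then have "u \<le> q" "q \<le> p" using le CA by (auto simp: A_def le_fun_def)
        then show ?thesis by (rule order_trans)
      qed
      ultimately show ?thesis using le by (auto simp: A_def le_fun_def)
    qed
  qed
  then obtain q where q: "q \<in> A" "\<And>r. r \<in> A \<Longrightarrow> r \<le> q \<Longrightarrow> r = q" by blast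
  show thesis by (rule that[of q]) (use q in \<open>auto simp: A_def intro: order_trans\<close>)
qed

text \<open>A minimal sublinear functional is odd, since it equals each of its shifts, and hence linear.\<close>

theorem hahn_banach_sublinear:
  assumes p: "sublinear (p :: 'v::real_vector \<Rightarrow> real)"
  obtains f where "linear f" "\<And>x. f x \<le> p x" "f x0 = p x0"
proof -
  \<comment> \<open>Shifting along \<open>x0\<close> before minimizing is what forces equality at
    \<open>x0\<close>.\<close>
  obtain p0 where p0: "sublinear p0" "p0 \<le> p" "p0 (- x0) \<le> - p x0"
    using sublinear_shift[OF p] .
  obtain f where f: "sublinear f" "f \<le> p0" "\<And>r. sublinear r \<Longrightarrow> r \<le> f \<Longrightarrow> r = f"
    using minimal_sublinear[OF p0(1)] by metis
  have odd: "f (- y) = - f y" for y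
  proof -
    obtain q where q: "sublinear q" "q \<le> f" "q (- y) \<le> - f y"
      using sublinear_shift[OF f(1)] .
    then have "f (- y) \<le> - f y" using f(3) by metis
    then show ?thesis using sublinearD(4)[OF f(1), of y] by simp
  qed
  have "f (x + y) = f x + f y" for x y
    using sublinearD(1)[OF f(1), of x y] sublinearD(1)[OF f(1), of "x + y" "- y"] odd[of y] by simp
  moreover have "f (r *\<^sub>R x) = r *\<^sub>R f x" for r x
    using sublinearD(2)[OF f(1), of r x] sublinearD(2)[OF f(1), of "- r" x] odd[of "r *\<^sub>R x"]
    by (cases "0 \<le> r") auto
  ultimately have "linear f" by (rule linearI)
  moreover have le: "f x \<le> p x" for x using f(2) p0(2) by (meson le_funD order_trans)
  moreover have "f x0 = p x0"
    using le[of x0] odd[of x0] p0(3) f(2) by (simp add: le_fun_def) (smt (verit))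
  ultimately show thesis by (rule that)
qed

text \<open>\<open>cnj (sgn z)\<close> is the phase that turns \<open>z\<close> into its modulus;
  with \<open>sgn 0 = 0\<close> it is bounded by 1 everywhere.\<close>

lemma cnj_sgn_mult: "cnj (sgn z) * z = of_real (cmod z)"
proof (cases "z = 0")
  case False
  have "cnj z * z = of_real (cmod z) * of_real (cmod z)"
    using complex_norm_square[of z] by (simp add: power2_eq_square mult.commute)
  then show ?thesis using False by (simp add: sgn_eq)
qed simp

section \<open>Separation and norming functionals\<close>

context compact_haar
begin

lemma urysohn:
  fixes S T :: "'g set"
  assumes "closed S" "closed T" "S \<inter> T = {}"
  obtains f :: "'g \<Rightarrow> real" where "continuous_on UNIV f" "\<And>x. 0 \<le> f x" "\<And>x. f x \<le> 1"
    "\<And>x. x \<in> S \<Longrightarrow> f x = 0" "\<And>x. x \<in> T \<Longrightarrow> f x = 1"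
proof -
  have "compact_space (euclidean :: 'g topology)"
    using compact_UNIV by (simp add: compact_space_def compactin_euclidean_iff)
  moreover have "Hausdorff_space (euclidean :: 'g topology)"
    by (simp add: Hausdorff_space_def) (metis disjnt_def hausdorff)
  ultimately have "normal_space (euclidean :: 'g topology)"
    using compact_Hausdorff_or_regular_imp_normal_space by blast
  then obtain f :: "'g \<Rightarrow> real" where
    f: "continuous_map euclidean (top_of_set {0..1}) f" "f ` S \<subseteq> {0}" "f ` T \<subseteq> {1}"
    using iffD1[OF normal_space_iff_Urysohn, rule_format, of euclidean S T] assms
    by (auto simp: disjnt_def)
  show thesis
    by (rule that[of f]) (use f in \<open>auto simp: continuous_map_in_subtopology image_subset_iff\<close>)
qed

text \<open>The real Hahn-Banach theorem is applied to the distance from \<open>S\<close>, which is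
  0 on \<open>S\<close> and at least \<open>d\<close> at \<open>f0\<close>. Bounded continuous
  functions serve as a vector space type with the sup norm.\<close>

lemma hahn_banach_C:
  assumes S: "\<And>s. s \<in> S \<Longrightarrow> cont s" "(\<lambda>x. 0) \<in> S"
    "\<And>s t. s \<in> S \<Longrightarrow> t \<in> S \<Longrightarrow> (\<lambda>x. s x + t x) \<in> S" "\<And>c s. s \<in> S \<Longrightarrow> (\<lambda>x. c * s x) \<in> S"
    and f0: "cont f0" and d: "\<And>s M. s \<in> S \<Longrightarrow> (\<And>x. cmod (f0 x - s x) \<le> M) \<Longrightarrow> d \<le> M"
  obtains \<Phi> where "C_functional \<Phi> 1" "\<And>s. s \<in> S \<Longrightarrow> \<Phi> s = 0" "d \<le> Re (\<Phi> f0)"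
proof -
  define B where "B f = Bcontfun f" for f :: "'g \<Rightarrow> complex"
  have B: "apply_bcontfun (B f) = f" if "cont f" for f
  proof -
    have "f \<in> bcontfun"
      using continuous_bounded[OF that] by (metis bcontfun_normI that)
    then show ?thesis unfolding B_def by (rule Bcontfun_inverse)
  qed
  have B_add: "B (\<lambda>x. f x + g x) = B f + B g" if "cont f" "cont g" for f g
    using that by (intro bcontfun_eqI) (simp add: B continuous_intros)
  have B_scale: "B (\<lambda>x. of_real r * f x) = r *\<^sub>R B f" if "cont f" for r f
    using that by (intro bcontfun_eqI) (simp add: B continuous_intros scaleR_conv_of_real)
  define p where "p F = (INF s\<in>S. norm (F - B s))" for F
  have bdd: "bdd_below ((\<lambda>s. norm (F - B s)) ` S)" for F
    by (rule bdd_belowI2[of _ 0]) simp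
  have le: "p F \<le> norm (F - B s)" if "s \<in> S" for F s
    unfolding p_def by (rule cINF_lower[OF bdd that])
  have ge: "z \<le> p F" if "\<And>s. s \<in> S \<Longrightarrow> z \<le> norm (F - B s)" for z F
    unfolding p_def using S(2) that by (intro cINF_greatest) auto
  have B0: "B (\<lambda>x. 0) = 0" by (intro bcontfun_eqI) (simp add: B)
  have p_norm: "p F \<le> norm F" for F using le[OF S(2), of F] by (simp add: B0)
  have "sublinear p"
  proof (rule sublinearI)
    fix F G
    have "p (F + G) - norm (G - B t) \<le> p F" if t: "t \<in> S" for t
    proof (rule ge)
      fix s assume s: "s \<in> S"
      have "p (F + G) \<le> norm ((F - B s) + (G - B t))"
        using le[OF S(3)[OF s t], of "F + G"] by (simp add: B_add S(1) s t algebra_simps)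
      also have "\<dots> \<le> norm (F - B s) + norm (G - B t)" by (rule norm_triangle_ineq)
      finally show "p (F + G) - norm (G - B t) \<le> norm (F - B s)" by simp
    qed
    then have "p (F + G) - p F \<le> p G" by (intro ge) (simp add: algebra_simps)
    then show "p (F + G) \<le> p F + p G" by simp
  next
    show "p 0 = 0" using p_norm[of 0] ge[of 0 0] by simp
  next
    fix r :: real and F assume r: "0 < r"
    have "p (r *\<^sub>R F) / r \<le> p F"
    proof (rule ge)
      fix s assume s: "s \<in> S"
      have "p (r *\<^sub>R F) \<le> norm (r *\<^sub>R (F - B s))"
        using le[OF S(4)[OF s, of "of_real r"], of "r *\<^sub>R F"] by (simp add: B_scale S(1) s algebra_simps)
      also have "\<dots> = r * norm (F - B s)" using r by simp
      finally show "p (r *\<^sub>R F) / r \<le> norm (F - B s)" using r by (simp add: field_simps)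
    qed
    then show "p (r *\<^sub>R F) \<le> r * p F" using r by (simp add: field_simps)
  qed
  then obtain u where u: "linear u" "\<And>F. u F \<le> p F" "u (B f0) = p (B f0)"
    using hahn_banach_sublinear by metis
  \<comment> \<open>The complex-linear functional whose real part is \<open>u\<close>.\<close>
  define \<Phi> where "\<Phi> f = Complex (u (B f)) (- u (B (\<lambda>x. \<i> * f x)))" for f
  have u_add: "u (B (\<lambda>x. f x + g x)) = u (B f) + u (B g)" if "cont f" "cont g" for f g
    using that by (simp add: B_add linear_add[OF u(1)])
  have u_scale: "u (B (\<lambda>x. of_real r * f x)) = r * u (B f)" if "cont f" for f r
    using that by (simp add: B_scale linear_scale[OF u(1)])
  have u_complex: "u (B (\<lambda>x. c * f x)) = Re c * u (B f) + Im c * u (B (\<lambda>x. \<i> * f x))" if f: "cont f" for f c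
  proof -
    have "(\<lambda>x. c * f x) = (\<lambda>x. of_real (Re c) * f x + of_real (Im c) * (\<i> * f x))"
      by (subst complex_eq[of c]) (simp add: algebra_simps)
    then show ?thesis using f by (simp only: u_add u_scale continuous_intros)
  qed
  have scale: "\<Phi> (\<lambda>x. c * f x) = c * \<Phi> f" if f: "cont f" for f c
    using u_complex[OF f, of c] u_complex[OF f, of "\<i> * c"]
    by (simp add: \<Phi>_def complex_eq_iff mult.assoc)
  have bound: "cmod (\<Phi> f) \<le> M" if f: "cont f" and M: "\<And>x. cmod (f x) \<le> M" for f M
  proof (cases "\<Phi> f = 0")
    case True
    then show ?thesis using order_trans[OF norm_ge_zero M] by simp
  next
    case False
    \<comment> \<open>After this rotation the value is real, so the bound for the real part
      \<open>u\<close> is a bound for the modulus.\<close>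
    define c where "c = cnj (sgn (\<Phi> f))"
    have c: "cmod c = 1" "c * \<Phi> f = cmod (\<Phi> f)"
      using False cnj_sgn_mult[of "\<Phi> f"] by (simp_all add: c_def norm_sgn)
    have "cmod (\<Phi> f) = Re (\<Phi> (\<lambda>x. c * f x))" using c scale[OF f] by simp
    also have "\<dots> = u (B (\<lambda>x. c * f x))" by (simp add: \<Phi>_def)
    also have "\<dots> \<le> norm (B (\<lambda>x. c * f x))" using u(2) p_norm order_trans by blast
    also have "\<dots> \<le> M"
      using M c f by (intro norm_bound) (simp add: B continuous_intros norm_mult)
    finally show ?thesis .
  qed
  have "C_functional \<Phi> 1"
    unfolding C_functional_def
  proof (intro conjI allI impI)
    fix f g assume "cont f" "cont g"
    then show "\<Phi> (\<lambda>x. f x + g x) = \<Phi> f + \<Phi> g"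
      using u_add[of "\<lambda>x. \<i> * f x" "\<lambda>x. \<i> * g x"]
      by (simp add: \<Phi>_def u_add complex_eq_iff distrib_left continuous_intros)
  qed (use scale bound in auto)
  moreover have "\<Phi> s = 0" if s: "s \<in> S" for s
  proof -
    have nonpos: "u (B t) \<le> 0" if "t \<in> S" for t
      using u(2)[of "B t"] le[OF that, of "B t"] by simp
    have zero: "u (B t) = 0" if t: "t \<in> S" for t
      using nonpos[OF t] nonpos[OF S(4)[OF t, of "-1"]] u_scale[OF S(1)[OF t], of "-1"] by simp
    show ?thesis using zero[OF s] zero[OF S(4)[OF s, of \<i>]] by (simp add: \<Phi>_def complex_eq_iff)
  qed
  moreover have "d \<le> Re (\<Phi> f0)"
  proof -
    have "d \<le> norm (B f0 - B s)" if "s \<in> S" for s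
      using norm_bounded[of "B f0 - B s"] f0 S(1)[OF that] by (intro d[OF that]) (simp add: B)
    then have "d \<le> p (B f0)" by (rule ge)
    then show ?thesis by (simp add: \<Phi>_def u(3))
  qed
  ultimately show thesis by (rule that)
qed

end

section \<open>Characters, Fourier coefficients and smoothing\<close>

lemma dual_groupD:
  assumes "\<gamma> \<in> dual_group"
  shows "continuous_on UNIV \<gamma>" "cmod (\<gamma> x) = 1" "\<gamma> (x + y) = \<gamma> x * \<gamma> y" "\<gamma> (x - y) = \<gamma> x * cnj (\<gamma> y)"
    "\<gamma> x * cnj (\<gamma> x) = 1"
proof -
  show "continuous_on UNIV \<gamma>" and norm: "cmod (\<gamma> x) = 1" and mult: "\<gamma> (x + y) = \<gamma> x * \<gamma> y" for x y
    using assms by (auto simp: dual_group_def)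
  show unit: "\<gamma> x * cnj (\<gamma> x) = 1" for x
    using complex_norm_square[of "\<gamma> x"] norm[of x] by simp
  have "\<gamma> (x - y) * \<gamma> y = \<gamma> x" using mult[of "x - y" y] by simp
  then have "\<gamma> (x - y) * (\<gamma> y * cnj (\<gamma> y)) = \<gamma> x * cnj (\<gamma> y)" by (metis mult.assoc)
  then show "\<gamma> (x - y) = \<gamma> x * cnj (\<gamma> y)" by (simp add: unit)
qed

lemma borel_measurable_cnj_sgn:
  fixes f :: "'a \<Rightarrow> complex"
  assumes [measurable]: "f \<in> borel_measurable M"
  shows "(\<lambda>x. cnj (sgn (f x))) \<in> borel_measurable M"
proof -
  have [measurable]: "cnj \<in> borel_measurable borel"
    by (intro borel_measurable_continuous_onI continuous_intros)
  show ?thesis unfolding sgn_div_norm by measurable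
qed

lemma cnj_dual_group: "\<gamma> \<in> dual_group \<Longrightarrow> (\<lambda>x. cnj (\<gamma> x)) \<in> dual_group"
  by (auto simp: dual_group_def continuous_intros)

context compact_haar
begin

text \<open>Translation by \<open>a\<close> multiplies the integral by \<open>\<gamma> a\<close> and
  leaves it unchanged.\<close>

lemma integral_character_eq_0:
  assumes "\<gamma> \<in> dual_group" "\<gamma> \<noteq> (\<lambda>x. 1)"
  shows "(LINT x|m. \<gamma> x) = 0"
proof -
  obtain a where a: "\<gamma> a \<noteq> 1" using assms(2) by auto
  have "(LINT x|m. \<gamma> (a + x)) = (LINT x|m. \<gamma> x)"
    by (rule integral_translation[OF measurable_continuous[OF dual_groupD(1)[OF assms(1)]]])
  then have "(\<gamma> a - 1) * (LINT x|m. \<gamma> x) = 0"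
    by (simp add: dual_groupD(3)[OF assms(1)] algebra_simps)
  then show ?thesis using a by simp
qed

lemma fourier_coeff_character:
  assumes "\<gamma> \<in> dual_group" "\<delta> \<in> dual_group" "\<gamma> \<noteq> \<delta>"
  shows "fourier_coeff m \<delta> \<gamma> = 0"
  unfolding fourier_coeff_def
proof (rule integral_character_eq_0)
  show "(\<lambda>x. \<delta> x * cnj (\<gamma> x)) \<in> dual_group"
    using assms(1,2) by (auto simp: dual_group_def norm_mult intro!: continuous_intros)
  show "(\<lambda>x. \<delta> x * cnj (\<gamma> x)) \<noteq> (\<lambda>x. 1)"
  proof
    assume eq: "(\<lambda>x. \<delta> x * cnj (\<gamma> x)) = (\<lambda>x. 1)"
    have "\<delta> x = \<gamma> x" for x
    proof -
      have "\<delta> x = (\<delta> x * cnj (\<gamma> x)) * \<gamma> x"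
        using dual_groupD(5)[OF assms(1), of x] by (simp add: mult.assoc mult.commute[of "cnj _"])
      then show ?thesis using fun_cong[OF eq, of x] by simp
    qed
    then show False using assms(3) by auto
  qed
qed

text \<open>A Parseval formula with all terms 0. The correlation \<open>h\<close> of
  \<open>f\<close> with \<open>g\<close> is continuous even if \<open>g\<close> is only integrable;
  its coefficient at \<gamma> is the product of those of \<open>f\<close> at \<gamma> and of
  \<open>g\<close> at the inverse of \<gamma>. Uniqueness gives \<open>h = 0\<close>, in particular
  at 0.\<close>

lemma integral_product_eq_0:
  fixes f g :: "'g \<Rightarrow> complex"
  assumes f: "cont f" and g: "integrable m g"
    and zero: "\<And>\<gamma>. \<gamma> \<in> dual_group \<Longrightarrow> fourier_coeff m f \<gamma> = 0 \<or> fourier_coeff m g (\<lambda>x. cnj (\<gamma> x)) = 0"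
  shows "(LINT x|m. f x * g x) = 0"
proof -
  define h where "h t = (LINT x|m. f (x + t) * g x)" for t
  have F: "continuous_on UNIV (\<lambda>p::'g \<times> 'g. f (snd p + fst p))"
    by (rule continuous_on_compose2[OF f]) (auto intro!: continuous_intros)
  have "cont h"
    unfolding h_def using continuous_integral_right[OF F g] by simp
  moreover have "fourier_coeff m h \<gamma> = 0" if \<gamma>: "\<gamma> \<in> dual_group" for \<gamma>
  proof -
    note \<gamma>D = dual_groupD[OF \<gamma>]
    have c: "cont (\<lambda>x. cnj (\<gamma> x))" by (intro continuous_intros \<gamma>D)
    have inner: "(LINT t|m. f (x + t) * cnj (\<gamma> t)) = fourier_coeff m f \<gamma> * \<gamma> x" for x
    proof -
      have "cont (\<lambda>t. f t * cnj (\<gamma> (t - x)))" by (intro continuous_intros f cont_translate \<gamma>D)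
      from integral_translation[OF measurable_continuous[OF this], of x]
      have "(LINT t|m. f (x + t) * cnj (\<gamma> t)) = (LINT t|m. f t * cnj (\<gamma> (t - x)))" by simp
      also have "\<dots> = (LINT t|m. (f t * cnj (\<gamma> t)) * \<gamma> x)" by (simp add: \<gamma>D(4) mult.assoc)
      finally show ?thesis by (simp add: fourier_coeff_def)
    qed
    have "fourier_coeff m h \<gamma> = (LINT t|m. (LINT x|m. f (x + t) * g x) * cnj (\<gamma> t))"
      by (simp add: fourier_coeff_def h_def)
    also have "\<dots> = (LINT x|m. (LINT t|m. f (x + t) * cnj (\<gamma> t)) * g x)"
      using fubini_weighted[OF F g integrable_continuous[OF c]] by simp
    also have "\<dots> = (LINT x|m. fourier_coeff m f \<gamma> * (g x * cnj (cnj (\<gamma> x))))"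
      unfolding inner by (simp add: mult.assoc mult.commute[of "\<gamma> _"])
    also have "\<dots> = fourier_coeff m f \<gamma> * fourier_coeff m g (\<lambda>x. cnj (\<gamma> x))"
      unfolding fourier_coeff_def by (rule integral_mult_right_zero)
    finally show ?thesis using zero[OF \<gamma>] by auto
  qed
  ultimately have "h = (\<lambda>x. 0)" by (rule fourier_unique)
  from fun_cong[OF this, of 0] show ?thesis by (simp add: h_def)
qed

lemma approximate_identity:
  assumes f: "cont f" and "0 < e"
  obtains k :: "'g \<Rightarrow> real" where "continuous_on UNIV k" "\<And>x. 0 \<le> k x" "(LINT x|m. k x) = 1"
    "\<And>t. cmod ((LINT x|m. of_real (k (t - x)) * f x) - f t) \<le> e"
proof -
  have F: "continuous_on UNIV (\<lambda>p::'g \<times> 'g. f (fst p - snd p))" by (rule cont_compose_diff[OF f])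
  obtain V where V: "open V" "0 \<in> V" "\<And>t y. y \<in> V \<Longrightarrow> dist (f (t - y)) (f (t - 0)) < e"
  proof (rule tube_metric[OF compact_UNIV F \<open>0 < e\<close>, of 0])
    fix V assume V: "open V" "0 \<in> V"
      "\<And>x y. y \<in> V \<Longrightarrow> dist (f (fst (x, y) - snd (x, y))) (f (fst (x, 0) - snd (x, 0))) < e"
    show thesis by (rule that[OF V(1,2)]) (use V(3) in simp)
  qed
  obtain j :: "'g \<Rightarrow> real" where j: "continuous_on UNIV j" "\<And>x. 0 \<le> j x" "\<And>x. j x \<le> 1"
    "\<And>x. x \<in> - V \<Longrightarrow> j x = 0" "\<And>x. x \<in> {0} \<Longrightarrow> j x = 1"
    using urysohn[of "- V" "{0}"] V by auto
  define J where "J = (LINT x|m. j x)"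
  \<comment> \<open>As \<open>j\<close> takes values between 0 and 1, its integral dominates that of
    its square, which vanishes only for \<open>j = 0\<close>.\<close>
  have "0 < J"
  proof -
    have c: "cont (\<lambda>x. of_real (j x))" by (intro continuous_intros j)
    have "(\<lambda>x. complex_of_real (j x)) \<noteq> (\<lambda>x. 0)" using j(5)[of 0] by (auto simp: fun_eq_iff intro!: exI[of _ 0])
    then have "0 < sqnorm (\<lambda>x. of_real (j x))"
      using sqnorm_eq_0[OF c] sqnorm_nonneg[of "\<lambda>x. of_real (j x)"] by force
    also have "\<dots> \<le> J"
      unfolding sqnorm_def J_def using j
      by (intro integral_mono integrable_continuous continuous_intros) (auto simp: power2_eq_square mult_left_le)
    finally show ?thesis .
  qed
  define k where "k x = j x / J" for x
  have k: "continuous_on UNIV k" "0 \<le> k x" "x \<notin> V \<Longrightarrow> k x = 0" for x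
    using j \<open>0 < J\<close> by (auto simp: k_def intro!: continuous_intros)
  have k1: "(LINT x|m. k x) = 1" using \<open>0 < J\<close> by (simp add: k_def J_def)
  show thesis
  proof (rule that[OF k(1,2) k1])
    fix t
    let ?k = "\<lambda>x. complex_of_real (k x)"
    have c: "cont ?k" by (intro continuous_intros k)
    have int: "integrable m (\<lambda>y. f (t - y) * ?k y)" "integrable m (\<lambda>y. f t * ?k y)"
      by (intro integrable_continuous continuous_intros cont_reflect f c k)+
    have "(LINT x|m. ?k (t - x) * f x) = (LINT y|m. f (t - y) * ?k y)"
      using fun_cong[OF conv_commute[OF c f], of t] by (simp add: conv_def)
    moreover have "f t = (LINT y|m. f t * ?k y)"
      using k1 by simp
    ultimately have "(LINT x|m. ?k (t - x) * f x) - f t = (LINT y|m. f (t - y) * ?k y - f t * ?k y)"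
      using int by simp
    also have "cmod \<dots> \<le> (LINT y|m. cmod (f (t - y) * ?k y - f t * ?k y))"
      by (rule integral_norm_bound)
    also have "\<dots> \<le> (LINT y|m. e * k y)"
    proof (intro integral_mono integrable_norm Bochner_Integration.integrable_diff int)
      show "integrable m (\<lambda>y. e * k y)" by (intro integrable_continuous continuous_intros k)
      fix y
      have "cmod (f (t - y) * ?k y - f t * ?k y) = dist (f (t - y)) (f (t - 0)) * k y"
        using k(2)[of y] by (simp add: dist_norm norm_mult flip: left_diff_distrib)
      also have "\<dots> \<le> e * k y"
        using V(3)[of y t] k(2)[of y] k(3)[of y] by (cases "y \<in> V") (auto intro!: mult_right_mono)
      finally show "cmod (f (t - y) * ?k y - f t * ?k y) \<le> e * k y" .
    qed
    also have "\<dots> = e" using k1 by simp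
    finally show "cmod ((LINT x|m. ?k (t - x) * f x) - f t) \<le> e" .
  qed
qed

text \<open>The function \<open>g\<close> is the density of the measure \<Phi> convolved with a
  reflected bump. Characters are eigenvectors of convolution, so the result still kills \<Lambda>;
  the norm does not increase, and an approximate identity adapted to \<open>f\<close> nearly keeps
  the value at \<open>f\<close>.\<close>

lemma functional_smoothing:
  assumes \<Phi>: "C_functional \<Phi> 1" and \<Lambda>: "\<Lambda> \<subseteq> dual_group" "\<And>\<gamma>. \<gamma> \<in> \<Lambda> \<Longrightarrow> \<Phi> \<gamma> = 0"
    and f: "cont f" and e: "0 < e"
  obtains g where "cont g" "(LINT x|m. cmod (g x)) \<le> 1" "\<And>\<gamma>. \<gamma> \<in> \<Lambda> \<Longrightarrow> (LINT x|m. g x * \<gamma> x) = 0"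
    "cmod ((LINT x|m. f x * g x) - \<Phi> f) \<le> e"
proof -
  obtain k :: "'g \<Rightarrow> real" where k: "continuous_on UNIV k" "\<And>x. 0 \<le> k x" "(LINT x|m. k x) = 1"
    "\<And>t. cmod ((LINT x|m. of_real (k (t - x)) * f x) - f t) \<le> e"
    using approximate_identity[OF f e] by metis
  let ?k = "\<lambda>x. complex_of_real (k x)"
  have c: "cont ?k" by (intro continuous_intros k)
  note F = cont_compose_diff[OF c]
  define g where "g x = \<Phi> (\<lambda>t. ?k (t - x))" for x
  have g: "cont g" unfolding g_def using continuous_functional[OF compact_UNIV F \<Phi>] by simp
  have swap: "\<Phi> (\<lambda>t. LINT x|m. ?k (t - x) * u x) = (LINT x|m. g x * u x)" if "integrable m u" for u
    unfolding g_def using functional_integral_swap[OF compact_UNIV F \<Phi> that] by simp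
  have cu: "cont (\<lambda>t. LINT x|m. ?k (t - x) * u x)" if "integrable m u" for u
    using continuous_integral_right[OF F that] by simp
  have k_translate: "(LINT x|m. ?k (t - x)) = 1" for t
    using integral_reflect_translate[OF c, of t] k(3) by simp
  have "(LINT x|m. cmod (g x)) \<le> 1"
  proof -
    \<comment> \<open>The phase of \<open>g\<close> is only measurable, but its convolution with
      \<open>k\<close> is a continuous function bounded by 1, to which \<Phi> applies.\<close>
    define u where "u x = cnj (sgn (g x))" for x
    have u: "u \<in> borel_measurable m" "\<And>x. cmod (u x) \<le> 1"
      using borel_measurable_cnj_sgn[OF measurable_continuous[OF g]] by (auto simp: u_def[abs_def] norm_sgn)
    have ui: "integrable m u" by (rule integrable_bounded[OF u])
    have "complex_of_real (LINT x|m. cmod (g x)) = (LINT x|m. g x * u x)"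
      unfolding u_def by (simp add: mult.commute[of "g _"] cnj_sgn_mult)
    also have "\<dots> = \<Phi> (\<lambda>t. LINT x|m. ?k (t - x) * u x)" using swap[OF ui] by simp
    also have "cmod \<dots> \<le> 1 * 1"
    proof (rule C_functional_bound[OF \<Phi> cu[OF ui]])
      fix t
      have "cmod (LINT x|m. ?k (t - x) * u x) = cmod (LINT x|m. u x * ?k (t - x))" by (simp add: mult.commute)
      also have "\<dots> \<le> 1 * (LINT x|m. cmod (?k (t - x)))"
        by (intro integral_bounded_mult_le u integrable_continuous cont_reflect c)
      also have "complex_of_real (LINT x|m. cmod (?k (t - x))) = 1"
        using k_translate[of t] k(2) by simp
      then have "(LINT x|m. cmod (?k (t - x))) = 1" by (simp only: of_real_eq_1_iff)
      finally show "cmod (LINT x|m. ?k (t - x) * u x) \<le> 1" by simp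
    qed
    finally show ?thesis by simp
  qed
  moreover have "(LINT x|m. g x * \<gamma> x) = 0" if "\<gamma> \<in> \<Lambda>" for \<gamma>
  proof -
    have \<gamma>: "\<gamma> \<in> dual_group" using that \<Lambda> by auto
    note \<gamma>D = dual_groupD[OF \<gamma>]
    have "(LINT x|m. ?k (t - x) * \<gamma> x) = (LINT y|m. ?k y * cnj (\<gamma> y)) * \<gamma> t" for t
    proof -
      have "(LINT x|m. ?k (t - x) * \<gamma> x) = (LINT y|m. \<gamma> (t - y) * ?k y)"
        using fun_cong[OF conv_commute[OF c \<gamma>D(1)], of t] by (simp add: conv_def)
      also have "\<dots> = (LINT y|m. (?k y * cnj (\<gamma> y)) * \<gamma> t)" by (simp add: \<gamma>D(4) ac_simps)
      finally show ?thesis by (simp only: integral_mult_left_zero)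
    qed
    then have "\<Phi> (\<lambda>t. LINT x|m. ?k (t - x) * \<gamma> x) = 0"
      using C_functional_scale[OF \<Phi> \<gamma>D(1)] \<Lambda>(2)[OF that] by simp
    then show ?thesis using swap[OF integrable_continuous[OF \<gamma>D(1)]] by simp
  qed
  moreover have "cmod ((LINT x|m. f x * g x) - \<Phi> f) \<le> e"
  proof -
    have fi: "integrable m f" using f by auto
    have "(LINT x|m. f x * g x) - \<Phi> f = \<Phi> (\<lambda>t. (LINT x|m. ?k (t - x) * f x) - f t)"
      using swap[OF fi] C_functional_diff[OF \<Phi> cu[OF fi] f] by (simp add: mult.commute)
    then show ?thesis
      using C_functional_bound[OF \<Phi> _ k(4)] cu[OF fi] f by (simp add: continuous_intros)
  qed
  ultimately show thesis using that g by blast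
qed

lemma C_spectral_cont: "f \<in> C_spectral m \<Theta> \<Longrightarrow> cont f"
  by (simp add: C_spectral_def C_space_def)

lemma fourier_coeff_add:
  assumes "integrable m f" "integrable m g" "\<gamma> \<in> dual_group"
  shows "fourier_coeff m (\<lambda>x. f x + g x) \<gamma> = fourier_coeff m f \<gamma> + fourier_coeff m g \<gamma>"
proof -
  have "cont (\<lambda>x. cnj (\<gamma> x))" by (intro continuous_intros dual_groupD assms)
  then have "integrable m (\<lambda>x. u x * cnj (\<gamma> x))" if "integrable m u" for u
    using integrable_continuous_mult[of "\<lambda>x. cnj (\<gamma> x)" u] that by (simp add: mult.commute)
  then show ?thesis using assms(1,2) by (simp add: fourier_coeff_def distrib_right)
qed

lemma fourier_coeff_scale: "fourier_coeff m (\<lambda>x. c * f x) \<gamma> = c * fourier_coeff m f \<gamma>"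
  by (simp add: fourier_coeff_def mult.assoc)

lemma C_spectral_add: "f \<in> C_spectral m \<Theta> \<Longrightarrow> g \<in> C_spectral m \<Theta> \<Longrightarrow> (\<lambda>x. f x + g x) \<in> C_spectral m \<Theta>"
  by (auto simp: C_spectral_def C_space_def fourier_coeff_add integrable_continuous continuous_intros)

lemma C_spectral_scale: "f \<in> C_spectral m \<Theta> \<Longrightarrow> (\<lambda>x. c * f x) \<in> C_spectral m \<Theta>"
  by (auto simp: C_spectral_def C_space_def fourier_coeff_scale continuous_intros)

lemma C_spectral_zero: "(\<lambda>x. 0) \<in> C_spectral m \<Theta>"
  by (auto simp: C_spectral_def C_space_def fourier_coeff_def)

lemma character_in_C_spectral: "\<Lambda> \<subseteq> dual_group \<Longrightarrow> \<gamma> \<in> \<Lambda> \<Longrightarrow> \<gamma> \<in> C_spectral m \<Lambda>"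
  using dual_groupD(1)[of \<gamma>] fourier_coeff_character[of _ \<gamma>] by (auto simp: C_spectral_def C_space_def)

text \<open>\<open>d\<close> stands for the quotient norm of \<open>f\<close>, given as a lower
  bound for all uniform distances to the subspace. The dual functional itself attains
  \<open>d\<close>; the loss \<open>e\<close> comes from smoothing it.\<close>

theorem quotient_norm_attained_L1:
  assumes \<Lambda>: "\<Lambda> \<subseteq> dual_group" and f: "cont f" and e: "0 < e"
    and d: "\<And>s M. s \<in> C_spectral m \<Lambda> \<Longrightarrow> (\<And>x. cmod (f x - s x) \<le> M) \<Longrightarrow> d \<le> M"
  obtains g where "cont g" "(LINT x|m. cmod (g x)) \<le> 1" "\<And>\<gamma>. \<gamma> \<in> \<Lambda> \<Longrightarrow> (LINT x|m. g x * \<gamma> x) = 0"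
    "d - e \<le> Re (LINT x|m. f x * g x)"
proof -
  obtain \<Phi> where \<Phi>: "C_functional \<Phi> 1" "\<And>s. s \<in> C_spectral m \<Lambda> \<Longrightarrow> \<Phi> s = 0" "d \<le> Re (\<Phi> f)"
  proof (rule hahn_banach_C[of "C_spectral m \<Lambda>" f d])
    fix \<Phi> assume "C_functional \<Phi> 1" "\<And>s. s \<in> C_spectral m \<Lambda> \<Longrightarrow> \<Phi> s = 0" "d \<le> Re (\<Phi> f)"
    then show thesis by (rule that)
  next
    fix s M assume "s \<in> C_spectral m \<Lambda>" "\<And>x. cmod (f x - s x) \<le> M"
    then show "d \<le> M" by (rule d)
  qed (simp_all add: C_spectral_cont C_spectral_zero C_spectral_add C_spectral_scale f)
  obtain g where g: "cont g" "(LINT x|m. cmod (g x)) \<le> 1" "\<And>\<gamma>. \<gamma> \<in> \<Lambda> \<Longrightarrow> (LINT x|m. g x * \<gamma> x) = 0"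
    "cmod ((LINT x|m. f x * g x) - \<Phi> f) \<le> e"
    using functional_smoothing[OF \<Phi>(1) \<Lambda> _ f e] \<Phi>(2) character_in_C_spectral[OF \<Lambda>] by metis
  have "Re (\<Phi> f) - Re (LINT x|m. f x * g x) \<le> e"
    using g(4) complex_Re_le_cmod[of "\<Phi> f - (LINT x|m. f x * g x)"] by (simp add: norm_minus_commute)
  then show thesis using that[OF g(1-3)] \<Phi>(3) by simp
qed

end

section \<open>Functions concentrated on small sets\<close>

context compact_haar
begin

lemma inner_regular:
  assumes A: "A \<in> sets borel" and e: "0 < e"
  obtains K where "compact K" "K \<subseteq> A" "measure m (A - K) < e"
proof (cases "measure m A < e")
  \<comment> \<open>Here the difference \<open>measure m A - e\<close> used below would be negative
    and be truncated by \<open>ennreal\<close>; the empty set serves instead.\<close>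
  case True
  then show thesis using that[of "{}"] by simp
next
  case False
  have "ennreal (measure m A - e) < ennreal (measure m A)"
    using e False by (simp add: ennreal_less_iff)
  also have "\<dots> = (SUP K\<in>{K. compact K \<and> K \<subseteq> A}. emeasure m K)"
    using haar A unfolding normalized_haar_measure_def emeasure_eq_measure[symmetric] by blast
  finally obtain K where K: "compact K" "K \<subseteq> A" "ennreal (measure m A - e) < emeasure m K"
    by (auto simp: less_SUP_iff)
  then have "measure m A - e < measure m K"
    using False by (simp add: emeasure_eq_measure ennreal_less_iff)
  moreover have "K \<in> sets borel" using K(1) by (simp add: compact_imp_closed)
  then have "measure m (A - K) = measure m A - measure m K"
    using A K(2) by (intro finite_measure_Diff) auto
  ultimately show thesis using that[OF K(1,2)] by simp
qed

lemma outer_regular: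
  assumes A: "A \<in> sets borel" and e: "0 < e"
  obtains U where "open U" "A \<subseteq> U" "measure m (U - A) < e"
proof -
  obtain K where K: "compact K" "K \<subseteq> - A" "measure m (- A - K) < e"
    using inner_regular[of "- A" e] A e by auto
  have "- A - K = - K - A" by auto
  then show thesis using that[of "- K"] K compact_imp_closed[OF K(1)] by auto
qed

lemma integrable_indicator_borel: "D \<in> sets borel \<Longrightarrow> integrable m (indicator D :: 'g \<Rightarrow> real)"
  by (rule integrable_bounded[of _ 1]) (auto simp: indicator_def intro!: borel_measurable_indicator)

lemma integrable_indicator_cmod:
  fixes z :: "'g \<Rightarrow> complex"
  shows "D \<in> sets borel \<Longrightarrow> integrable m z \<Longrightarrow> integrable m (\<lambda>x. indicator D x * cmod (z x))"
  using integrable_real_mult_indicator[of D m "\<lambda>x. cmod (z x)"] by (simp add: mult.commute)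

lemma continuous_dense_L1:
  fixes f :: "'g \<Rightarrow> complex"
  assumes "integrable m f" "0 < e"
  obtains s where "cont s" "(LINT x|m. cmod (f x - s x)) < e"
proof -
  have "\<forall>e>0. \<exists>s. cont s \<and> (LINT x|m. cmod (f x - s x)) < e"
    using assms(1)
  proof (induction rule: integrable_induct)
    case (base A c)
    show ?case
    proof (intro allI impI)
      fix e :: real assume e: "0 < e"
      \<comment> \<open>The error is carried by \<open>U - K\<close>, of measure at most
        \<open>2 * e'\<close>; \<open>cmod c + 1\<close> allows \<open>c = 0\<close>.\<close>
      define e' where "e' = e / (2 * (cmod c + 1))"
      have e': "0 < e'" using e by (simp add: e'_def add_nonneg_pos)
      have sA: "A \<in> sets borel" using base(1) by simp
      obtain K where K: "compact K" "K \<subseteq> A" "measure m (A - K) < e'"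
        using inner_regular[OF sA e'] .
      obtain U where U: "open U" "A \<subseteq> U" "measure m (U - A) < e'"
        using outer_regular[OF sA e'] .
      obtain j :: "'g \<Rightarrow> real" where j: "continuous_on UNIV j" "\<And>x. 0 \<le> j x" "\<And>x. j x \<le> 1"
        "\<And>x. x \<in> - U \<Longrightarrow> j x = 0" "\<And>x. x \<in> K \<Longrightarrow> j x = 1"
        using urysohn[of "- U" K] U K compact_imp_closed[OF K(1)] by auto
      let ?s = "\<lambda>x. complex_of_real (j x) * c"
      have s: "cont ?s" by (intro continuous_intros j)
      have A: "A \<in> sets m" "K \<in> sets m" "U \<in> sets m"
        using base compact_imp_closed[OF K(1)] U(1) by auto
      have "(LINT x|m. cmod (indicator A x *\<^sub>R c - ?s x)) \<le> (LINT x|m. cmod c * indicator (U - K) x)"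
      proof (intro integral_mono integrable_norm Bochner_Integration.integrable_diff)
        show "integrable m (\<lambda>x. cmod c * indicator (U - K) x)"
          using A by (intro integrable_mult_right integrable_indicator_borel) auto
        show "integrable m (\<lambda>x. indicator A x *\<^sub>R c)" using A by (auto simp: emeasure_eq_measure)
        show "integrable m ?s" using s by auto
        fix x
        have "\<bar>indicator A x - j x\<bar> \<le> indicator (U - K) x"
          using j(2,3)[of x] j(4,5)[of x] U(2) K(2) by (auto simp: indicator_def)
        then have "\<bar>indicator A x - j x\<bar> * cmod c \<le> indicator (U - K) x * cmod c"
          by (rule mult_right_mono) simp
        moreover have "cmod (indicator A x *\<^sub>R c - ?s x) = \<bar>indicator A x - j x\<bar> * cmod c"
          by (simp add: scaleR_conv_of_real flip: left_diff_distrib of_real_diff add: norm_mult)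
        ultimately show "cmod (indicator A x *\<^sub>R c - ?s x) \<le> cmod c * indicator (U - K) x"
          by (simp add: mult.commute)
      qed
      also have "\<dots> = cmod c * measure m (U - K)" using A by simp
      also have "\<dots> \<le> cmod c * (2 * e')"
      proof (rule mult_left_mono)
        have "measure m (U - K) \<le> measure m ((U - A) \<union> (A - K))"
          using A by (intro finite_measure_mono) auto
        also have "\<dots> \<le> measure m (U - A) + measure m (A - K)"
          using A by (intro measure_Un_le) auto
        finally show "measure m (U - K) \<le> 2 * e'" using K U by simp
      qed simp
      also have "\<dots> < (cmod c + 1) * (2 * e')" using e' by simp
      also have "\<dots> = e"
      proof -
        have "cmod c + 1 \<noteq> 0" using norm_ge_zero[of c] by linarith
        then show ?thesis by (simp add: e'_def field_simps)
      qed
      finally show "\<exists>s. cont s \<and> (LINT x|m. cmod (indicator A x *\<^sub>R c - s x)) < e"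
        using s by blast
    qed
  next
    case (add f g)
    show ?case
    proof (intro allI impI)
      fix e :: real assume "0 < e"
      then obtain s t where s: "cont s" "(LINT x|m. cmod (f x - s x)) < e / 2"
        and t: "cont t" "(LINT x|m. cmod (g x - t x)) < e / 2"
        using add half_gt_zero by metis
      have int: "integrable m s" "integrable m t" using s t by auto
      have "(LINT x|m. cmod (f x + g x - (s x + t x))) \<le> (LINT x|m. cmod (f x - s x) + cmod (g x - t x))"
        using int add by (intro integral_mono) (auto simp: norm_diff_triangle_ineq)
      also have "\<dots> < e" using s t int add by simp
      finally show "\<exists>s. cont s \<and> (LINT x|m. cmod (f x + g x - s x)) < e"
        using s t by (intro exI[of _ "\<lambda>x. s x + t x"]) (auto intro: continuous_intros)
    qed
  next
    case (lim f s)
    show ?case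
    proof (intro allI impI)
      fix e :: real assume "0 < e"
      \<comment> \<open>The simple functions \<open>s i\<close> are bounded by twice the modulus of
        \<open>f\<close>, so three times the modulus dominates the differences.\<close>
      have "(\<lambda>i. LINT x|m. cmod (f x - s i x)) \<longlonglongrightarrow> (LINT x|m. 0)"
      proof (rule integral_dominated_convergence[where w = "\<lambda>x. 3 * cmod (f x)"])
        show "integrable m (\<lambda>x. 3 * cmod (f x))" using lim by simp
        show "AE x in m. (\<lambda>i. cmod (f x - s i x)) \<longlonglongrightarrow> 0"
        proof (rule AE_I2)
          fix x assume "x \<in> space m"
          then have "(\<lambda>i. cmod (f x - s i x)) \<longlonglongrightarrow> cmod (f x - f x)"
            by (intro tendsto_intros lim.hyps(2))
          then show "(\<lambda>i. cmod (f x - s i x)) \<longlonglongrightarrow> 0" by simp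
        qed
        show "AE x in m. norm (cmod (f x - s i x)) \<le> 3 * cmod (f x)" for i
        proof (rule AE_I2)
          fix x
          show "norm (cmod (f x - s i x)) \<le> 3 * cmod (f x)"
            using norm_triangle_ineq4[of "f x" "s i x"] lim.hyps(3)[of x i] by simp
        qed
      qed (use lim in auto)
      then have "\<forall>\<^sub>F i in sequentially. (LINT x|m. cmod (f x - s i x)) < e / 2"
        using \<open>0 < e\<close> by (intro order_tendstoD(2)) auto
      then obtain i where i: "(LINT x|m. cmod (f x - s i x)) < e / 2"
        using eventually_happens'[OF sequentially_bot] by blast
      obtain t where t: "cont t" "(LINT x|m. cmod (s i x - t x)) < e / 2"
        using lim.IH[of i] \<open>0 < e\<close> half_gt_zero by metis
      have int: "integrable m t" "integrable m (s i)" using t lim by auto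
      have "(LINT x|m. cmod (f x - t x)) \<le> (LINT x|m. cmod (f x - s i x) + cmod (s i x - t x))"
        using int lim.hyps(4) by (intro integral_mono) (auto intro: norm_diff_triangle_le)
      also have "\<dots> < e" using i t int lim.hyps(4) by simp
      finally show "\<exists>s. cont s \<and> (LINT x|m. cmod (f x - s x)) < e" using t by blast
    qed
  qed
  then show thesis using assms(2) that by blast
qed

text \<open>The phase \<open>cnj (sgn (z x))\<close> norms \<open>z\<close> but need not be
  continuous. Approximating \<open>z\<close> by a continuous \<open>s\<close> and dividing by
  \<open>cmod (s x) + \<tau>\<close> instead of \<open>cmod (s x)\<close> removes the singularity at
  the zeros of \<open>s\<close> at the cost of \<tau>.\<close>

lemma continuous_norming:
  fixes z :: "'g \<Rightarrow> complex"
  assumes z: "integrable m z" and e: "0 < e"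
  obtains v where "cont v" "\<And>x. cmod (v x) \<le> 1" "(LINT x|m. cmod (z x) - Re (v x * z x)) \<le> e"
proof -
  obtain s where s: "cont s" "(LINT x|m. cmod (z x - s x)) < e / 3"
    using continuous_dense_L1[OF z, of "e / 3"] e by auto
  \<comment> \<open>The pointwise error is 2 |z - s| + \<tau>, whose integral is at most 2 e / 3 + e
    / 3.\<close>
  define \<tau> where "\<tau> = e / 3"
  have \<tau>: "0 < \<tau>" using e by (simp add: \<tau>_def)
  have pos: "0 < cmod (s x) + \<tau>" for x using \<tau> by (simp add: add_nonneg_pos)
  define v where "v x = cnj (s x) / of_real (cmod (s x) + \<tau>)" for x
  have v: "cont v"
    unfolding v_def using pos by (intro continuous_intros s) (metis of_real_eq_0_iff less_irrefl)
  have v1: "cmod (v x) \<le> 1" for x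
    using pos[of x] \<tau> by (simp add: v_def norm_divide divide_le_eq del: of_real_add)
  have vs: "cmod (s x) - Re (v x * s x) \<le> \<tau>" for x
  proof -
    have "v x * s x = of_real ((cmod (s x))\<^sup>2 / (cmod (s x) + \<tau>))"
      using complex_norm_square[of "s x"] by (simp add: v_def mult.commute)
    then have "Re (v x * s x) = (cmod (s x))\<^sup>2 / (cmod (s x) + \<tau>)" by simp
    moreover have "cmod (s x) - \<tau> \<le> (cmod (s x))\<^sup>2 / (cmod (s x) + \<tau>)"
      using pos[of x] by (simp add: le_divide_eq algebra_simps power2_eq_square)
    ultimately show ?thesis by simp
  qed
  have int: "integrable m (\<lambda>x. v x * z x)" by (rule integrable_continuous_mult[OF v z])
  have int_s: "integrable m s" using s by auto
  have "(LINT x|m. cmod (z x) - Re (v x * z x)) \<le> (LINT x|m. 2 * cmod (z x - s x) + \<tau>)"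
  proof (rule integral_mono)
    show "integrable m (\<lambda>x. cmod (z x) - Re (v x * z x))"
      by (intro Bochner_Integration.integrable_diff integrable_norm integrable_Re int z)
    show "integrable m (\<lambda>x. 2 * cmod (z x - s x) + \<tau>)" using int_s z by auto
    fix x
    have "cmod (z x) \<le> cmod (s x) + cmod (z x - s x)" using norm_triangle_sub by blast
    moreover have "Re (v x * s x) - Re (v x * z x) \<le> cmod (v x * (s x - z x))"
      using complex_Re_le_cmod[of "v x * (s x - z x)"] by (simp add: right_diff_distrib)
    moreover have "cmod (v x * (s x - z x)) \<le> cmod (z x - s x)"
      using v1[of x] by (simp add: norm_mult norm_minus_commute mult_left_le_one_le)
    ultimately show "cmod (z x) - Re (v x * z x) \<le> 2 * cmod (z x - s x) + \<tau>"
      using vs[of x] by linarith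
  qed
  also have "\<dots> \<le> e" using s int_s z by (simp add: \<tau>_def)
  finally show thesis using that v v1 by blast
qed

text \<open>Absolute continuity of the integral: up to \<open>e / 2\<close> in L1 the function is
  bounded by some \<open>B\<close>, and a bounded function has a small integral over a small
  set.\<close>

lemma integral_small_set:
  fixes z :: "'g \<Rightarrow> complex"
  assumes z: "integrable m z" and e: "0 < e"
  obtains d where "0 < d" "\<And>D. D \<in> sets borel \<Longrightarrow> measure m D < d \<Longrightarrow> (LINT x|m. indicator D x * cmod (z x)) \<le> e"
proof -
  obtain s where s: "cont s" "(LINT x|m. cmod (z x - s x)) < e / 2"
    using continuous_dense_L1[OF z, of "e / 2"] e by auto
  obtain B where B: "0 < B" "\<And>x. cmod (s x) \<le> B" using continuous_bounded[OF s(1)] by metis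
  have int_s: "integrable m s" using s by auto
  show thesis
  proof (rule that[of "e / (2 * B)"])
    show "0 < e / (2 * B)" using e B by simp
    fix D :: "'g set" assume D: "D \<in> sets borel" "measure m D < e / (2 * B)"
    have "(LINT x|m. indicator D x * cmod (z x)) \<le> (LINT x|m. cmod (z x - s x) + B * indicator D x)"
    proof (rule integral_mono)
      show "integrable m (\<lambda>x. indicator D x * cmod (z x))"
        using D(1) z by (rule integrable_indicator_cmod)
      show "integrable m (\<lambda>x. cmod (z x - s x) + B * indicator D x)"
        using D(1) z int_s
        by (intro Bochner_Integration.integrable_add integrable_norm Bochner_Integration.integrable_diff
            integrable_mult_right integrable_indicator_borel)
      fix x
      show "indicator D x * cmod (z x) \<le> cmod (z x - s x) + B * indicator D x"
        using norm_triangle_sub[of "z x" "s x"] B(2)[of x] by (auto simp: indicator_def)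
    qed
    also have "\<dots> = (LINT x|m. cmod (z x - s x)) + B * measure m D"
      using integrable_indicator_borel[OF D(1)] D z int_s by simp
    also have "\<dots> \<le> e" using D(2) s(2) B(1) by (simp add: field_simps)
    finally show "(LINT x|m. indicator D x * cmod (z x)) \<le> e" .
  qed
qed

text \<open>A substitute for the Lebesgue decomposition of the measure representing \<open>\<Phi>\<close>: the singular part is
  almost exhausted by a function with small support \<open>U\<close>, so \<open>\<Phi>\<close> is negligible near any small compact
  set off \<open>U\<close>.\<close>

lemma functional_negligible_off_small_set:
  assumes \<Phi>: "C_functional \<Phi> N" and \<delta>: "0 < \<delta>"
  shows "\<exists>\<eta>>0. \<forall>K z. compact K \<longrightarrow> measure m K < \<eta> \<longrightarrow> integrable m z \<longrightarrow>
      (\<exists>K1 V. compact K1 \<and> K1 \<subseteq> K \<and> open V \<and> K1 \<subseteq> V \<and> (LINT x|m. indicator (K - K1) x * cmod (z x)) \<le> \<delta> \<and>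
        (\<forall>f. cont f \<longrightarrow> (\<forall>x. cmod (f x) \<le> 1) \<longrightarrow> (\<forall>x. x \<notin> V \<longrightarrow> f x = 0) \<longrightarrow> cmod (\<Phi> f) \<le> \<delta>))"
proof -
  \<comment> \<open>The supremum of \<open>Q \<eta>\<close> is the mass that \<Phi> can show on sets
    of measure below \<eta>; its limit as \<eta> tends to 0 is the norm of the singular
    part.\<close>
  define Q where "Q \<eta> = {cmod (\<Phi> f) |f. cont f \<and> (\<forall>x. cmod (f x) \<le> 1) \<and> measure m {x. f x \<noteq> 0} < \<eta>}" for \<eta>
  have N: "0 \<le> N" using C_functional_nonneg[OF \<Phi>] .
  have Q_le: "q \<le> N" if "q \<in> Q \<eta>" for q \<eta>
    using that C_functional_bound[OF \<Phi>, of _ 1] by (auto simp: Q_def)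
  have bdd: "bdd_above (Q \<eta>)" for \<eta> by (rule bdd_aboveI[of _ N]) (rule Q_le)
  have \<Phi>0: "\<Phi> (\<lambda>x. 0) = 0" using C_functional_scale[OF \<Phi>, of "\<lambda>_. 0" 0] by simp
  have Q0: "0 \<in> Q \<eta>" if "0 < \<eta>" for \<eta>
    using that \<Phi>0 by (auto simp: Q_def intro!: exI[of _ "\<lambda>_. 0"])
  define c where "c \<eta> = Sup (Q \<eta>)" for \<eta>
  have c_ge: "q \<le> c \<eta>" if "q \<in> Q \<eta>" for q \<eta> unfolding c_def by (rule cSup_upper[OF that bdd])
  have "bdd_below (c ` {0<..})" using c_ge[OF Q0] by (intro bdd_belowI2[of _ 0]) auto
  \<comment> \<open>At this \<eta> the mass is, up to \<delta> / 4, already that of the singular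
    part.\<close>
  then obtain \<eta> where \<eta>: "0 < \<eta>" "\<And>\<eta>'. 0 < \<eta>' \<Longrightarrow> c \<eta> \<le> c \<eta>' + \<delta> / 4"
  proof -
    assume bb: "bdd_below (c ` {0<..})"
    assume *: "\<And>\<eta>. 0 < \<eta> \<Longrightarrow> (\<And>\<eta>'. 0 < \<eta>' \<Longrightarrow> c \<eta> \<le> c \<eta>' + \<delta> / 4) \<Longrightarrow> thesis"
    obtain \<eta> where \<eta>: "0 < \<eta>" "c \<eta> < (INF \<eta>\<in>{0<..}. c \<eta>) + \<delta> / 4"
      using cInf_lessD[of "c ` {0<..}" "(INF \<eta>\<in>{0<..}. c \<eta>) + \<delta> / 4"] \<delta> by auto
    have "(INF \<eta>\<in>{0<..}. c \<eta>) \<le> c \<eta>'" if "0 < \<eta>'" for \<eta>'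
      using cINF_lower[OF bb, of \<eta>'] that by simp
    then show thesis using \<eta> by (intro *[of \<eta>]) force+
  qed
  show ?thesis
  proof (rule exI[of _ \<eta>], intro conjI allI impI)
    show "0 < \<eta>" by (rule \<eta>(1))
    fix K :: "'g set" and z :: "'g \<Rightarrow> complex"
    assume K: "compact K" "measure m K < \<eta>" and z: "integrable m z"
    obtain d where d: "0 < d" "\<And>D. D \<in> sets borel \<Longrightarrow> measure m D < d \<Longrightarrow> (LINT x|m. indicator D x * cmod (z x)) \<le> \<delta>"
      using integral_small_set[OF z \<delta>] by metis
    \<comment> \<open>The bound \<open>d\<close> makes \<open>z\<close> negligible on
      \<open>K - K1\<close>, which lies in \<open>U\<close>; the bound
      \<open>\<eta> - measure m K\<close> leaves room for \<open>U\<close> and a neighbourhood of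
      \<open>K1\<close> within \<eta>.\<close>
    define \<eta>2 where "\<eta>2 = min d (\<eta> - measure m K)"
    have \<eta>2: "0 < \<eta>2" using d K by (simp add: \<eta>2_def)
    have "\<exists>q\<in>Q \<eta>2. c \<eta>2 - \<delta> / 4 < q"
      unfolding c_def using Q0[OF \<eta>2] \<delta> by (intro less_cSupD) auto
    then obtain f1 where f1: "cont f1" "\<And>x. cmod (f1 x) \<le> 1" "measure m {x. f1 x \<noteq> 0} < \<eta>2"
      "c \<eta>2 - \<delta> / 4 < cmod (\<Phi> f1)"
      by (auto simp: Q_def)
    define U where "U = {x. f1 x \<noteq> 0}"
    have U: "open U" unfolding U_def by (intro open_Collect_neq f1 continuous_intros)
    define \<theta> where "\<theta> = cnj (sgn (\<Phi> f1))"
    have \<theta>: "cmod \<theta> \<le> 1" "\<theta> * \<Phi> f1 = of_real (cmod (\<Phi> f1))"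
      by (simp_all add: \<theta>_def cnj_sgn_mult norm_sgn)
    define f0 where "f0 x = \<theta> * f1 x" for x
    have f0: "cont f0" unfolding f0_def by (intro continuous_intros f1)
    have f0_le: "cmod (f0 x) \<le> 1" for x
      unfolding f0_def using mult_mono[OF \<theta>(1) f1(2)[of x]] by (simp add: norm_mult)
    have f0_U: "x \<notin> U \<Longrightarrow> f0 x = 0" for x by (simp add: f0_def U_def)
    have \<Phi>f0: "\<Phi> f0 = of_real (cmod (\<Phi> f1))"
      unfolding f0_def C_functional_scale[OF \<Phi> f1(1)] by (rule \<theta>(2))
    define \<tau> where "\<tau> = \<delta> / (4 * (N + 1))"
    have \<tau>: "0 < \<tau>" "N * \<tau> \<le> \<delta> / 4" using N \<delta> by (auto simp: \<tau>_def field_simps)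
    \<comment> \<open>Soft thresholding of \<open>f0\<close>: it changes \<open>f0\<close> by at
      most \<tau> and vanishes wherever |f0| < \<tau>, hence on all of \<open>V\<close> below. A
      function supported in \<open>V\<close> and bounded by 1 can then be added without leaving the
      unit ball.\<close>
    define g0 where "g0 x = f0 x - f0 x * of_real (\<tau> / max \<tau> (cmod (f0 x)))" for x
    have mx: "max \<tau> (cmod (f0 x)) \<noteq> 0" for x
      using \<tau>(1) max.cobounded1[of \<tau> "cmod (f0 x)"] by linarith
    have g0: "cont g0"
      unfolding g0_def using mx by (intro continuous_intros f0) auto
    have g0_small: "cmod (f0 x) < \<tau> \<Longrightarrow> g0 x = 0" for x
      using \<tau> by (simp add: g0_def)
    have diff: "cmod (f0 x - g0 x) \<le> \<tau>" for x
      using \<tau> by (cases "f0 x = 0") (auto simp: g0_def norm_mult norm_divide divide_le_eq max_def)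
    have g0_le: "cmod (g0 x) \<le> 1" for x
    proof -
      have "g0 x = f0 x * of_real (1 - \<tau> / max \<tau> (cmod (f0 x)))" by (simp add: g0_def right_diff_distrib)
      moreover have "0 \<le> 1 - \<tau> / max \<tau> (cmod (f0 x))" "1 - \<tau> / max \<tau> (cmod (f0 x)) \<le> 1"
        using \<tau> by (auto simp: divide_le_eq le_max_iff_disj)
      ultimately show ?thesis
        using f0_le[of x] by (simp add: norm_mult mult_le_one del: of_real_diff of_real_divide)
    qed
    have \<Phi>g0: "cmod (\<Phi> f1) - \<delta> / 4 \<le> Re (\<Phi> g0)"
    proof -
      have "cmod (\<Phi> f0 - \<Phi> g0) \<le> N * \<tau>"
        using C_functional_bound[OF \<Phi>, of "\<lambda>x. f0 x - g0 x" \<tau>] diff C_functional_diff[OF \<Phi> f0 g0] f0 g0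
        by (simp add: continuous_on_diff)
      then have "Re (\<Phi> f0 - \<Phi> g0) \<le> \<delta> / 4" using \<tau>(2) complex_Re_le_cmod[of "\<Phi> f0 - \<Phi> g0"] by linarith
      then show ?thesis by (simp add: \<Phi>f0)
    qed
    define K1 where "K1 = K - U"
    have K1: "compact K1" "K1 \<subseteq> K" using K(1) U by (auto simp: K1_def compact_diff)
    have sets: "K \<in> sets borel" "K1 \<in> sets borel" "U \<in> sets borel"
      using compact_imp_closed[OF K(1)] compact_imp_closed[OF K1(1)] U by auto
    have mU: "measure m U < \<eta>2" using f1(3) by (simp add: U_def)
    have gap: "0 < \<eta> - measure m K - measure m U" using mU by (simp add: \<eta>2_def)
    obtain W where W: "open W" "K1 \<subseteq> W" "measure m (W - K1) < \<eta> - measure m K - measure m U"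
      using outer_regular[OF sets(2) gap] .
    define V where "V = W \<inter> {x. cmod (f0 x) < \<tau>}"
    have V: "open V" unfolding V_def by (intro open_Int W open_Collect_less continuous_intros f0)
    have K1V: "K1 \<subseteq> V" using W(2) \<tau> f0_U by (auto simp: V_def K1_def)
    have mVU: "measure m (V \<union> U) < \<eta>"
    proof -
      have "measure m V \<le> measure m (K1 \<union> (W - K1))"
        using sets W(1) by (intro finite_measure_mono) (auto simp: V_def)
      also have "\<dots> \<le> measure m K1 + measure m (W - K1)"
        using sets W(1) by (intro measure_Un_le) auto
      also have "measure m K1 \<le> measure m K" using sets K1 by (intro finite_measure_mono) auto
      finally have "measure m V + measure m U < \<eta>" using W(3) by simp
      moreover have "measure m (V \<union> U) \<le> measure m V + measure m U"
        using sets V by (intro measure_Un_le) auto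
      ultimately show ?thesis by simp
    qed
    have negligible: "cmod (\<Phi> f) \<le> \<delta>"
      if f: "cont f" "\<And>x. cmod (f x) \<le> 1" "\<And>x. x \<notin> V \<Longrightarrow> f x = 0" for f
    proof -
      define \<sigma> where "\<sigma> = cnj (sgn (\<Phi> f))"
      have \<sigma>: "cmod \<sigma> \<le> 1" "\<sigma> * \<Phi> f = of_real (cmod (\<Phi> f))"
        by (simp_all add: \<sigma>_def cnj_sgn_mult norm_sgn)
      \<comment> \<open>\<open>?h\<close> competes in \<open>Q \<eta>\<close>. The real part of
        \<open>\<Phi> g0\<close> already uses \<open>c \<eta>2\<close> up to \<delta> / 2, and
        \<open>c \<eta>\<close> exceeds \<open>c \<eta>2\<close> by at most \<delta> / 4, so little
        is left for \<open>f\<close>.\<close>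
      let ?h = "\<lambda>x. \<sigma> * f x + g0 x"
      have h: "cont ?h" by (intro continuous_intros f g0)
      have h1: "cmod (?h x) \<le> 1" for x
        using mult_mono[OF \<sigma>(1) f(2)[of x]] g0_le[of x] g0_small[of x] f(3)[of x]
        by (cases "x \<in> V") (auto simp: V_def norm_mult)
      have "{x. ?h x \<noteq> 0} \<subseteq> V \<union> U"
        using contrapos_np[OF _ f(3)] f0_U by (auto simp: g0_def)
      then have "measure m {x. ?h x \<noteq> 0} \<le> measure m (V \<union> U)"
        using sets V by (intro finite_measure_mono) auto
      then have "cmod (\<Phi> ?h) \<in> Q \<eta>" using mVU h h1 by (auto simp: Q_def)
      then have "cmod (\<Phi> ?h) \<le> c \<eta>" by (rule c_ge)
      moreover have "\<Phi> ?h = of_real (cmod (\<Phi> f)) + \<Phi> g0"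
        using C_functional_add[OF \<Phi> _ g0, of "\<lambda>x. \<sigma> * f x"] C_functional_scale[OF \<Phi> f(1), of \<sigma>] \<sigma>(2) f(1)
        by (simp add: continuous_intros)
      ultimately have "cmod (\<Phi> f) + Re (\<Phi> g0) \<le> c \<eta>"
        using complex_Re_le_cmod[of "\<Phi> ?h"] by simp
      then show ?thesis using \<Phi>g0 f1(4) \<eta>(2)[OF \<eta>2] \<delta> by linarith
    qed
    have "(LINT x|m. indicator (K - K1) x * cmod (z x)) \<le> \<delta>"
    proof (rule d(2))
      have "measure m (K - K1) \<le> measure m U" using sets by (intro finite_measure_mono) (auto simp: K1_def)
      then show "measure m (K - K1) < d" using mU by (simp add: \<eta>2_def)
    qed (use sets in auto)
    then show "\<exists>K1 V. compact K1 \<and> K1 \<subseteq> K \<and> open V \<and> K1 \<subseteq> V \<and> (LINT x|m. indicator (K - K1) x * cmod (z x)) \<le> \<delta> \<and>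
        (\<forall>f. cont f \<longrightarrow> (\<forall>x. cmod (f x) \<le> 1) \<longrightarrow> (\<forall>x. x \<notin> V \<longrightarrow> f x = 0) \<longrightarrow> cmod (\<Phi> f) \<le> \<delta>)"
      using K1 V K1V negligible by blast
  qed
qed

text \<open>The hypothesis on \<open>z\<close> says that |z| is at least 1 only on a small set
  \<open>A\<close> and has small integral elsewhere. On a compact part \<open>K1\<close> of
  \<open>A\<close> that \<Phi> hardly sees, \<open>y0\<close> is exchanged for a function norming
  \<open>z\<close>; a Urysohn function confines the change to \<open>V\<close>.\<close>

theorem functional_almost_disjoint:
  assumes \<Phi>: "C_functional \<Phi> N" and \<delta>: "0 < \<delta>"
  shows "\<exists>\<eta>>0. \<forall>y0 z. cont y0 \<longrightarrow> (\<forall>x. cmod (y0 x) \<le> 1) \<longrightarrow> integrable m z \<longrightarrow> (LINT x|m. min 1 (cmod (z x))) < \<eta> \<longrightarrow>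
      (\<exists>y. cont y \<and> (\<forall>x. cmod (y x) \<le> 1) \<and> cmod (\<Phi> y - \<Phi> y0) \<le> \<delta> \<and> (LINT x|m. cmod (z x)) - \<delta> \<le> Re (LINT x|m. y x * z x))"
proof -
  \<comment> \<open>Seven errors: one from \<open>v\<close>, and twice the three from outside
    \<open>A\<close>, from \<open>A - K\<close> and from \<open>K - K1\<close>.\<close>
  define \<delta>' where "\<delta>' = \<delta> / 7"
  have \<delta>': "0 < \<delta>'" using \<delta> by (simp add: \<delta>'_def)
  obtain \<eta> where \<eta>: "0 < \<eta>"
    "\<forall>K z. compact K \<longrightarrow> measure m K < \<eta> \<longrightarrow> integrable m z \<longrightarrow>
      (\<exists>K1 V. compact K1 \<and> K1 \<subseteq> K \<and> open V \<and> K1 \<subseteq> V \<and> (LINT x|m. indicator (K - K1) x * cmod (z x)) \<le> \<delta>' \<and>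
        (\<forall>f. cont f \<longrightarrow> (\<forall>x. cmod (f x) \<le> 1) \<longrightarrow> (\<forall>x. x \<notin> V \<longrightarrow> f x = 0) \<longrightarrow> cmod (\<Phi> f) \<le> \<delta>'))"
    using functional_negligible_off_small_set[OF \<Phi> \<delta>'] by (elim exE conjE) blast
  show ?thesis
  proof (rule exI[of _ "min \<eta> \<delta>'"], intro conjI allI impI)
    show "0 < min \<eta> \<delta>'" using \<eta> \<delta>' by simp
    fix y0 z :: "'g \<Rightarrow> complex"
    assume y0: "cont y0" "\<forall>x. cmod (y0 x) \<le> 1" and z: "integrable m z"
      and small: "(LINT x|m. min 1 (cmod (z x))) < min \<eta> \<delta>'"
    have [measurable]: "z \<in> borel_measurable m" using z by auto
    have int_min: "integrable m (\<lambda>x. min 1 (cmod (z x)))" by (rule integrable_bounded[of _ 1]) auto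
    define A where "A = {x. 1 \<le> cmod (z x)}"
    have "{x \<in> space m. 1 \<le> cmod (z x)} \<in> sets m" by measurable
    then have A: "A \<in> sets borel" by (simp add: A_def)
    have "measure m A = (LINT x|m. indicator A x)" using A by simp
    also have "\<dots> \<le> (LINT x|m. min 1 (cmod (z x)))"
      by (rule integral_mono[OF integrable_indicator_borel[OF A] int_min]) (auto simp: A_def indicator_def)
    finally have mA: "measure m A < \<eta>" using small by simp
    obtain d where d: "0 < d" "\<And>D. D \<in> sets borel \<Longrightarrow> measure m D < d \<Longrightarrow> (LINT x|m. indicator D x * cmod (z x)) \<le> \<delta>'"
      using integral_small_set[OF z \<delta>'] by metis
    obtain K where K: "compact K" "K \<subseteq> A" "measure m (A - K) < d" using inner_regular[OF A d(1)] .
    have sK: "K \<in> sets borel" using compact_imp_closed[OF K(1)] by auto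
    have "measure m K \<le> measure m A" using A K sK by (intro finite_measure_mono) auto
    then have "measure m K < \<eta>" using mA by simp
    then obtain K1 V where K1: "compact K1" "K1 \<subseteq> K" "open V" "K1 \<subseteq> V"
      "(LINT x|m. indicator (K - K1) x * cmod (z x)) \<le> \<delta>'"
      "\<And>f. cont f \<Longrightarrow> (\<And>x. cmod (f x) \<le> 1) \<Longrightarrow> (\<And>x. x \<notin> V \<Longrightarrow> f x = 0) \<Longrightarrow> cmod (\<Phi> f) \<le> \<delta>'"
      using \<eta>(2)[rule_format, OF K(1) _ z] by blast
    have sK1: "K1 \<in> sets borel" using compact_imp_closed[OF K1(1)] by auto
    obtain v where v: "cont v" "\<And>x. cmod (v x) \<le> 1" "(LINT x|m. cmod (z x) - Re (v x * z x)) \<le> \<delta>'"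
      using continuous_norming[OF z \<delta>'] by metis
    obtain j :: "'g \<Rightarrow> real" where j: "continuous_on UNIV j" "\<And>x. 0 \<le> j x" "\<And>x. j x \<le> 1"
      "\<And>x. x \<in> - V \<Longrightarrow> j x = 0" "\<And>x. x \<in> K1 \<Longrightarrow> j x = 1"
      using urysohn[of "- V" K1] K1 compact_imp_closed[OF K1(1)] by auto
    define y where "y x = y0 x + of_real (j x) * (v x - y0 x)" for x
    have y: "cont y" unfolding y_def by (intro continuous_intros y0 v j)
    have y1: "cmod (y x) \<le> 1" for x
    proof -
      have "y x = of_real (1 - j x) * y0 x + of_real (j x) * v x" by (simp add: y_def algebra_simps)
      then have "cmod (y x) \<le> cmod (of_real (1 - j x) * y0 x) + cmod (of_real (j x) * v x)"
        by (simp only: norm_triangle_ineq)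
      also have "\<dots> = (1 - j x) * cmod (y0 x) + j x * cmod (v x)"
        using j(2,3)[of x] by (simp add: norm_mult del: of_real_diff)
      also have "\<dots> \<le> (1 - j x) * 1 + j x * 1"
        using j(2,3)[of x] y0 v by (intro add_mono mult_left_mono) auto
      finally show ?thesis by simp
    qed
    have "cmod (\<Phi> y - \<Phi> y0) \<le> \<delta>"
    proof -
      \<comment> \<open>The factor 1 / 2 brings the change \<open>y - y0\<close> into the unit ball,
        where the estimate for functions supported in \<open>V\<close> applies.\<close>
      define w where "w x = of_real (j x) * (v x - y0 x) * (1 / 2)" for x
      have w: "cont w" unfolding w_def by (intro continuous_intros y0 v j)
      have "cmod (w x) \<le> 1" for x
      proof -
        have "cmod (v x - y0 x) \<le> 2" using norm_triangle_ineq4[of "v x" "y0 x"] v(2)[of x] spec[OF y0(2), of x] by simp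
        then have "j x * cmod (v x - y0 x) \<le> 1 * 2" using j(2,3)[of x] by (intro mult_mono) auto
        then show ?thesis using j(2)[of x] by (simp add: w_def norm_mult)
      qed
      then have "cmod (\<Phi> w) \<le> \<delta>'" using j(4) by (intro K1(6) w) (auto simp: w_def)
      moreover have "(\<lambda>x. y x - y0 x) = (\<lambda>x. 2 * w x)" by (simp add: y_def w_def)
      then have "\<Phi> y - \<Phi> y0 = 2 * \<Phi> w"
        using C_functional_diff[OF \<Phi> y y0(1)] C_functional_scale[OF \<Phi> w, of 2] by simp
      ultimately show ?thesis using \<delta> by (simp add: norm_mult \<delta>'_def)
    qed
    moreover have "(LINT x|m. cmod (z x)) - \<delta> \<le> Re (LINT x|m. y x * z x)"
    proof -
      have int_v: "integrable m (\<lambda>x. v x * z x)" and int_y: "integrable m (\<lambda>x. y x * z x)"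
        by (rule integrable_continuous_mult[OF v(1) z] integrable_continuous_mult[OF y z])+
      have int: "integrable m (\<lambda>x. cmod (z x) - Re (v x * z x))"
        "integrable m (\<lambda>x. indicator (A - K) x * cmod (z x))" "integrable m (\<lambda>x. indicator (K - K1) x * cmod (z x))"
        "integrable m (\<lambda>x. cmod (z x) - Re (y x * z x))"
        using A sK sK1 by (intro Bochner_Integration.integrable_diff integrable_norm integrable_Re int_v int_y z
            integrable_indicator_cmod; simp)+
      have pt: "cmod (z x) - Re (u * z x) \<le> 2 * cmod (z x)" "0 \<le> cmod (z x) - Re (u * z x)" if "cmod u \<le> 1" for u x
        using abs_Re_le_cmod[of "u * z x"] mult_right_mono[OF that norm_ge_zero[of "z x"]] by (simp_all add: norm_mult)
      \<comment> \<open>On \<open>K1\<close> the functions \<open>y\<close> and \<open>v\<close>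
        agree; elsewhere the integrand is at most \<open>2 * cmod (z x)\<close>, and
        \<open>cmod (z x)\<close> is covered by one of the three small terms.\<close>
      have "(LINT x|m. cmod (z x) - Re (y x * z x)) \<le>
        (LINT x|m. (cmod (z x) - Re (v x * z x)) + 2 * (min 1 (cmod (z x)) +
          (indicator (A - K) x * cmod (z x) + indicator (K - K1) x * cmod (z x))))"
      proof (rule integral_mono)
        fix x
        show "cmod (z x) - Re (y x * z x) \<le> (cmod (z x) - Re (v x * z x)) + 2 * (min 1 (cmod (z x)) +
          (indicator (A - K) x * cmod (z x) + indicator (K - K1) x * cmod (z x)))"
        proof (cases "x \<in> K1")
          case True
          then show ?thesis using j(5)[OF True] K1(2) K(2) by (simp add: y_def)
        next
          case False
          then have "cmod (z x) \<le> min 1 (cmod (z x)) +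
              (indicator (A - K) x * cmod (z x) + indicator (K - K1) x * cmod (z x))"
            using K1(2) K(2) by (auto simp: indicator_def A_def)
          moreover have "a - r \<le> (a - s) + 2 * b" if "a \<le> b" "a - r \<le> 2 * a" "0 \<le> a - s" for a b r s :: real
            using that by linarith
          ultimately show ?thesis using pt(1)[OF y1[of x], of x] pt(2)[OF v(2)[of x], of x] by blast
        qed
      qed (use int int_min in auto)
      also have "\<dots> = (LINT x|m. cmod (z x) - Re (v x * z x)) + 2 * ((LINT x|m. min 1 (cmod (z x))) +
          ((LINT x|m. indicator (A - K) x * cmod (z x)) + (LINT x|m. indicator (K - K1) x * cmod (z x))))"
        using int int_min by (simp del: Bochner_Integration.integral_diff)
      also have "\<dots> \<le> \<delta>"
        using v(3) small K1(5) d(2)[OF _ K(3)] A sK by (simp add: \<delta>'_def)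
      finally have "(LINT x|m. cmod (z x) - Re (y x * z x)) \<le> \<delta>" .
      moreover have "(LINT x|m. cmod (z x) - Re (y x * z x)) = (LINT x|m. cmod (z x)) - Re (LINT x|m. y x * z x)"
        by (subst Bochner_Integration.integral_diff[OF integrable_norm[OF z] integrable_Re[OF int_y]])
          (simp only: integral_Re[OF int_y])
      ultimately show ?thesis by simp
    qed
    ultimately show "\<exists>y. cont y \<and> (\<forall>x. cmod (y x) \<le> 1) \<and> cmod (\<Phi> y - \<Phi> y0) \<le> \<delta> \<and> (LINT x|m. cmod (z x)) - \<delta> \<le> Re (LINT x|m. y x * z x)"
      using y y1 by blast
  qed
qed

end

section \<open>Quotients of Banach spaces and rank-one operators\<close>

context complex_normed_space
begin

lemma scale_zero_left: "x \<in> carrier X \<Longrightarrow> 0 \<odot> x = \<zero>"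
  using scale_add_left[of x 1 "-1"] diff_self[of x] by (simp add: vdiff_def scale_one)

lemma norm_zero: "\<parallel>\<zero>\<parallel> = 0"
  using norm_eq_0_iff[OF zero_closed] by simp

lemma add_left_commute:
  "x \<in> carrier X \<Longrightarrow> y \<in> carrier X \<Longrightarrow> z \<in> carrier X \<Longrightarrow> x \<oplus> (y \<oplus> z) = y \<oplus> (x \<oplus> z)"
  by (metis add_assoc add_commute)

lemma zero_add: "x \<in> carrier X \<Longrightarrow> \<zero> \<oplus> x = x"
  using add_zero add_commute zero_closed by metis

lemma vdiff_closed: "x \<in> carrier X \<Longrightarrow> y \<in> carrier X \<Longrightarrow> x \<ominus> y \<in> carrier X"
  by (simp add: vdiff_def add_closed scale_closed)

lemma add_diff_cancel: "x \<in> carrier X \<Longrightarrow> y \<in> carrier X \<Longrightarrow> y \<oplus> (x \<ominus> y) = x"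
  using diff_self[of y] by (simp add: vdiff_def add_left_commute[of y x] scale_closed add_zero)

lemma diff_add_diff:
  assumes "x \<in> carrier X" "y \<in> carrier X" "z \<in> carrier X"
  shows "(x \<ominus> y) \<oplus> (y \<ominus> z) = x \<ominus> z"
proof -
  have "((-1) \<odot> y) \<oplus> (y \<oplus> ((-1) \<odot> z)) = y \<oplus> (((-1) \<odot> z) \<ominus> y)"
    using assms by (simp add: vdiff_def scale_closed add_left_commute[of _ y] add_commute[of "(-1) \<odot> y"])
  also have "\<dots> = (-1) \<odot> z" using assms by (simp add: add_diff_cancel scale_closed)
  finally show ?thesis using assms by (simp add: vdiff_def add_assoc add_closed scale_closed)
qed

lemma norm_diff_commute: "x \<in> carrier X \<Longrightarrow> y \<in> carrier X \<Longrightarrow> \<parallel>x \<ominus> y\<parallel> = \<parallel>y \<ominus> x\<parallel>"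
  using norm_scale[OF vdiff_closed, of y x "-1"]
  by (simp add: vdiff_def scale_add_right scale_scale scale_one scale_closed add_commute)

lemma norm_diff_triangle:
  "x \<in> carrier X \<Longrightarrow> y \<in> carrier X \<Longrightarrow> z \<in> carrier X \<Longrightarrow> \<parallel>x \<ominus> z\<parallel> \<le> \<parallel>x \<ominus> y\<parallel> + \<parallel>y \<ominus> z\<parallel>"
  using norm_triangle[OF vdiff_closed vdiff_closed, of x y y z] by (simp add: diff_add_diff)

end

locale normed_quotient = complex_normed_space X for X :: "('v, 'm) normed_struct_scheme" (structure) +
  fixes Y :: "'v set"
  assumes closed: "closed_subspace X Y"
begin

abbreviation Q :: "'v set normed_struct" where "Q \<equiv> quotient_space X Y"
abbreviation cs :: "'v \<Rightarrow> 'v set" where "cs \<equiv> coset_of X Y"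

lemma subspace: "y \<in> Y \<Longrightarrow> y \<in> carrier X" "\<zero> \<in> Y" "x \<in> Y \<Longrightarrow> y \<in> Y \<Longrightarrow> x \<oplus> y \<in> Y" "y \<in> Y \<Longrightarrow> c \<odot> y \<in> Y"
  using closed by (auto simp: closed_subspace_def)

lemma closed_limit: "(\<And>n. s n \<in> Y) \<Longrightarrow> x \<in> carrier X \<Longrightarrow> (\<lambda>n. \<parallel>s n \<ominus> x\<parallel>) \<longlonglongrightarrow> 0 \<Longrightarrow> x \<in> Y"
  using closed unfolding closed_subspace_def by blast

lemma quotient_sel: "carrier Q = cs ` carrier X" "vzero Q = Y" "vnorm Q A = (INF a\<in>A. \<parallel>a\<parallel>)"
  by (simp_all add: quotient_space_def)

lemma coset_closed: "x \<in> carrier X \<Longrightarrow> cs x \<in> carrier Q"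
  by (simp add: quotient_sel)

lemma coset_add_subspace: 
  assumes "x \<in> carrier X" "y \<in> Y" shows "cs (x \<oplus> y) = cs x"
proof (intro equalityI subsetI)
  fix z assume "z \<in> cs (x \<oplus> y)"
  then obtain w where w: "w \<in> Y" "z = (x \<oplus> y) \<oplus> w" by (auto simp: coset_of_def)
  then have "z = x \<oplus> (y \<oplus> w)" using assms subspace by (simp add: add_assoc)
  then show "z \<in> cs x" using subspace(3)[OF assms(2) w(1)] by (auto simp: coset_of_def)
next
  fix z assume "z \<in> cs x"
  then obtain w where w: "w \<in> Y" "z = x \<oplus> w" by (auto simp: coset_of_def)
  have "z = (x \<oplus> y) \<oplus> (w \<ominus> y)"
    using assms w subspace add_diff_cancel[of w y] by (simp add: add_assoc vdiff_closed)
  moreover have "w \<ominus> y \<in> Y" using assms w subspace by (simp add: vdiff_def)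
  ultimately show "z \<in> cs (x \<oplus> y)" by (auto simp: coset_of_def)
qed

lemma coset_zero: "cs \<zero> = Y"
  using subspace by (auto simp: coset_of_def zero_add image_iff)

lemma coset_subspace: "y \<in> Y \<Longrightarrow> cs y = Y"
  using coset_add_subspace[OF zero_closed, of y] by (simp add: zero_add subspace coset_zero)

lemma coset_add: 
  assumes "x \<in> carrier X" "z \<in> carrier X" shows "vadd Q (cs x) (cs z) = cs (x \<oplus> z)"
proof (intro equalityI subsetI)
  fix u assume "u \<in> vadd Q (cs x) (cs z)"
  then obtain v w where w: "v \<in> Y" "w \<in> Y" "u = (x \<oplus> v) \<oplus> (z \<oplus> w)"
    by (auto simp: quotient_space_def coset_of_def)
  then have "u = (x \<oplus> z) \<oplus> (v \<oplus> w)"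
    using assms subspace by (simp add: add_assoc add_closed add_left_commute[of v z])
  then show "u \<in> cs (x \<oplus> z)" using subspace(3)[OF w(1,2)] by (auto simp: coset_of_def)
next
  fix u assume "u \<in> cs (x \<oplus> z)"
  then obtain w where w: "w \<in> Y" "u = (x \<oplus> z) \<oplus> w" by (auto simp: coset_of_def)
  then have "u = (x \<oplus> \<zero>) \<oplus> (z \<oplus> w)" using assms subspace by (simp add: add_assoc add_zero)
  then show "u \<in> vadd Q (cs x) (cs z)"
    using w(1) subspace(2) unfolding quotient_space_def coset_of_def by fastforce
qed

lemma coset_scale: 
  assumes "x \<in> carrier X" shows "vscale Q c (cs x) = cs (c \<odot> x)"
proof (intro equalityI subsetI)
  fix u assume "u \<in> vscale Q c (cs x)"
  then obtain v w where w: "v \<in> Y" "w \<in> Y" "u = (c \<odot> (x \<oplus> v)) \<oplus> w"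
    by (auto simp: quotient_space_def coset_of_def)
  then have "u = (c \<odot> x) \<oplus> ((c \<odot> v) \<oplus> w)"
    using assms subspace by (simp add: add_assoc scale_closed scale_add_right)
  then show "u \<in> cs (c \<odot> x)" using subspace(3)[OF subspace(4) w(2), OF w(1)] by (auto simp: coset_of_def)
next
  fix u assume "u \<in> cs (c \<odot> x)"
  then obtain w where w: "w \<in> Y" "u = (c \<odot> (x \<oplus> \<zero>)) \<oplus> w" using assms by (auto simp: coset_of_def add_zero)
  then show "u \<in> vscale Q c (cs x)"
    using subspace(2) unfolding quotient_space_def coset_of_def by fastforce
qed

lemma coset_diff: "x \<in> carrier X \<Longrightarrow> z \<in> carrier X \<Longrightarrow> cs x \<ominus>\<^bsub>Q\<^esub> cs z = cs (x \<ominus> z)"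
  by (simp add: vdiff_def coset_scale coset_add scale_closed)

lemma quotient_norm_le: 
  assumes "x \<in> carrier X" "y \<in> Y" shows "vnorm Q (cs x) \<le> \<parallel>x \<oplus> y\<parallel>"
proof -
  have "bdd_below (vnorm X ` cs x)"
    using assms(1) norm_nonneg subspace add_closed by (intro bdd_belowI2[of _ 0]) (auto simp: coset_of_def)
  then show ?thesis
    unfolding quotient_sel using assms by (intro cINF_lower) (auto simp: coset_of_def)
qed

lemma quotient_norm_le_norm: "x \<in> carrier X \<Longrightarrow> vnorm Q (cs x) \<le> \<parallel>x\<parallel>"
  using quotient_norm_le[OF _ subspace(2)] by (simp add: add_zero)

lemma quotient_norm_greatest:
  assumes "x \<in> carrier X" "\<And>y. y \<in> Y \<Longrightarrow> r \<le> \<parallel>x \<oplus> y\<parallel>" shows "r \<le> vnorm Q (cs x)"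
  unfolding quotient_sel using assms subspace(2) by (intro cINF_greatest) (auto simp: coset_of_def)

lemma quotient_norm_less:
  assumes "x \<in> carrier X" "vnorm Q (cs x) < r" obtains y where "y \<in> Y" "\<parallel>x \<oplus> y\<parallel> < r"
  using quotient_norm_greatest[OF assms(1), of r] assms(2) by force

lemma quotient_complex_normed_space: "complex_normed_space Q"
proof
  fix A B D :: "'v set" and c d :: complex
  {
    assume "A \<in> carrier Q" "B \<in> carrier Q"
    then show "A \<oplus>\<^bsub>Q\<^esub> B \<in> carrier Q" "A \<oplus>\<^bsub>Q\<^esub> B = B \<oplus>\<^bsub>Q\<^esub> A"
      "c \<odot>\<^bsub>Q\<^esub> (A \<oplus>\<^bsub>Q\<^esub> B) = (c \<odot>\<^bsub>Q\<^esub> A) \<oplus>\<^bsub>Q\<^esub> (c \<odot>\<^bsub>Q\<^esub> B)"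
      by (auto simp: quotient_sel(1) coset_add coset_scale add_closed scale_closed scale_add_right add_commute)
    show "vnorm Q (A \<oplus>\<^bsub>Q\<^esub> B) \<le> vnorm Q A + vnorm Q B"
    proof -
      obtain x z where x: "x \<in> carrier X" "A = cs x" and z: "z \<in> carrier X" "B = cs z"
        using \<open>A \<in> carrier Q\<close> \<open>B \<in> carrier Q\<close> by (auto simp: quotient_sel)
      \<comment> \<open>The two infima are taken one after the other, each with the other summand
        fixed.\<close>
      have both: "vnorm Q (cs (x \<oplus> z)) \<le> \<parallel>x \<oplus> v\<parallel> + \<parallel>z \<oplus> w\<parallel>" if "v \<in> Y" "w \<in> Y" for v w
      proof -
        have "vnorm Q (cs (x \<oplus> z)) \<le> \<parallel>(x \<oplus> z) \<oplus> (v \<oplus> w)\<parallel>"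
          using x z that subspace by (intro quotient_norm_le add_closed) auto
        also have "(x \<oplus> z) \<oplus> (v \<oplus> w) = (x \<oplus> v) \<oplus> (z \<oplus> w)"
          using x z that subspace by (simp add: add_assoc add_closed add_left_commute[of v z])
        also have "\<parallel>\<dots>\<parallel> \<le> \<parallel>x \<oplus> v\<parallel> + \<parallel>z \<oplus> w\<parallel>"
          using x z that subspace by (intro norm_triangle add_closed) auto
        finally show ?thesis .
      qed
      have "vnorm Q (cs (x \<oplus> z)) - vnorm Q (cs x) \<le> vnorm Q (cs z)"
      proof (rule quotient_norm_greatest[OF z(1)])
        fix w assume w: "w \<in> Y"
        have "vnorm Q (cs (x \<oplus> z)) - \<parallel>z \<oplus> w\<parallel> \<le> vnorm Q (cs x)"
          using both[OF _ w] by (intro quotient_norm_greatest[OF x(1)]) (simp add: algebra_simps)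
        then show "vnorm Q (cs (x \<oplus> z)) - vnorm Q (cs x) \<le> \<parallel>z \<oplus> w\<parallel>" by simp
      qed
      then show ?thesis by (simp add: x z coset_add)
    qed
  }
  {
    assume "A \<in> carrier Q" "B \<in> carrier Q" "D \<in> carrier Q"
    then show "A \<oplus>\<^bsub>Q\<^esub> B \<oplus>\<^bsub>Q\<^esub> D = A \<oplus>\<^bsub>Q\<^esub> (B \<oplus>\<^bsub>Q\<^esub> D)"
      by (auto simp: quotient_sel(1) coset_add add_closed add_assoc)
  }
  show "\<zero>\<^bsub>Q\<^esub> \<in> carrier Q" using coset_closed[OF zero_closed] by (simp add: coset_zero quotient_sel(2))
  assume "A \<in> carrier Q"
  then obtain x where x: "x \<in> carrier X" "A = cs x" by (auto simp: quotient_sel)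
  show "c \<odot>\<^bsub>Q\<^esub> A \<in> carrier Q" "(c + d) \<odot>\<^bsub>Q\<^esub> A = (c \<odot>\<^bsub>Q\<^esub> A) \<oplus>\<^bsub>Q\<^esub> (d \<odot>\<^bsub>Q\<^esub> A)"
    "c \<odot>\<^bsub>Q\<^esub> d \<odot>\<^bsub>Q\<^esub> A = (c * d) \<odot>\<^bsub>Q\<^esub> A" "1 \<odot>\<^bsub>Q\<^esub> A = A"
    using x by (auto simp: coset_closed coset_add coset_scale scale_closed scale_add_left scale_scale scale_one)
  show "A \<oplus>\<^bsub>Q\<^esub> \<zero>\<^bsub>Q\<^esub> = A"
    using x coset_add[OF x(1) zero_closed] by (simp add: quotient_sel(2) coset_zero add_zero)
  show "A \<ominus>\<^bsub>Q\<^esub> A = \<zero>\<^bsub>Q\<^esub>"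
    using x by (simp add: coset_diff diff_self coset_zero quotient_sel(2))
  show "0 \<le> vnorm Q A"
    using x subspace by (auto intro!: quotient_norm_greatest norm_nonneg add_closed)
  show "vnorm Q A = 0 \<longleftrightarrow> A = \<zero>\<^bsub>Q\<^esub>"
  proof
    assume 0: "vnorm Q A = 0"
    \<comment> \<open>Closedness of \<open>Y\<close> makes the norm definite: the negatives of these
      \<open>y\<close> tend to \<open>x\<close>.\<close>
    have "\<exists>y. y \<in> Y \<and> \<parallel>x \<oplus> y\<parallel> < inverse (real (Suc n))" for n
      by (rule quotient_norm_less[OF x(1), of "inverse (real (Suc n))"]) (use 0 x(2) in auto)
    then obtain y where "\<And>n. y n \<in> Y \<and> \<parallel>x \<oplus> y n\<parallel> < inverse (real (Suc n))" by metis
    then have y: "\<And>n. y n \<in> Y" "\<And>n. \<parallel>x \<oplus> y n\<parallel> < inverse (real (Suc n))" by auto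
    have eq: "\<parallel>((-1) \<odot> y n) \<ominus> x\<parallel> = \<parallel>x \<oplus> y n\<parallel>" for n
      using norm_scale[of "x \<oplus> y n" "-1"] x y subspace
      by (simp add: vdiff_def scale_add_right scale_closed add_closed add_commute)
    have "0 \<le> \<parallel>x \<oplus> y n\<parallel>" for n by (intro norm_nonneg add_closed x subspace(1) y)
    then have "(\<lambda>n. \<parallel>x \<oplus> y n\<parallel>) \<longlonglongrightarrow> 0"
      by (intro tendsto_sandwich[OF _ _ tendsto_const LIMSEQ_inverse_real_of_nat])
        (auto simp only: less_imp_le[OF y(2)] intro!: always_eventually)
    then have "x \<in> Y"
      by (intro closed_limit[of "\<lambda>n. (-1) \<odot> y n", OF subspace(4)[OF y(1)] x(1)]) (simp only: eq)
    then show "A = \<zero>\<^bsub>Q\<^esub>" using x by (simp add: coset_subspace quotient_sel(2))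
  next
    assume "A = \<zero>\<^bsub>Q\<^esub>"
    then have "A = cs \<zero>" by (simp add: coset_zero quotient_sel(2))
    then show "vnorm Q A = 0"
      using quotient_norm_le_norm[OF zero_closed] \<open>0 \<le> vnorm Q A\<close> norm_zero by simp
  qed
  \<comment> \<open>Applied to \<open>c\<close> and to \<open>1 / c\<close>, this gives
    equality.\<close>
  have scale_le: "vnorm Q (cs (c \<odot> x)) \<le> cmod c * vnorm Q (cs x)" if x: "x \<in> carrier X" and c: "c \<noteq> 0" for c x
  proof -
    have "vnorm Q (cs (c \<odot> x)) / cmod c \<le> vnorm Q (cs x)"
    proof (rule quotient_norm_greatest[OF x])
      fix y assume y: "y \<in> Y"
      have "vnorm Q (cs (c \<odot> x)) \<le> \<parallel>(c \<odot> x) \<oplus> (c \<odot> y)\<parallel>"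
        using x y subspace by (intro quotient_norm_le scale_closed)
      also have "\<dots> = cmod c * \<parallel>x \<oplus> y\<parallel>"
        using x y subspace by (simp add: norm_scale add_closed flip: scale_add_right)
      finally show "vnorm Q (cs (c \<odot> x)) / cmod c \<le> \<parallel>x \<oplus> y\<parallel>" using c by (simp add: field_simps)
    qed
    then show ?thesis using c by (simp add: field_simps)
  qed
  show "vnorm Q (c \<odot>\<^bsub>Q\<^esub> A) = cmod c * vnorm Q A"
  proof (cases "c = 0")
    case True
    have "vnorm Q (cs \<zero>) \<le> 0" using quotient_norm_le_norm[OF zero_closed] norm_zero by simp
    moreover have "0 \<le> vnorm Q (cs \<zero>)"
      using subspace by (auto intro!: quotient_norm_greatest norm_nonneg add_closed zero_closed)
    ultimately show ?thesis using True x by (simp add: coset_scale scale_zero_left)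
  next
    case False
    have "vnorm Q (cs x) \<le> cmod (1 / c) * vnorm Q (cs (c \<odot> x))"
      using scale_le[of "c \<odot> x" "1 / c"] False x by (simp add: scale_closed scale_scale scale_one)
    then show ?thesis using scale_le[OF x(1) False] False x
      by (simp add: coset_scale norm_divide field_simps)
  qed
qed

end

text \<open>A subsequence with steps below \<open>(1 / 2) ^ k\<close> is lifted to a Cauchy sequence
  in \<open>X\<close> by choosing representatives one after the other; the limit of the lifts
  represents the limit.\<close>

lemma quotient_complex_banach_space:
  fixes X :: "('v, 'm) normed_struct_scheme" (structure)
  assumes X: "complex_banach_space X" and Y: "closed_subspace X Y"
  shows "complex_banach_space (quotient_space X Y)"
proof -
  interpret X: complex_banach_space X by (rule X)
  interpret normed_quotient X Y by standard (rule Y)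
  interpret Q: complex_normed_space Q by (rule quotient_complex_normed_space)
  show ?thesis
  proof
    fix A :: "nat \<Rightarrow> 'v set"
    assume A: "\<And>n. A n \<in> carrier Q"
      and Cauchy: "\<forall>\<epsilon>>0. \<exists>N::nat. \<forall>i\<ge>N. \<forall>j\<ge>N. vnorm Q (A i \<ominus>\<^bsub>Q\<^esub> A j) < \<epsilon>"
    have "\<exists>N. \<forall>i\<ge>N. \<forall>j\<ge>N. vnorm Q (A i \<ominus>\<^bsub>Q\<^esub> A j) < (1 / 2) ^ k" for k
      using Cauchy by simp
    then obtain N where N: "\<And>k i j. i \<ge> N k \<Longrightarrow> j \<ge> N k \<Longrightarrow> vnorm Q (A i \<ominus>\<^bsub>Q\<^esub> A j) < (1 / 2) ^ k"
      by metis
    \<comment> \<open>Partial sums make the indices monotone while keeping them above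
      \<open>N k\<close>.\<close>
    define r where "r k = (\<Sum>i\<le>k. N i)" for k
    have r: "N k \<le> r k" "r k \<le> r (Suc k)" for k
      by (auto simp: r_def intro: member_le_sum)
    have "\<exists>x. \<forall>k. (x k \<in> carrier X \<and> cs (x k) = A (r k)) \<and> \<parallel>x (Suc k) \<ominus> x k\<parallel> < (1 / 2) ^ k"
    proof (rule dependent_nat_choice)
      show "\<exists>x. x \<in> carrier X \<and> cs x = A (r 0)" using A[of "r 0"] by (auto simp: quotient_sel)
      fix x k assume x: "x \<in> carrier X \<and> cs x = A (r k)"
      obtain z where z: "z \<in> carrier X" "cs z = A (r (Suc k))" using A[of "r (Suc k)"] by (auto simp: quotient_sel)
      have "vnorm Q (A (r (Suc k)) \<ominus>\<^bsub>Q\<^esub> A (r k)) < (1 / 2) ^ k"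
        using r(1)[of k] r(2)[of k] by (intro N) auto
      then have "vnorm Q (cs (z \<ominus> x)) < (1 / 2) ^ k"
        using x z coset_diff by metis
      then obtain y where y: "y \<in> Y" "\<parallel>(z \<ominus> x) \<oplus> y\<parallel> < (1 / 2) ^ k"
        using quotient_norm_less X.vdiff_closed x z by metis
      have "(z \<oplus> y) \<ominus> x = (z \<ominus> x) \<oplus> y"
        using x z subspace(1)[OF y(1)] by (simp add: vdiff_def X.add_assoc X.scale_closed X.add_commute[of y])
      then show "\<exists>u. (u \<in> carrier X \<and> cs u = A (r (Suc k))) \<and> \<parallel>u \<ominus> x\<parallel> < (1 / 2) ^ k"
        using y z subspace(1)[OF y(1)] coset_add_subspace[OF z(1) y(1)] X.add_closed
        by (intro exI[of _ "z \<oplus> y"]) auto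
    qed
    then obtain x where x: "\<And>k. x k \<in> carrier X" "\<And>k. cs (x k) = A (r k)"
      "\<And>k. \<parallel>x (Suc k) \<ominus> x k\<parallel> < (1 / 2) ^ k"
      by blast
    \<comment> \<open>The subtracted term makes the geometric bound exact enough for the
      induction.\<close>
    have tail: "\<parallel>x (k + n) \<ominus> x k\<parallel> \<le> 2 * (1 / 2) ^ k - 2 * (1 / 2) ^ (k + n)" for k n
    proof (induction n)
      case 0
      then show ?case using X.diff_self[OF x(1)] X.norm_zero by simp
    next
      case (Suc n)
      have "\<parallel>x (Suc (k + n)) \<ominus> x k\<parallel> \<le> \<parallel>x (Suc (k + n)) \<ominus> x (k + n)\<parallel> + \<parallel>x (k + n) \<ominus> x k\<parallel>"
        by (rule X.norm_diff_triangle[OF x(1) x(1) x(1)])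
      then show ?case using Suc x(3)[of "k + n"] by simp
    qed
    have tail': "\<parallel>x i \<ominus> x k\<parallel> \<le> 2 * (1 / 2) ^ k" if "k \<le> i" for i k
    proof -
      have "\<parallel>x i \<ominus> x k\<parallel> \<le> 2 * (1 / 2) ^ k - 2 * (1 / 2) ^ i"
        using tail[of k "i - k"] that by simp
      also have "\<dots> \<le> 2 * (1 / 2) ^ k" by simp
      finally show ?thesis .
    qed
    have small: "\<exists>k. c * (1 / 2) ^ k < e" if "0 < e" "0 < c" for e c :: real
    proof -
      obtain k where "(1 / 2 :: real) ^ k < e / c"
        using real_arch_pow_inv[of "e / c" "1 / 2"] divide_pos_pos[OF \<open>0 < e\<close> \<open>0 < c\<close>] by auto
      then show ?thesis using that by (auto simp: field_simps)
    qed
    have "\<exists>y\<in>carrier X. (\<lambda>n. \<parallel>x n \<ominus> y\<parallel>) \<longlonglongrightarrow> 0"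
    proof (rule X.complete[OF x(1)], intro allI impI)
      fix e :: real assume "0 < e"
      then obtain k where k: "4 * (1 / 2) ^ k < e" using small[of e 4] by auto
      have "\<parallel>x i \<ominus> x j\<parallel> < e" if "i \<ge> k" "j \<ge> k" for i j
        using X.norm_diff_triangle[OF x(1)[of i] x(1)[of k] x(1)[of j]] tail'[OF that(1)] tail'[OF that(2)]
          X.norm_diff_commute[OF x(1)[of j] x(1)[of k]] k by linarith
      then show "\<exists>N. \<forall>i\<ge>N. \<forall>j\<ge>N. \<parallel>x i \<ominus> x j\<parallel> < e" by blast
    qed
    then obtain y where y: "y \<in> carrier X" "(\<lambda>n. \<parallel>x n \<ominus> y\<parallel>) \<longlonglongrightarrow> 0" by blast
    have yQ: "cs y \<in> carrier Q" by (rule coset_closed[OF y(1)])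
    have "(\<lambda>n. vnorm Q (A n \<ominus>\<^bsub>Q\<^esub> cs y)) \<longlonglongrightarrow> 0"
    proof (rule LIMSEQ_I)
      fix e :: real assume e: "0 < e"
      obtain k0 where k0: "1 * (1 / 2) ^ k0 < e / 2" using small[of "e / 2" 1] e by auto
      obtain k1 where k1: "\<And>n. n \<ge> k1 \<Longrightarrow> \<parallel>x n \<ominus> y\<parallel> < e / 2"
        using LIMSEQ_D[OF y(2), of "e / 2"] e by fastforce
      define k where "k = max k0 k1"
      have mono: "r k0 \<le> r k" using lift_Suc_mono_le[of r, OF r(2)] by (simp add: k_def)
      have "norm (vnorm Q (A n \<ominus>\<^bsub>Q\<^esub> cs y) - 0) < e" if n: "n \<ge> r k" for n
      proof -
        have "vnorm Q (A n \<ominus>\<^bsub>Q\<^esub> A (r k)) < (1 / 2) ^ k0"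
          using n mono r(1)[of k0] by (intro N) auto
        moreover have "vnorm Q (A (r k) \<ominus>\<^bsub>Q\<^esub> cs y) \<le> \<parallel>x k \<ominus> y\<parallel>"
          using quotient_norm_le_norm[OF X.vdiff_closed[OF x(1)[of k] y(1)]]
          by (simp add: coset_diff[OF x(1) y(1), symmetric] x(2))
        moreover have "vnorm Q (A n \<ominus>\<^bsub>Q\<^esub> cs y) \<le> vnorm Q (A n \<ominus>\<^bsub>Q\<^esub> A (r k)) + vnorm Q (A (r k) \<ominus>\<^bsub>Q\<^esub> cs y)"
          by (rule Q.norm_diff_triangle[OF A A yQ])
        moreover have "0 \<le> vnorm Q (A n \<ominus>\<^bsub>Q\<^esub> cs y)"
          by (rule Q.norm_nonneg[OF Q.vdiff_closed[OF A yQ]])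
        ultimately show ?thesis using k0 k1[of k] by (simp add: k_def)
      qed
      then show "\<exists>no. \<forall>n\<ge>no. norm (vnorm Q (A n \<ominus>\<^bsub>Q\<^esub> cs y) - 0) < e" by blast
    qed
    then show "\<exists>B\<in>carrier Q. (\<lambda>n. vnorm Q (A n \<ominus>\<^bsub>Q\<^esub> B)) \<longlonglongrightarrow> 0" using yQ by blast
  qed
qed

section \<open>Rank-one operators and a criterion for the Daugavet property\<close>

context complex_normed_space
begin

text \<open>The coefficient \<open>\<phi> x\<close> is unique because \<open>c \<odot> e\<close>
  determines \<open>c\<close>; uniqueness passes linearity from \<open>T\<close> to \<phi>.\<close>

lemma rank_one_decomposition:
  assumes T: "bounded_operator X X T" and rank: "rank_one X X T"
  obtains \<phi> e where "e \<in> carrier X" "\<parallel>e\<parallel> = 1" "bounded_operator X scalar_space \<phi>"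
    "\<And>x. x \<in> carrier X \<Longrightarrow> T x = \<phi> x \<odot> e"
proof -
  obtain e0 where e0: "e0 \<in> carrier X" "e0 \<noteq> \<zero>" "T ` carrier X = {c \<odot> e0 | c. True}"
    using rank by (auto simp: rank_one_def)
  have n0: "\<parallel>e0\<parallel> \<noteq> 0" using e0 norm_eq_0_iff by auto
  define e where "e = complex_of_real (1 / \<parallel>e0\<parallel>) \<odot> e0"
  have e: "e \<in> carrier X" "\<parallel>e\<parallel> = 1"
    using e0 n0 norm_nonneg[OF e0(1)] by (auto simp: e_def scale_closed norm_scale norm_divide)
  have "\<exists>c. T x = c \<odot> e" if "x \<in> carrier X" for x
  proof -
    have "T x \<in> T ` carrier X" using that by (rule imageI)
    then obtain c where "T x = c \<odot> e0" unfolding e0(3) by auto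
    then have "T x = (c * of_real \<parallel>e0\<parallel>) \<odot> e" using e0(1) n0 by (simp add: e_def scale_scale)
    then show ?thesis ..
  qed
  then obtain \<phi> where \<phi>: "\<And>x. x \<in> carrier X \<Longrightarrow> T x = \<phi> x \<odot> e" by metis
  have inj: "c = d" if "c \<odot> e = d \<odot> e" for c d
  proof -
    have "(c - d) \<odot> e = (c \<odot> e) \<ominus> (d \<odot> e)"
      using scale_add_left[OF e(1), of c "- d"] e(1) by (simp add: vdiff_def scale_scale)
    also have "\<dots> = \<zero>" using that diff_self scale_closed[OF e(1)] by simp
    finally have "cmod (c - d) * \<parallel>e\<parallel> = 0" using norm_scale[OF e(1), of "c - d"] norm_zero by simp
    then show ?thesis using e(2) by simp
  qed
  have "bounded_operator X scalar_space \<phi>"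
    unfolding bounded_operator_def
  proof (intro conjI ballI allI)
    fix x y assume x: "x \<in> carrier X" "y \<in> carrier X"
    have "T (x \<oplus> y) = T x \<oplus> T y" using T x unfolding bounded_operator_def by blast
    then have "\<phi> (x \<oplus> y) \<odot> e = (\<phi> x + \<phi> y) \<odot> e"
      using x e by (simp add: \<phi> scale_add_left add_closed)
    then show "\<phi> (x \<oplus> y) = \<phi> x \<oplus>\<^bsub>scalar_space\<^esub> \<phi> y" using inj by (simp add: scalar_space_def)
  next
    fix c x assume x: "x \<in> carrier X"
    have "T (c \<odot> x) = c \<odot> T x" using T x unfolding bounded_operator_def by blast
    then have "\<phi> (c \<odot> x) \<odot> e = (c * \<phi> x) \<odot> e"
      using x e by (simp add: \<phi> scale_closed scale_scale)
    then show "\<phi> (c \<odot> x) = c \<odot>\<^bsub>scalar_space\<^esub> \<phi> x" using inj by (simp add: scalar_space_def)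
  next
    obtain K where K: "\<forall>x\<in>carrier X. \<parallel>T x\<parallel> \<le> K * \<parallel>x\<parallel>" using T by (auto simp: bounded_operator_def)
    then have "\<parallel>\<phi> x\<parallel>\<^bsub>scalar_space\<^esub> \<le> K * \<parallel>x\<parallel>" if "x \<in> carrier X" for x
      using that e norm_scale[OF e(1), of "\<phi> x"] \<phi>[OF that] by (auto simp: scalar_space_def)
    then show "\<exists>K. \<forall>x\<in>carrier X. \<parallel>\<phi> x\<parallel>\<^bsub>scalar_space\<^esub> \<le> K * \<parallel>x\<parallel>" by blast
  qed (simp add: scalar_space_def)
  then show thesis using that e \<phi> by blast
qed

end

text \<open>Besides the triangle inequality only the lower bound needs proof. As \<open>e\<close>
  has norm 1, the norm of \<open>T x0\<close> is \<open>cmod (\<phi> x0)\<close>, so for each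
  \<open>x0\<close> in the ball it suffices to find some \<open>x\<close>, possibly far from
  \<open>x0\<close>, that nearly reaches \<open>1 + cmod (\<phi> x0)\<close>.\<close>

lemma daugavet_propertyI:
  fixes X :: "('v, 'm) normed_struct_scheme" (structure)
  assumes X: "complex_banach_space X"
    and ex: "\<And>\<phi> e x0 \<epsilon>. bounded_operator X scalar_space \<phi> \<Longrightarrow> e \<in> carrier X \<Longrightarrow> \<parallel>e\<parallel> = 1 \<Longrightarrow>
      x0 \<in> carrier X \<Longrightarrow> \<parallel>x0\<parallel> \<le> 1 \<Longrightarrow> 0 < \<epsilon> \<Longrightarrow>
      \<exists>x\<in>carrier X. \<parallel>x\<parallel> \<le> 1 \<and> 1 + cmod (\<phi> x0) - \<epsilon> \<le> \<parallel>x \<oplus> (\<phi> x \<odot> e)\<parallel>"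
  shows "daugavet_property X"
  unfolding daugavet_property_def
proof (intro conjI allI impI X)
  interpret complex_banach_space X by (rule X)
  fix T assume "bounded_operator X X T \<and> rank_one X X T"
  then have T: "bounded_operator X X T" and rank: "rank_one X X T" by auto
  obtain \<phi> e where e: "e \<in> carrier X" "\<parallel>e\<parallel> = 1" and \<phi>: "bounded_operator X scalar_space \<phi>"
    and T_eq: "\<And>x. x \<in> carrier X \<Longrightarrow> T x = \<phi> x \<odot> e"
    using rank_one_decomposition[OF T rank] by metis
  define B where "B = {x \<in> carrier X. \<parallel>x\<parallel> \<le> 1}"
  have B0: "\<zero> \<in> B" using zero_closed norm_zero by (simp add: B_def)
  obtain K where K: "\<forall>x\<in>carrier X. \<parallel>T x\<parallel> \<le> K * \<parallel>x\<parallel>" using T by (auto simp: bounded_operator_def)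
  have TX: "x \<in> carrier X \<Longrightarrow> T x \<in> carrier X" for x using T by (auto simp: bounded_operator_def)
  have T_le: "\<parallel>T x\<parallel> \<le> \<bar>K\<bar>" if "x \<in> B" for x
  proof -
    have "\<parallel>T x\<parallel> \<le> K * \<parallel>x\<parallel>" using that K by (simp add: B_def)
    also have "\<dots> \<le> \<bar>K\<bar> * \<parallel>x\<parallel>" using that norm_nonneg by (intro mult_right_mono) (auto simp: B_def)
    also have "\<dots> \<le> \<bar>K\<bar>" using that by (simp add: B_def mult_left_le)
    finally show ?thesis .
  qed
  have IT_le: "\<parallel>x \<oplus> T x\<parallel> \<le> 1 + \<parallel>T x\<parallel>" if "x \<in> B" for x
    using norm_triangle[of x "T x"] that TX by (simp add: B_def)
  have bddT: "bdd_above ((\<lambda>x. \<parallel>T x\<parallel>) ` B)" by (rule bdd_aboveI2[OF T_le])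
  have bddIT: "bdd_above ((\<lambda>x. \<parallel>x \<oplus> T x\<parallel>) ` B)"
    by (rule bdd_aboveI2[of _ _ "1 + \<bar>K\<bar>"]) (use IT_le T_le in force)
  show "operator_norm X X (\<lambda>x. x \<oplus> T x) = 1 + operator_norm X X T"
    unfolding operator_norm_def B_def[symmetric]
  proof (rule order_antisym)
    show "(SUP x\<in>B. \<parallel>x \<oplus> T x\<parallel>) \<le> 1 + (SUP x\<in>B. \<parallel>T x\<parallel>)"
    proof (rule cSUP_least)
      show "B \<noteq> {}" using B0 by auto
      fix x assume "x \<in> B"
      then show "\<parallel>x \<oplus> T x\<parallel> \<le> 1 + (SUP x\<in>B. \<parallel>T x\<parallel>)"
        using IT_le[of x] cSUP_upper[OF _ bddT, of x] by simp
    qed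
    have "(SUP x\<in>B. \<parallel>T x\<parallel>) \<le> (SUP x\<in>B. \<parallel>x \<oplus> T x\<parallel>) - 1"
    proof (rule cSUP_least)
      show "B \<noteq> {}" using B0 by auto
      fix x0 assume x0: "x0 \<in> B"
      then have Tx0: "\<parallel>T x0\<parallel> = cmod (\<phi> x0)" using e by (simp add: B_def T_eq norm_scale)
      show "\<parallel>T x0\<parallel> \<le> (SUP x\<in>B. \<parallel>x \<oplus> T x\<parallel>) - 1"
      proof (rule field_le_epsilon)
        fix \<epsilon> :: real assume "0 < \<epsilon>"
        then obtain x where x: "x \<in> carrier X" "\<parallel>x\<parallel> \<le> 1"
          "1 + cmod (\<phi> x0) - \<epsilon> \<le> \<parallel>x \<oplus> (\<phi> x \<odot> e)\<parallel>"
          using ex[OF \<phi> e, of x0 \<epsilon>] x0 by (auto simp: B_def)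
        have "\<parallel>x \<oplus> T x\<parallel> \<le> (SUP x\<in>B. \<parallel>x \<oplus> T x\<parallel>)"
          using x by (intro cSUP_upper bddIT) (simp add: B_def)
        then show "\<parallel>T x0\<parallel> \<le> (SUP x\<in>B. \<parallel>x \<oplus> T x\<parallel>) - 1 + \<epsilon>"
          using x Tx0 T_eq[OF x(1)] by simp
      qed
    qed
    then show "1 + (SUP x\<in>B. \<parallel>T x\<parallel>) \<le> (SUP x\<in>B. \<parallel>x \<oplus> T x\<parallel>)" by simp
  qed
qed

section \<open>The spaces of continuous and of integrable functions\<close>

lemma C_space_sel:
  "carrier C_space = {f. continuous_on UNIV f}" "vadd C_space f g = (\<lambda>x. f x + g x)" "vzero C_space = (\<lambda>x. 0)"
  "vscale C_space c f = (\<lambda>x. c * f x)" "vnorm C_space f = (SUP x. cmod (f x))"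
  by (simp_all add: C_space_def)

lemma C_space_diff: "f \<ominus>\<^bsub>C_space\<^esub> g = (\<lambda>x. f x - g x)"
  by (simp add: vdiff_def C_space_sel)

lemma C_norm_least: "(\<And>x. cmod (f x) \<le> M) \<Longrightarrow> vnorm C_space f \<le> M"
  unfolding C_space_sel by (rule cSUP_least) auto

lemma C_norm_upper:
  assumes "compact (UNIV :: 'a::topological_space set)" "continuous_on UNIV f"
  shows "cmod (f (x :: 'a)) \<le> vnorm C_space f"
proof -
  have "bounded (range f)" by (rule compact_imp_bounded[OF compact_continuous_image[OF assms(2,1)]])
  then have "bdd_above (range (\<lambda>x. cmod (f x)))" by (auto simp: bounded_iff intro: bdd_aboveI2)
  then show ?thesis unfolding C_space_sel by (intro cSUP_upper) auto
qed

lemma C_space_complex_banach_space: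
  assumes compact: "compact (UNIV :: 'a::topological_space set)"
  shows "complex_banach_space (C_space :: ('a \<Rightarrow> complex) normed_struct)"
proof -
  note upper = C_norm_upper[OF compact]
  have normed: "complex_normed_space (C_space :: ('a \<Rightarrow> complex) normed_struct)"
  proof
    fix f g :: "'a \<Rightarrow> complex" and c
    assume "f \<in> carrier C_space"
    then have f: "continuous_on UNIV f" by (simp add: C_space_sel)
    show nonneg: "0 \<le> vnorm C_space f" using order_trans[OF norm_ge_zero upper[OF f]] .
    show "vnorm C_space f = 0 \<longleftrightarrow> f = \<zero>\<^bsub>C_space\<^esub>"
    proof
      assume "vnorm C_space f = 0"
      then show "f = \<zero>\<^bsub>C_space\<^esub>" using upper[OF f] by (auto simp: C_space_sel(3))
    next
      assume "f = \<zero>\<^bsub>C_space\<^esub>"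
      then have "vnorm C_space f \<le> 0" by (intro C_norm_least) (simp add: C_space_sel(3))
      then show "vnorm C_space f = 0" using nonneg by simp
    qed
    have le: "vnorm C_space (\<lambda>x. c * f x) \<le> cmod c * vnorm C_space f" if "continuous_on UNIV f" for c and f :: "'a \<Rightarrow> complex"
      using upper[OF that] by (intro C_norm_least) (simp add: norm_mult mult_left_mono)
    show "vnorm C_space (c \<odot>\<^bsub>C_space\<^esub> f) = cmod c * vnorm C_space f"
    proof (cases "c = 0")
      case True
      have "vnorm C_space (\<lambda>x::'a. 0) = 0" by (simp add: C_space_sel(5))
      then show ?thesis using True by (simp add: C_space_sel(4))
    next
      case False
      have "cmod c * vnorm C_space f \<le> vnorm C_space (\<lambda>x. c * f x)"
        using le[of "\<lambda>x. c * f x" "1 / c"] False f by (simp add: norm_divide field_simps continuous_on_mult_left)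
      then show ?thesis using le[OF f, of c] by (simp add: C_space_sel(4))
    qed
    assume "g \<in> carrier C_space"
    then have g: "continuous_on UNIV g" by (simp add: C_space_sel)
    show "vnorm C_space (f \<oplus>\<^bsub>C_space\<^esub> g) \<le> vnorm C_space f + vnorm C_space g"
      unfolding C_space_sel(2) by (intro C_norm_least norm_triangle_le add_mono upper f g)
  qed (auto simp: C_space_sel(1-4) C_space_diff intro!: continuous_intros simp: algebra_simps)
  interpret complex_normed_space "C_space :: ('a \<Rightarrow> complex) normed_struct" by (rule normed)
  show ?thesis
  proof
    fix s :: "nat \<Rightarrow> 'a \<Rightarrow> complex"
    assume s: "\<And>n. s n \<in> carrier C_space"
      and Cauchy: "\<forall>\<epsilon>>0. \<exists>N::nat. \<forall>i\<ge>N. \<forall>j\<ge>N. vnorm C_space (s i \<ominus>\<^bsub>C_space\<^esub> s j) < \<epsilon>"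
    have sc: "continuous_on UNIV (s n)" for n using s by (simp add: C_space_sel)
    have "uniformly_Cauchy_on UNIV s"
    proof (rule uniformly_Cauchy_onI)
      fix e :: real assume "0 < e"
      then obtain N where N: "\<And>i j. i \<ge> N \<Longrightarrow> j \<ge> N \<Longrightarrow> vnorm C_space (s i \<ominus>\<^bsub>C_space\<^esub> s j) < e"
        using Cauchy by blast
      have "dist (s i x) (s j x) < e" if "i \<ge> N" "j \<ge> N" for i j x
        using upper[OF continuous_on_diff[OF sc sc], of i x j] N[OF that] by (simp add: dist_norm C_space_diff)
      then show "\<exists>M. \<forall>x\<in>UNIV. \<forall>i\<ge>M. \<forall>j\<ge>M. dist (s i x) (s j x) < e" by blast
    qed
    then obtain f where f: "uniform_limit UNIV s f sequentially"
      using Cauchy_uniformly_convergent uniformly_convergent_on_def by blast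
    have fc: "continuous_on UNIV f" by (rule uniform_limit_theorem[OF _ f]) (use sc in auto)
    have "(\<lambda>n. vnorm C_space (s n \<ominus>\<^bsub>C_space\<^esub> f)) \<longlonglongrightarrow> 0"
    proof (rule LIMSEQ_I)
      fix e :: real assume e: "0 < e"
      obtain N where N: "\<And>n x. n \<ge> N \<Longrightarrow> dist (s n x) (f x) < e / 2"
        using uniform_limitD[OF f, of "e / 2"] e by (auto simp: eventually_sequentially)
      have "norm (vnorm C_space (s n \<ominus>\<^bsub>C_space\<^esub> f) - 0) < e" if "n \<ge> N" for n
      proof -
        have "vnorm C_space (s n \<ominus>\<^bsub>C_space\<^esub> f) \<le> e / 2"
          using N[OF that] by (intro C_norm_least) (simp add: C_space_diff dist_norm less_imp_le)
        moreover have "0 \<le> vnorm C_space (s n \<ominus>\<^bsub>C_space\<^esub> f)"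
          using sc fc by (intro norm_nonneg) (simp add: C_space_sel(1) C_space_diff continuous_on_diff)
        ultimately show ?thesis using e by simp
      qed
      then show "\<exists>no. \<forall>n\<ge>no. norm (vnorm C_space (s n \<ominus>\<^bsub>C_space\<^esub> f) - 0) < e" by blast
    qed
    then show "\<exists>x\<in>carrier C_space. (\<lambda>n. vnorm C_space (s n \<ominus>\<^bsub>C_space\<^esub> x)) \<longlonglongrightarrow> 0"
      using fc by (auto simp: C_space_sel(1))
  qed
qed

section \<open>Spectral subspaces and classes of integrable functions\<close>

context compact_haar
begin

lemma closed_subspace_C_spectral: "closed_subspace C_space (C_spectral m \<Theta>)"
  unfolding closed_subspace_def
proof (intro conjI ballI allI impI)
  show "C_spectral m \<Theta> \<subseteq> carrier C_space" by (auto simp: C_spectral_def)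
  show "\<zero>\<^bsub>C_space\<^esub> \<in> C_spectral m \<Theta>" by (simp add: C_space_sel C_spectral_zero)
next
  fix f g c assume "f \<in> C_spectral m \<Theta>"
  then show "c \<odot>\<^bsub>C_space\<^esub> f \<in> C_spectral m \<Theta>" by (simp add: C_space_sel C_spectral_scale)
  assume "g \<in> C_spectral m \<Theta>"
  with \<open>f \<in> _\<close> show "f \<oplus>\<^bsub>C_space\<^esub> g \<in> C_spectral m \<Theta>" by (simp add: C_space_sel C_spectral_add)
next
  fix s :: "nat \<Rightarrow> 'g \<Rightarrow> complex" and f
  assume "(\<forall>n. s n \<in> C_spectral m \<Theta>) \<and> f \<in> carrier C_space \<and> (\<lambda>n. vnorm C_space (s n \<ominus>\<^bsub>C_space\<^esub> f)) \<longlonglongrightarrow> 0"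
  then have s: "\<And>n. s n \<in> C_spectral m \<Theta>" and f: "cont f" and lim: "(\<lambda>n. vnorm C_space (s n \<ominus>\<^bsub>C_space\<^esub> f)) \<longlonglongrightarrow> 0"
    by (auto simp: C_space_sel(1))
  have "fourier_coeff m f \<gamma> = 0" if \<gamma>: "\<gamma> \<in> dual_group - \<Theta>" for \<gamma>
  proof -
    have c: "cont (\<lambda>x. cnj (\<gamma> x))" "\<And>x. cmod (cnj (\<gamma> x)) \<le> 1"
      using \<gamma> dual_groupD[of \<gamma>] by (auto intro: continuous_intros)
    \<comment> \<open>The coefficient of \<open>s n\<close> is 0, so that of \<open>f\<close> is, up
      to sign, the coefficient of the difference, bounded by its sup norm.\<close>
    have "cmod (fourier_coeff m f \<gamma>) \<le> vnorm C_space (s n \<ominus>\<^bsub>C_space\<^esub> f)" for n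
    proof -
      let ?d = "\<lambda>x. s n x - f x"
      have sc: "cont (s n)" using s by (rule C_spectral_cont)
      then have d: "cont ?d" using f by (rule continuous_on_diff)
      have "fourier_coeff m (\<lambda>x. s n x + (-1) * f x) \<gamma> = fourier_coeff m (s n) \<gamma> + (-1) * fourier_coeff m f \<gamma>"
        using \<gamma> sc f by (subst fourier_coeff_add) (auto simp only: fourier_coeff_scale intro!: integrable_continuous continuous_intros)
      moreover have "fourier_coeff m (s n) \<gamma> = 0" using s[of n] \<gamma> by (simp add: C_spectral_def)
      ultimately have "cmod (fourier_coeff m f \<gamma>) = cmod (LINT x|m. ?d x * cnj (\<gamma> x))"
        by (simp add: fourier_coeff_def)
      also have "\<dots> \<le> vnorm C_space ?d"
      proof (rule integral_bound_prob)
        show "integrable m (\<lambda>x. ?d x * cnj (\<gamma> x))" by (intro integrable_continuous continuous_on_mult d c)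
        fix x
        have "cmod (?d x) * cmod (cnj (\<gamma> x)) \<le> cmod (?d x)" by (rule mult_left_le[OF c(2)]) simp
        also have "\<dots> \<le> vnorm C_space ?d" by (rule C_norm_upper[OF compact_UNIV d])
        finally show "norm (?d x * cnj (\<gamma> x)) \<le> vnorm C_space ?d" by (simp only: norm_mult)
      qed
      finally show ?thesis by (simp only: C_space_diff)
    qed
    then have "cmod (fourier_coeff m f \<gamma>) \<le> 0" by (intro LIMSEQ_le_const[OF lim]) auto
    then show ?thesis by simp
  qed
  then show "f \<in> C_spectral m \<Theta>" using f by (simp add: C_spectral_def C_space_sel(1))
qed

definition L1_class :: "('g \<Rightarrow> complex) \<Rightarrow> ('g \<Rightarrow> complex) set"
  where "L1_class f = {g. integrable m g \<and> (AE x in m. g x = f x)}"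

lemma L1_carrier: "carrier (L1_space m) = {L1_class f | f. integrable m f}"
proof -
  have "carrier (L1_space m) = coset_of (integrable_functions m) (null_functions m) ` {f. integrable m f}"
    by (simp add: L1_space_def quotient_space_def integrable_functions_def)
  then show ?thesis using L1_class_eq unfolding L1_class_def by (force simp: image_iff)
qed

lemma L1_norm: "integrable m f \<Longrightarrow> vnorm (L1_space m) (L1_class f) = (LINT x|m. cmod (f x))"
  using L1_norm_class[of m f] L1_class_eq[of m f] by (simp add: L1_class_def)

lemma L1_class_refl: "integrable m f \<Longrightarrow> f \<in> L1_class f"
  by (simp add: L1_class_def)

lemma L1_space_sel:
  "F \<oplus>\<^bsub>L1_space m\<^esub> G = {\<lambda>x. a x + b x | a b. a \<in> F \<and> b \<in> G}"
  "c \<odot>\<^bsub>L1_space m\<^esub> F = {\<lambda>x. c * a x + b x | a b. a \<in> F \<and> b \<in> null_functions m}"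
  by (simp_all add: L1_space_def quotient_space_def integrable_functions_def)

lemma L1_add:
  assumes "integrable m f" "integrable m g"
  shows "L1_class f \<oplus>\<^bsub>L1_space m\<^esub> L1_class g = L1_class (\<lambda>x. f x + g x)"
proof (intro equalityI subsetI)
  fix h assume "h \<in> L1_class f \<oplus>\<^bsub>L1_space m\<^esub> L1_class g"
  then obtain a b where "h = (\<lambda>x. a x + b x)" "a \<in> L1_class f" "b \<in> L1_class g"
    by (auto simp: L1_space_sel)
  then show "h \<in> L1_class (\<lambda>x. f x + g x)" by (auto simp: L1_class_def)
next
  fix h assume h: "h \<in> L1_class (\<lambda>x. f x + g x)"
  then have "(\<lambda>x. h x - f x) \<in> L1_class g" using assms by (auto simp: L1_class_def)
  moreover have "h = (\<lambda>x. f x + (h x - f x))" by simp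
  ultimately show "h \<in> L1_class f \<oplus>\<^bsub>L1_space m\<^esub> L1_class g"
    using L1_class_refl[OF assms(1)] unfolding L1_space_sel
    by (intro CollectI exI[of _ f] exI[of _ "\<lambda>x. h x - f x"]) simp
qed

lemma L1_scale:
  assumes "integrable m f"
  shows "c \<odot>\<^bsub>L1_space m\<^esub> L1_class f = L1_class (\<lambda>x. c * f x)"
proof (intro equalityI subsetI)
  fix h assume "h \<in> c \<odot>\<^bsub>L1_space m\<^esub> L1_class f"
  then obtain a b where "h = (\<lambda>x. c * a x + b x)" "a \<in> L1_class f" "b \<in> null_functions m"
    by (auto simp: L1_space_sel)
  then show "h \<in> L1_class (\<lambda>x. c * f x)" by (auto simp: L1_class_def null_functions_def)
next
  fix h assume h: "h \<in> L1_class (\<lambda>x. c * f x)"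
  then have "(\<lambda>x. h x - c * f x) \<in> null_functions m" using assms by (auto simp: L1_class_def null_functions_def)
  moreover have "h = (\<lambda>x. c * f x + (h x - c * f x))" by simp
  ultimately show "h \<in> c \<odot>\<^bsub>L1_space m\<^esub> L1_class f"
    using L1_class_refl[OF assms] unfolding L1_space_sel
    by (intro CollectI exI[of _ f] exI[of _ "\<lambda>x. h x - c * f x"]) simp
qed

lemma L1_diff:
  "integrable m f \<Longrightarrow> integrable m g \<Longrightarrow> L1_class f \<ominus>\<^bsub>L1_space m\<^esub> L1_class g = L1_class (\<lambda>x. f x - g x)"
  by (simp add: vdiff_def L1_scale L1_add)

text \<open>The functional must be defined on classes, so a representative is chosen; the integral
  does not depend on the choice.\<close>

definition L1_pairing :: "('g \<Rightarrow> complex) \<Rightarrow> ('g \<Rightarrow> complex) set \<Rightarrow> complex"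
  where "L1_pairing w F = (LINT x|m. w x * (SOME f. f \<in> F) x)"

lemma L1_pairing_class:
  assumes w: "w \<in> borel_measurable m" and f: "integrable m f"
  shows "L1_pairing w (L1_class f) = (LINT x|m. w x * f x)"
proof -
  have "(SOME g. g \<in> L1_class f) \<in> L1_class f" by (rule someI[of "\<lambda>g. g \<in> L1_class f", OF L1_class_refl[OF f]])
  then have "integrable m (SOME g. g \<in> L1_class f)" "AE x in m. (SOME g. g \<in> L1_class f) x = f x"
    by (auto simp: L1_class_def)
  then show ?thesis
    unfolding L1_pairing_def using w f by (intro integral_cong_AE borel_measurable_times) auto
qed

lemma L1_pairing_bounded_operator:
  assumes w: "w \<in> borel_measurable m" "\<And>x. cmod (w x) \<le> B"
  shows "bounded_operator (L1_space m) scalar_space (L1_pairing w)"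
  unfolding bounded_operator_def
proof (intro conjI ballI allI)
  note mult = integrable_bounded_mult[OF w]
  fix F assume "F \<in> carrier (L1_space m)"
  then obtain f where f: "integrable m f" "F = L1_class f" by (auto simp: L1_carrier)
  show "L1_pairing w F \<in> carrier scalar_space" by (simp add: scalar_space_def)
  show "L1_pairing w (c \<odot>\<^bsub>L1_space m\<^esub> F) = c \<odot>\<^bsub>scalar_space\<^esub> L1_pairing w F" for c
    using f by (simp add: L1_scale L1_pairing_class[OF w(1)] scalar_space_def mult.left_commute[of _ c])
  fix G assume "G \<in> carrier (L1_space m)"
  then obtain g where g: "integrable m g" "G = L1_class g" by (auto simp: L1_carrier)
  show "L1_pairing w (F \<oplus>\<^bsub>L1_space m\<^esub> G) = L1_pairing w F \<oplus>\<^bsub>scalar_space\<^esub> L1_pairing w G"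
    using f g mult[OF f(1)] mult[OF g(1)]
    by (simp add: L1_add L1_pairing_class[OF w(1)] scalar_space_def distrib_left)
next
  have "\<parallel>L1_pairing w F\<parallel>\<^bsub>scalar_space\<^esub> \<le> B * vnorm (L1_space m) F" if F: "F \<in> carrier (L1_space m)" for F
  proof -
    obtain f where f: "integrable m f" "F = L1_class f" using F by (auto simp: L1_carrier)
    then show ?thesis
      using integral_bounded_mult_le[OF w f(1)] by (simp add: L1_norm L1_pairing_class[OF w(1)] scalar_space_def)
  qed
  then show "\<exists>K. \<forall>F\<in>carrier (L1_space m). \<parallel>L1_pairing w F\<parallel>\<^bsub>scalar_space\<^esub> \<le> K * vnorm (L1_space m) F" by blast
qed

text \<open>Narrowness of the quotient map, unfolded for the functional \<open>L1_pairing w\<close>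
  and expressed by functions. \<open>s\<close> is an element of the subspace close to
  \<open>z - y\<close>; \<open>2 * \<epsilon>\<close> replaces \<epsilon> because the infimum
  defining the quotient norm need not be attained.\<close>

lemma rich_L1D:
  assumes rich: "rich (L1_space m) (L1_spectral m (dual_group - inverse_characters \<Lambda>))" and \<Lambda>: "\<Lambda> \<subseteq> dual_group"
    and x: "integrable m x" "(LINT t|m. cmod (x t)) = 1" and y: "integrable m y" "(LINT t|m. cmod (y t)) = 1"
    and w: "w \<in> borel_measurable m" "\<And>t. cmod (w t) \<le> B" and \<epsilon>: "0 < \<epsilon>"
  obtains z s where "integrable m z" "(LINT t|m. cmod (z t)) = 1" "2 - \<epsilon> \<le> (LINT t|m. cmod (x t + z t))"
    "cmod ((LINT t|m. w t * y t) - (LINT t|m. w t * z t)) \<le> \<epsilon>"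
    "integrable m s" "\<And>\<gamma>. \<gamma> \<in> \<Lambda> \<Longrightarrow> (LINT t|m. s t * \<gamma> t) = 0" "(LINT t|m. cmod (z t - y t - s t)) \<le> 2 * \<epsilon>"
proof -
  let ?X = "L1_space m" and ?Y = "L1_spectral m (dual_group - inverse_characters \<Lambda>)"
  have sphere: "L1_class f \<in> sphere_of ?X" if "integrable m f" "(LINT t|m. cmod (f t)) = 1" for f
    using that by (auto simp: sphere_of_def L1_carrier L1_norm)
  obtain Z where Z: "Z \<in> sphere_of ?X"
    "\<parallel>coset_of ?X ?Y (L1_class y \<ominus>\<^bsub>?X\<^esub> Z)\<parallel>\<^bsub>quotient_space ?X ?Y\<^esub> + cmod (L1_pairing w (L1_class y \<ominus>\<^bsub>?X\<^esub> Z)) \<le> \<epsilon>"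
    "2 - \<epsilon> \<le> \<parallel>L1_class x \<oplus>\<^bsub>?X\<^esub> Z\<parallel>\<^bsub>?X\<^esub>"
    using rich sphere[OF x] sphere[OF y] L1_pairing_bounded_operator[OF w] \<epsilon> unfolding rich_def narrow_def by blast
  obtain z where z: "integrable m z" "Z = L1_class z" using Z(1) by (auto simp: sphere_of_def L1_carrier)
  let ?d = "\<lambda>t. y t - z t"
  have d: "integrable m ?d" "L1_class y \<ominus>\<^bsub>?X\<^esub> Z = L1_class ?d" using y z by (auto simp: L1_diff)
  have "0 \<le> \<parallel>coset_of ?X ?Y (L1_class ?d)\<parallel>\<^bsub>quotient_space ?X ?Y\<^esub>"
  proof -
    have "0 \<le> \<parallel>L1_class ?d \<oplus>\<^bsub>?X\<^esub> S\<parallel>\<^bsub>?X\<^esub>" if S: "S \<in> ?Y" for S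
    proof -
      obtain s where "integrable m s" "S = L1_class s" using S by (auto simp: L1_spectral_def L1_carrier)
      then show ?thesis using d by (simp add: L1_add L1_norm)
    qed
    moreover have "?Y \<noteq> {}" using rich by (auto simp: rich_def closed_subspace_def)
    ultimately show ?thesis by (auto simp: quotient_space_def coset_of_def intro!: cINF_greatest)
  qed
  then have pairing: "cmod (L1_pairing w (L1_class ?d)) \<le> \<epsilon>"
    and "\<parallel>coset_of ?X ?Y (L1_class ?d)\<parallel>\<^bsub>quotient_space ?X ?Y\<^esub> \<le> \<epsilon>"
    using Z(2) norm_ge_zero[of "L1_pairing w (L1_class ?d)"] unfolding d(2) by linarith+
  then have "(INF A\<in>coset_of ?X ?Y (L1_class ?d). \<parallel>A\<parallel>\<^bsub>?X\<^esub>) < 2 * \<epsilon>"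
    using \<epsilon> by (simp add: quotient_space_def)
  moreover have "coset_of ?X ?Y (L1_class ?d) \<noteq> {}" using rich by (auto simp: rich_def closed_subspace_def coset_of_def)
  ultimately obtain A where A: "A \<in> coset_of ?X ?Y (L1_class ?d)" "\<parallel>A\<parallel>\<^bsub>?X\<^esub> < 2 * \<epsilon>"
    using cInf_lessD[of "vnorm ?X ` coset_of ?X ?Y (L1_class ?d)"] by auto
  then obtain S where S: "S \<in> ?Y" "\<parallel>L1_class ?d \<oplus>\<^bsub>?X\<^esub> S\<parallel>\<^bsub>?X\<^esub> < 2 * \<epsilon>" by (auto simp: coset_of_def)
  then obtain s where s: "integrable m s" "S = L1_class s" by (auto simp: L1_spectral_def L1_carrier)
  \<comment> \<open>A Fourier coefficient conjugates its character, so vanishing at the inverse of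
    \<gamma> is vanishing of the integral against \<gamma>.\<close>
  have zero: "(LINT t|m. s t * \<gamma> t) = 0" if \<gamma>: "\<gamma> \<in> \<Lambda>" for \<gamma>
  proof -
    have "(\<lambda>x. cnj (\<gamma> x)) \<in> dual_group" using \<gamma> \<Lambda> by (auto intro: cnj_dual_group)
    moreover have "(\<lambda>x. cnj (\<gamma> x)) \<in> inverse_characters \<Lambda>" using \<gamma> by (auto simp: inverse_characters_def)
    ultimately have "fourier_coeff m s (\<lambda>x. cnj (\<gamma> x)) = 0"
      using S(1) L1_class_refl[OF s(1)] s(2) by (auto simp: L1_spectral_def)
    then show ?thesis by (simp add: fourier_coeff_def)
  qed
  show thesis
  proof (rule that[of z s])
    show "(LINT t|m. cmod (z t)) = 1" using Z(1) z by (simp add: sphere_of_def L1_norm)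
    show "2 - \<epsilon> \<le> (LINT t|m. cmod (x t + z t))" using Z(3) z x by (simp add: L1_add L1_norm)
    show "cmod ((LINT t|m. w t * y t) - (LINT t|m. w t * z t)) \<le> \<epsilon>"
      using pairing integrable_bounded_mult[OF w y(1)] integrable_bounded_mult[OF w z(1)]
      by (simp add: L1_pairing_class[OF w(1) d(1)] right_diff_distrib)
    have "(LINT t|m. cmod (y t - z t + s t)) < 2 * \<epsilon>" using S(2) s d by (simp add: L1_add L1_norm)
    moreover have "cmod (y t - z t + s t) = cmod (z t - y t - s t)" for t
      by (metis norm_minus_commute diff_diff_eq minus_diff_eq add.commute diff_minus_eq_add)
    ultimately show "(LINT t|m. cmod (z t - y t - s t)) \<le> 2 * \<epsilon>" by simp
  qed (use z s zero in auto)
qed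

text \<open>The right side adds up the defects in the triangle inequalities for 1 + w and w - 1. The
  parallelogram law bounds the square of |1 + w| + |w - 1| by 4 (1 + |w|^2), which is compared with
  the square of \<open>2 + 2 * cmod w - min 1 (cmod w)\<close>. Integrated, this bounds the size of
  a function by its failure to be additive in norm with 1 and with -1.\<close>

lemma min_le_parallelogram_defect: "min 1 (cmod w) \<le> 2 + 2 * cmod w - cmod (1 + w) - cmod (w - 1)"
proof -
  let ?r = "cmod w"
  have "(cmod (1 + w))\<^sup>2 + (cmod (w - 1))\<^sup>2 = 2 * (1 + ?r\<^sup>2)"
    by (simp only: cmod_power2) (simp add: power2_eq_square algebra_simps)
  then have "(cmod (1 + w) + cmod (w - 1))\<^sup>2 \<le> 4 * (1 + ?r\<^sup>2)"
    using sum_squares_ge_zero[of "cmod (1 + w) - cmod (w - 1)" 0] by (simp add: power2_eq_square algebra_simps)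
  also have "\<dots> \<le> (2 + 2 * ?r - min 1 ?r)\<^sup>2"
  proof (cases "?r \<le> 1")
    case True
    have "?r * ?r \<le> ?r" by (rule mult_left_le[OF True norm_ge_zero])
    then have "3 * (?r * ?r) \<le> 4 * ?r" using norm_ge_zero[of w] by linarith
    then show ?thesis using True by (simp add: power2_eq_square algebra_simps)
  next
    case False
    then show ?thesis by (simp add: power2_eq_square algebra_simps)
  qed
  finally have "cmod (1 + w) + cmod (w - 1) \<le> 2 + 2 * ?r - min 1 ?r"
    by (rule power2_le_imp_le) (simp add: min_def)
  then show ?thesis by simp
qed

text \<open>Richness is applied twice, starting at \<open>1\<close> and at \<open>-1\<close>; the second functional contains a norming
  functional \<open>u\<close> of \<open>1 + z1\<close>, which keeps \<open>z2\<close> almost additive with \<open>1\<close>. A function almost additive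
  with both \<open>1\<close> and \<open>-1\<close> lives on a small set.\<close>

lemma rich_concentrated:
  assumes rich: "rich (L1_space m) (L1_spectral m (dual_group - inverse_characters \<Lambda>))" and \<Lambda>: "\<Lambda> \<subseteq> dual_group"
    and e: "cont e" "\<And>x. cmod (e x) \<le> 1 + \<delta>" and \<delta>: "0 < \<delta>" "\<delta> < 1"
    and d: "\<And>s M. s \<in> C_spectral m \<Lambda> \<Longrightarrow> (\<And>x. cmod (e x - s x) \<le> M) \<Longrightarrow> 1 \<le> M"
  obtains z s where "integrable m z" "(LINT x|m. cmod (z x)) = 1" "1 - \<delta> \<le> Re (LINT x|m. e x * z x)"
    "(LINT x|m. min 1 (cmod (z x))) \<le> 2 * \<delta>"
    "integrable m s" "\<And>\<gamma>. \<gamma> \<in> \<Lambda> \<Longrightarrow> (LINT x|m. s x * \<gamma> x) = 0" "(LINT x|m. cmod (z x - s x)) \<le> \<delta>"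
proof -
  \<comment> \<open>The decisive use is the final count of defects, 5 t + \<delta> for 1 and t for
    -1, which total \<open>2 * \<delta>\<close>.\<close>
  define t where "t = \<delta> / 6"
  have t: "0 < t" "t < 1" "6 * t = \<delta>" using \<delta> by (auto simp: t_def)
  have em: "e \<in> borel_measurable m" using e(1) by (rule measurable_continuous)
  obtain g where g: "cont g" "(LINT x|m. cmod (g x)) \<le> 1" "\<And>\<gamma>. \<gamma> \<in> \<Lambda> \<Longrightarrow> (LINT x|m. g x * \<gamma> x) = 0"
    "1 - t \<le> Re (LINT x|m. e x * g x)"
  proof (rule quotient_norm_attained_L1[OF \<Lambda> e(1) t(1), of 1])
    fix s M assume "s \<in> C_spectral m \<Lambda>" "\<And>x. cmod (e x - s x) \<le> M"
    then show "1 \<le> M" by (rule d)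
  next
    fix g assume "cont g" "(LINT x|m. cmod (g x)) \<le> 1" "\<And>\<gamma>. \<gamma> \<in> \<Lambda> \<Longrightarrow> (LINT x|m. g x * \<gamma> x) = 0"
      "1 - t \<le> Re (LINT x|m. e x * g x)"
    then show thesis by (rule that)
  qed
  have gi: "integrable m g" using g(1) by auto
  define c where "c = (LINT x|m. cmod (g x))"
  \<comment> \<open>\<open>g\<close> cannot vanish, so it can be normalized; dividing by
    \<open>c \<le> 1\<close> does not spoil the lower bound.\<close>
  have "1 - t \<le> (1 + \<delta>) * c"
    using g(4) complex_Re_le_cmod[of "LINT x|m. e x * g x"] integral_bounded_mult_le[OF em e(2) gi] by (simp add: c_def)
  then have "0 < (1 + \<delta>) * c" using t(2) by linarith
  then have c: "0 < c" "c \<le> 1" using \<delta> g(2) by (auto simp: zero_less_mult_iff c_def)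
  define y where "y x = g x / of_real c" for x
  have y: "integrable m y" "(LINT x|m. cmod (y x)) = 1"
    using gi c by (auto simp: y_def[abs_def] norm_divide c_def[symmetric])
  have ey: "1 - t \<le> Re (LINT x|m. e x * y x)"
  proof -
    have "(LINT x|m. e x * y x) = (LINT x|m. e x * g x) / of_real c" by (simp add: y_def)
    then have "Re (LINT x|m. e x * y x) = Re (LINT x|m. e x * g x) / c" by simp
    moreover have "1 - t \<le> (1 - t) / c" using c t by (simp add: le_divide_eq mult_left_le)
    moreover have "(1 - t) / c \<le> Re (LINT x|m. e x * g x) / c" using g(4) c by (intro divide_right_mono) auto
    ultimately show ?thesis by linarith
  qed
  have y0: "(LINT x|m. y x * \<gamma> x) = 0" if "\<gamma> \<in> \<Lambda>" for \<gamma>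
    using g(3)[OF that] by (simp add: y_def)
  obtain z1 s1 where z1: "integrable m z1" "(LINT x|m. cmod (z1 x)) = 1" "2 - t \<le> (LINT x|m. cmod (1 + z1 x))"
    "cmod ((LINT x|m. e x * y x) - (LINT x|m. e x * z1 x)) \<le> t"
    and s1: "integrable m s1" "\<And>\<gamma>. \<gamma> \<in> \<Lambda> \<Longrightarrow> (LINT x|m. s1 x * \<gamma> x) = 0" "(LINT x|m. cmod (z1 x - y x - s1 x)) \<le> 2 * t"
  proof (rule rich_L1D[OF rich \<Lambda> _ _ y em e(2) t(1), of "\<lambda>_. 1"])
    fix z s
    assume "integrable m z" "(LINT x|m. cmod (z x)) = 1" "2 - t \<le> (LINT x|m. cmod (1 + z x))"
      "cmod ((LINT x|m. e x * y x) - (LINT x|m. e x * z x)) \<le> t"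
      "integrable m s" "\<And>\<gamma>. \<gamma> \<in> \<Lambda> \<Longrightarrow> (LINT x|m. s x * \<gamma> x) = 0" "(LINT x|m. cmod (z x - y x - s x)) \<le> 2 * t"
    then show thesis by (rule that)
  qed simp_all
  have ez1: "1 - 2 * t \<le> Re (LINT x|m. e x * z1 x)"
    using ey z1(4) complex_Re_le_cmod[of "(LINT x|m. e x * y x) - (LINT x|m. e x * z1 x)"] by simp
  \<comment> \<open>Both \<integral> u and \<integral> u z1 have real part at most 1, and together
    at least \<open>2 - t\<close>, so each has at least \<open>1 - t\<close>.\<close>
  define u where "u x = cnj (sgn (1 + z1 x))" for x
  have u: "u \<in> borel_measurable m" "\<And>x. cmod (u x) \<le> 1"
    unfolding u_def using z1(1) by (auto intro!: borel_measurable_cnj_sgn simp: norm_sgn)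
  note u_int = integrable_bounded_mult[OF u] and e_int = integrable_bounded_mult[OF em e(2)]
  have u_le: "Re (LINT x|m. u x * v x) \<le> 1" if v: "integrable m v" "(LINT x|m. cmod (v x)) = 1" for v
    using integral_bounded_mult_le[OF u v(1)] v(2) complex_Re_le_cmod[of "LINT x|m. u x * v x"] by simp
  have one: "integrable m (\<lambda>_. 1 :: complex)" by simp
  have "complex_of_real (LINT x|m. cmod (1 + z1 x)) = (LINT x|m. u x * 1 + u x * z1 x)"
    unfolding u_def by (simp only: cnj_sgn_mult flip: distrib_left integral_complex_of_real)
  also have "\<dots> = (LINT x|m. u x * 1) + (LINT x|m. u x * z1 x)"
    by (rule Bochner_Integration.integral_add[OF u_int[OF one] u_int[OF z1(1)]])
  finally have "(LINT x|m. cmod (1 + z1 x)) = Re (LINT x|m. u x * 1) + Re (LINT x|m. u x * z1 x)"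
    by (metis Re_complex_of_real plus_complex.sel(1))
  then have u1: "1 - t \<le> Re (LINT x|m. u x * 1)" and uz1: "1 - t \<le> Re (LINT x|m. u x * z1 x)"
    using u_le[OF one] u_le[OF z1(1,2)] z1(3) by auto
  \<comment> \<open>Richness controls one functional at a time. The sum suffices: its value at
    \<open>z1\<close> is nearly maximal, \<integral> e z2 is at most 1 + \<delta> and \<integral> u
    z2 at most 1 in real part, so a large sum at \<open>z2\<close> makes both terms large.\<close>
  define w where "w x = e x + u x" for x
  have w: "w \<in> borel_measurable m" "\<And>x. cmod (w x) \<le> (1 + \<delta>) + 1"
    unfolding w_def by (intro borel_measurable_add em u norm_triangle_mono e)+
  have w_split: "Re (LINT x|m. w x * v x) = Re (LINT x|m. e x * v x) + Re (LINT x|m. u x * v x)" if "integrable m v" for v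
    using e_int[OF that] u_int[OF that] by (simp add: w_def distrib_right)
  obtain z2 s2 where z2: "integrable m z2" "(LINT x|m. cmod (z2 x)) = 1" "2 - t \<le> (LINT x|m. cmod (- 1 + z2 x))"
    "cmod ((LINT x|m. w x * z1 x) - (LINT x|m. w x * z2 x)) \<le> t"
    and s2: "integrable m s2" "\<And>\<gamma>. \<gamma> \<in> \<Lambda> \<Longrightarrow> (LINT x|m. s2 x * \<gamma> x) = 0" "(LINT x|m. cmod (z2 x - z1 x - s2 x)) \<le> 2 * t"
  proof (rule rich_L1D[OF rich \<Lambda> _ _ z1(1,2) w t(1), of "\<lambda>_. - 1"])
    fix z s
    assume "integrable m z" "(LINT x|m. cmod (z x)) = 1" "2 - t \<le> (LINT x|m. cmod (- 1 + z x))"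
      "cmod ((LINT x|m. w x * z1 x) - (LINT x|m. w x * z x)) \<le> t"
      "integrable m s" "\<And>\<gamma>. \<gamma> \<in> \<Lambda> \<Longrightarrow> (LINT x|m. s x * \<gamma> x) = 0" "(LINT x|m. cmod (z x - z1 x - s x)) \<le> 2 * t"
    then show thesis by (rule that)
  qed simp_all
  have wz2: "2 - 4 * t \<le> Re (LINT x|m. e x * z2 x) + Re (LINT x|m. u x * z2 x)"
    using z2(4) complex_Re_le_cmod[of "(LINT x|m. w x * z1 x) - (LINT x|m. w x * z2 x)"] ez1 uz1
    by (simp add: w_split[OF z1(1)] w_split[OF z2(1)] del: times_complex.sel)
  have ez2: "Re (LINT x|m. e x * z2 x) \<le> 1 + \<delta>"
    using integral_bounded_mult_le[OF em e(2) z2(1)] z2(2) complex_Re_le_cmod[of "LINT x|m. e x * z2 x"] by simp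
  have uz2: "1 - 4 * t - \<delta> \<le> Re (LINT x|m. u x * z2 x)" using wz2 ez2 by simp
  have plus: "2 - 5 * t - \<delta> \<le> (LINT x|m. cmod (1 + z2 x))"
  proof -
    have "(LINT x|m. u x * (1 + z2 x)) = (LINT x|m. u x * 1 + u x * z2 x)" by (simp only: distrib_left)
    also have "\<dots> = (LINT x|m. u x * 1) + (LINT x|m. u x * z2 x)"
      by (rule Bochner_Integration.integral_add[OF u_int[OF one] u_int[OF z2(1)]])
    finally have "Re (LINT x|m. u x * 1) + Re (LINT x|m. u x * z2 x) = Re (LINT x|m. u x * (1 + z2 x))" by simp
    also have "\<dots> \<le> (LINT x|m. cmod (1 + z2 x))"
      using integral_bounded_mult_le[OF u, of "\<lambda>x. 1 + z2 x"] z2(1) complex_Re_le_cmod[of "LINT x|m. u x * (1 + z2 x)"]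
      by simp
    finally show ?thesis using u1 uz2 by linarith
  qed
  have minus: "(LINT x|m. cmod (- 1 + z2 x)) = (LINT x|m. cmod (z2 x - 1))" by simp
  have [measurable]: "z2 \<in> borel_measurable m" using z2(1) by auto
  have int: "integrable m (\<lambda>x. cmod (1 + z2 x))" "integrable m (\<lambda>x. cmod (z2 x - 1))" using z2(1) by auto
  have "(LINT x|m. min 1 (cmod (z2 x))) \<le> (LINT x|m. 2 + 2 * cmod (z2 x) - cmod (1 + z2 x) - cmod (z2 x - 1))"
  proof (rule integral_mono)
    show "integrable m (\<lambda>x. min 1 (cmod (z2 x)))" by (rule integrable_bounded[of _ 1]) auto
    show "integrable m (\<lambda>x. 2 + 2 * cmod (z2 x) - cmod (1 + z2 x) - cmod (z2 x - 1))" using int z2(1) by auto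
  qed (rule min_le_parallelogram_defect)
  also have "\<dots> = 4 - (LINT x|m. cmod (1 + z2 x)) - (LINT x|m. cmod (z2 x - 1))" using int z2 by simp
  also have "\<dots> \<le> 2 * \<delta>" using plus z2(3) t unfolding minus by linarith
  finally have small: "(LINT x|m. min 1 (cmod (z2 x))) \<le> 2 * \<delta>" .
  \<comment> \<open>The corrections telescope: \<open>z2 - s\<close> is the sum of the two small
    remainders.\<close>
  define s where "s x = y x + s1 x + s2 x" for x
  have s: "integrable m s" using y s1 s2 by (simp add: s_def[abs_def])
  have s0: "(LINT x|m. s x * \<gamma> x) = 0" if \<gamma>: "\<gamma> \<in> \<Lambda>" for \<gamma>
  proof -
    have "cont \<gamma>" using \<gamma> \<Lambda> dual_groupD(1) by blast
    then have "integrable m (\<lambda>x. v x * \<gamma> x)" if "integrable m v" for v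
      using integrable_continuous_mult[of \<gamma> v] that by (simp add: mult.commute)
    then show ?thesis using y s1 s2 y0[OF \<gamma>] \<gamma> by (simp add: s_def distrib_right)
  qed
  have "(LINT x|m. cmod (z2 x - s x)) \<le> (LINT x|m. cmod (z2 x - z1 x - s2 x) + cmod (z1 x - y x - s1 x))"
  proof (rule integral_mono)
    fix x
    have "z2 x - s x = (z2 x - z1 x - s2 x) + (z1 x - y x - s1 x)" by (simp add: s_def)
    then show "cmod (z2 x - s x) \<le> cmod (z2 x - z1 x - s2 x) + cmod (z1 x - y x - s1 x)"
      by (simp only: norm_triangle_ineq)
  qed (use s y z1 z2 s1 s2 in auto)
  also have "\<dots> \<le> \<delta>" using s1 s2 y z1 z2 t by simp
  finally have zs: "(LINT x|m. cmod (z2 x - s x)) \<le> \<delta>" .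
  have ez2': "1 - \<delta> \<le> Re (LINT x|m. e x * z2 x)" using wz2 u_le[OF z2(1,2)] t by linarith
  show thesis by (rule that[OF z2(1,2) ez2' small s s0 zs])
qed

text \<open>The Daugavet inequality at the level of functions: \<open>e0\<close> represents a class
  of norm 1, adding \<open>s\<close> moves within a class, and \<open>r\<close> is the value of
  \<Phi> to be nearly kept. The function \<open>z\<close> carrying the estimate is only near the
  annihilator of C_\<Lambda>; its neighbour \<open>v\<close> annihilates \<open>s\<close>
  exactly.\<close>

lemma daugavet_pair:
  assumes rich: "rich (L1_space m) (L1_spectral m (dual_group - inverse_characters \<Lambda>))" and \<Lambda>: "\<Lambda> \<subseteq> dual_group"
    and \<Phi>: "C_functional \<Phi> K" and y0: "cont y0" "\<And>x. cmod (y0 x) \<le> 1" "\<Phi> y0 = of_real r" "0 \<le> r" and \<epsilon>: "0 < \<epsilon>"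
    and e0: "cont e0"
    and d: "\<And>s M. s \<in> C_spectral m \<Lambda> \<Longrightarrow> (\<And>x. cmod (e0 x - s x) \<le> M) \<Longrightarrow> 1 \<le> M"
    and e0': "\<And>r. 1 < r \<Longrightarrow> \<exists>s\<in>C_spectral m \<Lambda>. \<forall>x. cmod (e0 x + s x) \<le> r"
  obtains y e where "cont y" "\<And>x. cmod (y x) \<le> 1" "e \<in> {\<lambda>x. e0 x + s x | s. s \<in> C_spectral m \<Lambda>}"
    "\<And>s M. s \<in> C_spectral m \<Lambda> \<Longrightarrow> (\<And>x. cmod (y x + \<Phi> y * e x + s x) \<le> M) \<Longrightarrow> 1 + r - \<epsilon> \<le> M"
proof -
  have K: "0 \<le> K" using C_functional_nonneg[OF \<Phi>] .
  have rK: "r \<le> K" using C_functional_bound[OF \<Phi> y0(1,2)] y0(3,4) by simp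
  \<comment> \<open>All errors together are at most \<open>(5 + 4 * K) * \<delta>1\<close>: three
    times \<delta>1 from \<open>y\<close>, and \<delta> with the factors \<open>r \<le> K\<close>,
    \<open>1 + 2 * K\<close> and \<open>M \<le> 1 + K\<close>. The bound 1 / 2 gives
    \<open>\<delta> < 1\<close>.\<close>
  define \<delta>1 where "\<delta>1 = min (1 / 2) (\<epsilon> / (8 + 8 * K))"
  have \<delta>1: "0 < \<delta>1" "\<delta>1 \<le> 1 / 2" "\<delta>1 * (8 + 8 * K) \<le> \<epsilon>"
  proof -
    show "0 < \<delta>1" using \<epsilon> K by (simp add: \<delta>1_def)
    show "\<delta>1 \<le> 1 / 2" unfolding \<delta>1_def by (rule min.cobounded1)
    have "\<delta>1 \<le> \<epsilon> / (8 + 8 * K)" by (simp add: \<delta>1_def)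
    then show "\<delta>1 * (8 + 8 * K) \<le> \<epsilon>" using K by (simp add: pos_le_divide_eq)
  qed
  obtain \<eta> where \<eta>: "0 < \<eta>"
    "\<forall>y0 z. cont y0 \<longrightarrow> (\<forall>x. cmod (y0 x) \<le> 1) \<longrightarrow> integrable m z \<longrightarrow> (LINT x|m. min 1 (cmod (z x))) < \<eta> \<longrightarrow>
      (\<exists>y. cont y \<and> (\<forall>x. cmod (y x) \<le> 1) \<and> cmod (\<Phi> y - \<Phi> y0) \<le> \<delta>1 \<and> (LINT x|m. cmod (z x)) - \<delta>1 \<le> Re (LINT x|m. y x * z x))"
    using functional_almost_disjoint[OF \<Phi> \<delta>1(1)] by (elim exE conjE) blast
  define \<delta> where "\<delta> = min \<delta>1 (\<eta> / 4)"
  have \<delta>: "0 < \<delta>" "\<delta> < 1" "\<delta> \<le> \<delta>1" "2 * \<delta> < \<eta>" using \<delta>1 \<eta>(1) by (auto simp: \<delta>_def)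
  \<comment> \<open>The norm of the class need not be attained. This representative comes within
    \<delta> of it and must be chosen after \<delta>, so \<open>e\<close> is part of what the lemma
    returns.\<close>
  obtain s0 where s0: "s0 \<in> C_spectral m \<Lambda>" "\<And>x. cmod (e0 x + s0 x) \<le> 1 + \<delta>"
    using e0'[of "1 + \<delta>"] \<delta>(1) by auto
  define e where "e x = e0 x + s0 x" for x
  have e: "cont e" "\<And>x. cmod (e x) \<le> 1 + \<delta>"
    using s0 e0 C_spectral_cont[OF s0(1)] by (auto simp: e_def[abs_def] intro: continuous_intros)
  have e_ge: "1 \<le> M" if s: "s \<in> C_spectral m \<Lambda>" "\<And>x. cmod (e x - s x) \<le> M" for s M
  proof (rule d)
    show "(\<lambda>x. s x + (-1) * s0 x) \<in> C_spectral m \<Lambda>" using C_spectral_add[OF s(1) C_spectral_scale[OF s0(1)]] .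
    show "cmod (e0 x - (s x + (-1) * s0 x)) \<le> M" for x using s(2)[of x] by (simp add: e_def algebra_simps)
  qed
  obtain z v where z: "integrable m z" "(LINT x|m. cmod (z x)) = 1" "1 - \<delta> \<le> Re (LINT x|m. e x * z x)"
    "(LINT x|m. min 1 (cmod (z x))) \<le> 2 * \<delta>"
    and v: "integrable m v" "\<And>\<gamma>. \<gamma> \<in> \<Lambda> \<Longrightarrow> (LINT x|m. v x * \<gamma> x) = 0" "(LINT x|m. cmod (z x - v x)) \<le> \<delta>"
  proof (rule rich_concentrated[OF rich \<Lambda> e \<delta>(1,2)])
    fix s M assume "s \<in> C_spectral m \<Lambda>" "\<And>x. cmod (e x - s x) \<le> M"
    then show "1 \<le> M" by (rule e_ge)
  next
    fix z v
    assume "integrable m z" "(LINT x|m. cmod (z x)) = 1" "1 - \<delta> \<le> Re (LINT x|m. e x * z x)"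
      "(LINT x|m. min 1 (cmod (z x))) \<le> 2 * \<delta>" "integrable m v" "\<And>\<gamma>. \<gamma> \<in> \<Lambda> \<Longrightarrow> (LINT x|m. v x * \<gamma> x) = 0"
      "(LINT x|m. cmod (z x - v x)) \<le> \<delta>"
    then show thesis by (rule that)
  qed
  have "(LINT x|m. min 1 (cmod (z x))) < \<eta>" using z(4) \<delta>(4) by simp
  then obtain y where y: "cont y" "\<forall>x. cmod (y x) \<le> 1" "cmod (\<Phi> y - of_real r) \<le> \<delta>1"
    "1 - \<delta>1 \<le> Re (LINT x|m. y x * z x)"
    using \<eta>(2)[rule_format, OF y0(1,2) z(1)] unfolding y0(3) z(2) by blast
  note y = y(1) spec[OF y(2)] y(3,4)
  show thesis
  proof (rule that[OF y(1,2)])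
    show "e \<in> {\<lambda>x. e0 x + s x | s. s \<in> C_spectral m \<Lambda>}" using s0(1) by (auto simp: e_def[abs_def])
    fix s M assume s: "s \<in> C_spectral m \<Lambda>" and M: "\<And>x. cmod (y x + \<Phi> y * e x + s x) \<le> M"
    let ?h = "\<lambda>x. y x + \<Phi> y * e x"
    have sc: "cont s" using s by (rule C_spectral_cont)
    have h: "cont ?h" by (intro continuous_intros y e)
    have vi: "(LINT x|m. cmod (v x)) \<le> 1 + \<delta>"
    proof -
      have "(LINT x|m. cmod (v x)) \<le> (LINT x|m. cmod (z x) + cmod (z x - v x))"
        using z v by (intro integral_mono) (auto intro: norm_triangle_sub simp: norm_minus_commute[of "z _"])
      then show ?thesis using z v by simp
    qed
    \<comment> \<open>At each character one factor has no coefficient: \<open>s\<close> off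
      \<Lambda>, and \<open>v\<close>, at the inverse, on \<Lambda>.\<close>
    have sv: "(LINT x|m. s x * v x) = 0"
    proof (rule integral_product_eq_0[OF sc v(1)])
      fix \<gamma> :: "'g \<Rightarrow> complex" assume "\<gamma> \<in> dual_group"
      then show "fourier_coeff m s \<gamma> = 0 \<or> fourier_coeff m v (\<lambda>x. cnj (\<gamma> x)) = 0"
        using s v(2)[of \<gamma>] by (cases "\<gamma> \<in> \<Lambda>") (auto simp: C_spectral_def fourier_coeff_def)
    qed
    have M0: "0 \<le> M" using order_trans[OF norm_ge_zero M] .
    have hv: "Re (LINT x|m. ?h x * v x) \<le> M * (1 + \<delta>)"
    proof -
      have "(LINT x|m. (?h x + s x) * v x) = (LINT x|m. ?h x * v x) + (LINT x|m. s x * v x)"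
        using integrable_continuous_mult[OF h v(1)] integrable_continuous_mult[OF sc v(1)] by (simp add: distrib_right)
      then have "Re (LINT x|m. ?h x * v x) \<le> cmod (LINT x|m. (?h x + s x) * v x)"
        unfolding sv using complex_Re_le_cmod[of "LINT x|m. ?h x * v x"] by simp
      also have "\<dots> \<le> M * (LINT x|m. cmod (v x))"
        by (rule integral_bounded_mult_le[OF measurable_continuous[OF continuous_on_add[OF h sc]] M v(1)])
      also have "\<dots> \<le> M * (1 + \<delta>)" using vi M0 by (rule mult_left_mono)
      finally show ?thesis .
    qed
    have \<Phi>y: "cmod (\<Phi> y) \<le> K" using C_functional_bound[OF \<Phi> y(1,2)] by simp
    have h_le: "cmod (?h x) \<le> 1 + 2 * K" for x
    proof -
      have "cmod (\<Phi> y) * cmod (e x) \<le> K * 2" using \<Phi>y e(2)[of x] \<delta>(2) K by (intro mult_mono) auto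
      then show ?thesis using norm_triangle_ineq[of "y x" "\<Phi> y * e x"] y(2)[of x] by (simp add: norm_mult)
    qed
    have hzv: "Re (LINT x|m. ?h x * z x) - Re (LINT x|m. ?h x * v x) \<le> (1 + 2 * K) * \<delta>"
    proof -
      have "(LINT x|m. ?h x * z x) - (LINT x|m. ?h x * v x) = (LINT x|m. ?h x * (z x - v x))"
        using integrable_continuous_mult[OF h v(1)] integrable_continuous_mult[OF h z(1)] by (simp add: right_diff_distrib)
      then have "Re (LINT x|m. ?h x * z x) - Re (LINT x|m. ?h x * v x) \<le> cmod (LINT x|m. ?h x * (z x - v x))"
        using complex_Re_le_cmod by (metis minus_complex.sel(1))
      also have "\<dots> \<le> (1 + 2 * K) * (LINT x|m. cmod (z x - v x))"
        using z v by (intro integral_bounded_mult_le measurable_continuous h h_le) auto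
      also have "\<dots> \<le> (1 + 2 * K) * \<delta>" using v(3) K by (intro mult_left_mono) auto
      finally show ?thesis .
    qed
    let ?ez = "LINT x|m. e x * z x"
    have hz: "1 - \<delta>1 + r * (1 - \<delta>) - 2 * \<delta>1 \<le> Re (LINT x|m. ?h x * z x)"
    proof -
      have "(LINT x|m. ?h x * z x) = (LINT x|m. y x * z x + \<Phi> y * (e x * z x))"
        by (simp add: distrib_right mult.assoc)
      also have "\<dots> = (LINT x|m. y x * z x) + \<Phi> y * ?ez"
        using integrable_continuous_mult[OF y(1) z(1)] integrable_continuous_mult[OF e(1) z(1)] by simp
      finally have split: "Re (LINT x|m. ?h x * z x) = Re (LINT x|m. y x * z x) + Re (\<Phi> y * ?ez)"
        by (simp only: plus_complex.sel)
      have "cmod ?ez \<le> 2"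
        using integral_bounded_mult_le[OF measurable_continuous[OF e(1)] e(2) z(1)] z(2) \<delta>(2) by simp
      then have "cmod ((of_real r - \<Phi> y) * ?ez) \<le> \<delta>1 * 2"
        unfolding norm_mult using y(3) \<delta>1(1) by (intro mult_mono) (auto simp: norm_minus_commute)
      then have "Re ((of_real r - \<Phi> y) * ?ez) \<le> \<delta>1 * 2"
        using complex_Re_le_cmod[of "(of_real r - \<Phi> y) * ?ez"] by linarith
      moreover have "Re ((of_real r - \<Phi> y) * ?ez) = r * Re ?ez - Re (\<Phi> y * ?ez)"
        by (simp add: left_diff_distrib)
      moreover have "r * (1 - \<delta>) \<le> r * Re ?ez" using z(3) y0(4) by (rule mult_left_mono)
      ultimately show ?thesis using split y(4) by linarith
    qed
    have main: "1 + r - (\<delta>1 * 3 + r * \<delta> + (1 + 2 * K) * \<delta>) \<le> M + M * \<delta>"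
      using hv hzv hz by (simp add: algebra_simps)
    have bounds: "r * \<delta> \<le> K * \<delta>1" "(1 + 2 * K) * \<delta> \<le> (1 + 2 * K) * \<delta>1"
      using rK \<delta> K y0(4) by (auto intro!: mult_mono)
    \<comment> \<open>The error contains \<open>M * \<delta>\<close>, so a large \<open>M\<close>,
      for which the claim is trivial, is set aside.\<close>
    show "1 + r - \<epsilon> \<le> M"
    proof (cases "1 + r \<le> M")
      case True
      then show ?thesis using \<epsilon> by simp
    next
      case False
      then have "M * \<delta> \<le> (1 + K) * \<delta>1" using rK \<delta> K M0 by (intro mult_mono) auto
      have arith: "1 + r - \<epsilon> \<le> M" if "b \<le> \<delta>1 + p" "0 \<le> p" "1 + r - (\<delta>1 * 3 + a + c) \<le> M + b"
        "a \<le> p" "c \<le> \<delta>1 + 2 * p" "8 * \<delta>1 + 8 * p \<le> \<epsilon>" for a b c p :: real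
        using that \<delta>1(1) by linarith
      show ?thesis
        by (rule arith[OF _ _ main, of "K * \<delta>1"])
          (use \<open>M * \<delta> \<le> _\<close> bounds \<delta>1(1,3) K in \<open>simp_all add: algebra_simps\<close>)
    qed
  qed
qed

end

theorem theorem6p2:
  fixes m :: "'g::{topological_ab_group_add, t2_space} measure"
    and \<Lambda> :: "('g \<Rightarrow> complex) set"
  assumes "compact (UNIV :: 'g set)"
    and "infinite (UNIV :: 'g set)"
    and "normalized_haar_measure m"
    and "\<Lambda> \<subseteq> dual_group"
    and "rich (L1_space m) (L1_spectral m (dual_group - inverse_characters \<Lambda>))"
  shows "daugavet_property (quotient_space C_space (C_spectral m \<Lambda>))"
proof -
  interpret compact_haar m by standard (rule assms)+
  let ?S = "C_spectral m \<Lambda>"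
  interpret C: complex_banach_space "C_space :: ('g \<Rightarrow> complex) normed_struct"
    by (rule C_space_complex_banach_space[OF assms(1)])
  interpret normed_quotient C_space ?S
    by standard (rule closed_subspace_C_spectral)
  have banach: "complex_banach_space Q"
    by (rule quotient_complex_banach_space[OF C.complex_banach_space_axioms closed])
  then interpret Q: complex_banach_space Q .
  note upper = C_norm_upper[OF assms(1)]
  show ?thesis
  proof (rule daugavet_propertyI[OF banach])
    fix \<phi> E X0 and \<epsilon> :: real
    assume \<phi>: "bounded_operator Q scalar_space \<phi>" and E: "E \<in> carrier Q" "vnorm Q E = 1"
      and X0: "X0 \<in> carrier Q" "vnorm Q X0 \<le> 1" and \<epsilon>: "0 < \<epsilon>"
    have \<phi>_add: "\<phi> (A \<oplus>\<^bsub>Q\<^esub> B) = \<phi> A + \<phi> B" and \<phi>_scale: "\<phi> (c \<odot>\<^bsub>Q\<^esub> A) = c * \<phi> A"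
      if "A \<in> carrier Q" "B \<in> carrier Q" for A B c
      using \<phi> that unfolding bounded_operator_def by (auto simp: scalar_space_def)
    obtain K0 where K0: "\<forall>A\<in>carrier Q. cmod (\<phi> A) \<le> K0 * vnorm Q A"
      using \<phi> unfolding bounded_operator_def by (auto simp: scalar_space_def)
    define K where "K = max 0 K0"
    have K: "0 \<le> K" "cmod (\<phi> A) \<le> K * vnorm Q A" if "A \<in> carrier Q" for A
      using bspec[OF K0 that] mult_right_mono[of K0 K "vnorm Q A"] Q.norm_nonneg[OF that] by (auto simp: K_def)
    define \<Phi> where "\<Phi> f = \<phi> (cs f)" for f
    have csC: "cs f \<in> carrier Q" if "cont f" for f using that by (intro coset_closed) (simp add: C_space_sel(1))
    have \<Phi>: "C_functional \<Phi> K"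
      unfolding C_functional_def
    proof (intro conjI allI impI)
      show "0 \<le> K" using K(1)[OF E(1)] .
      fix f :: "'g \<Rightarrow> complex" assume f: "cont f"
      then have fX: "f \<in> carrier C_space" by (simp add: C_space_sel(1))
      show "\<Phi> (\<lambda>x. c * f x) = c * \<Phi> f" for c
        using coset_scale[OF fX, of c] \<phi>_scale[OF csC[OF f] csC[OF f], of c] by (simp add: \<Phi>_def C_space_sel(4))
      show "\<Phi> (\<lambda>x. f x + g x) = \<Phi> f + \<Phi> g" if g: "cont g" for g
        using coset_add[OF fX, of g] \<phi>_add[OF csC[OF f] csC[OF g]] g by (simp add: \<Phi>_def C_space_sel(1,2))
      show "cmod (\<Phi> f) \<le> K * M" if "\<forall>x. cmod (f x) \<le> M" for M
      proof -
        have "vnorm Q (cs f) \<le> M"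
          using quotient_norm_le_norm[OF fX] C_norm_least[of f M] that by (meson order_trans)
        then show ?thesis using K[OF csC[OF f]] mult_left_mono[of "vnorm Q (cs f)" M K] by (simp add: \<Phi>_def)
      qed
    qed
    obtain e0 where e0: "cont e0" "E = cs e0" using E(1) by (auto simp: quotient_sel(1) C_space_sel(1))
    then have e0X: "e0 \<in> carrier C_space" by (simp add: C_space_sel(1))
    obtain x0 where x0: "cont x0" "X0 = cs x0" using X0(1) by (auto simp: quotient_sel(1) C_space_sel(1))
    \<comment> \<open>The closed unit ball of the quotient need not be the image of that of
      \<open>C_space\<close>. Scaling a representative of norm below \<open>1 / q\<close> by
      \<open>q\<close> costs \<open>K * (1 - q) \<le> \<epsilon> / 2\<close>; \<open>K + 1\<close>
      allows \<open>K = 0\<close>.\<close>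
    define q where "q = 1 / (1 + \<epsilon> / (2 * (K + 1)))"
    have q: "0 < q" "q < 1" "K * (1 - q) \<le> \<epsilon> / 2"
    proof -
      define a where "a = \<epsilon> / (2 * (K + 1))"
      have a: "0 < a" "K * a \<le> \<epsilon> / 2" using \<epsilon> K(1)[OF E(1)] by (auto simp: a_def field_simps)
      have qa: "q = 1 / (1 + a)" by (simp add: q_def a_def)
      show "0 < q" "q < 1" using a by (auto simp: qa)
      have "1 - q \<le> a" using a by (simp add: qa field_simps)
      then have "K * (1 - q) \<le> K * a" using K(1)[OF E(1)] by (rule mult_left_mono)
      then show "K * (1 - q) \<le> \<epsilon> / 2" using a by simp
    qed
    have x0X: "x0 \<in> carrier C_space" using x0 by (simp add: C_space_sel(1))
    have "1 < 1 / q" using q by simp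
    then have "vnorm Q (cs x0) < 1 / q" using X0(2) x0 by simp
    then obtain s0 where s0: "s0 \<in> ?S" "vnorm C_space (\<lambda>x. x0 x + s0 x) < 1 / q"
      using quotient_norm_less[OF x0X] unfolding C_space_sel(2) by metis
    have x0s0: "cont (\<lambda>x. x0 x + s0 x)" using x0 C_spectral_cont[OF s0(1)] by (intro continuous_intros)
    have x0s0_le: "cmod (x0 x + s0 x) \<le> 1 / q" for x
      using upper[OF x0s0, of x] s0(2) by simp
    have \<Phi>x0: "\<Phi> (\<lambda>x. x0 x + s0 x) = \<phi> X0"
      using coset_add_subspace[OF x0X s0(1)] x0 by (simp add: \<Phi>_def C_space_sel(2))
    \<comment> \<open>A phase that makes \<open>\<Phi> y0\<close> real and nonnegative.\<close>
    define \<sigma> where "\<sigma> = cnj (sgn (\<phi> X0))"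
    define y0 where "y0 x = (\<sigma> * of_real q) * (x0 x + s0 x)" for x
    define r where "r = q * cmod (\<phi> X0)"
    have y0: "cont y0" unfolding y0_def by (intro continuous_intros x0s0)
    have y0_le: "cmod (y0 x) \<le> 1" for x
    proof -
      have "cmod (y0 x) = cmod \<sigma> * (q * cmod (x0 x + s0 x))" using q by (simp add: y0_def norm_mult)
      also have "\<dots> \<le> 1 * (q * (1 / q))"
        using q x0s0_le[of x] by (intro mult_mono mult_left_mono) (auto simp: \<sigma>_def norm_sgn)
      finally show ?thesis using q by simp
    qed
    have \<Phi>y0: "\<Phi> y0 = of_real r"
      unfolding y0_def C_functional_scale[OF \<Phi> x0s0] \<Phi>x0 using cnj_sgn_mult[of "\<phi> X0"]
      by (simp add: \<sigma>_def r_def mult.commute mult.left_commute)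
    have r0: "0 \<le> r" using q by (simp add: r_def)
    have r: "cmod (\<phi> X0) - \<epsilon> / 2 \<le> r"
    proof -
      have "cmod (\<phi> X0) \<le> K * 1" using K[OF X0(1)] X0(2) by (meson mult_left_mono order_trans)
      then have "(1 - q) * cmod (\<phi> X0) \<le> (1 - q) * K" using q by (intro mult_left_mono) auto
      then show ?thesis using q(3) by (simp add: r_def algebra_simps)
    qed
    obtain y s1 where y: "cont y" "\<And>x. cmod (y x) \<le> 1" and s1: "s1 \<in> ?S"
      and ge: "\<And>s M. s \<in> ?S \<Longrightarrow> (\<And>x. cmod (y x + \<Phi> y * (e0 x + s1 x) + s x) \<le> M) \<Longrightarrow> 1 + r - \<epsilon> / 2 \<le> M"
    proof (rule daugavet_pair[OF assms(5,4) \<Phi> y0 y0_le \<Phi>y0 r0 half_gt_zero[OF \<epsilon>] e0(1)])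
      fix s M assume s: "s \<in> ?S" and M: "\<And>x. cmod (e0 x - s x) \<le> M"
      have "1 \<le> vnorm C_space (\<lambda>x. e0 x + (-1) * s x)"
        using quotient_norm_le[OF e0X C_spectral_scale[OF s, of "-1"]] E(2) e0(2) by (simp add: C_space_sel(2))
      also have "\<dots> \<le> M" using M by (intro C_norm_least) simp
      finally show "1 \<le> M" .
    next
      fix r' :: real assume "1 < r'"
      then obtain s where s: "s \<in> ?S" "vnorm C_space (\<lambda>x. e0 x + s x) < r'"
        using quotient_norm_less[OF e0X, of r'] E(2) e0(2) unfolding C_space_sel(2) by metis
      have "cont (\<lambda>x. e0 x + s x)" using e0 C_spectral_cont[OF s(1)] by (intro continuous_intros)
      then have "\<forall>x. cmod (e0 x + s x) \<le> r'" using upper s(2) by (meson less_imp_le order_trans)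
      then show "\<exists>s\<in>?S. \<forall>x. cmod (e0 x + s x) \<le> r'" using s(1) by blast
    next
      fix y e
      assume y: "cont y" "\<And>x. cmod (y x) \<le> 1" and e: "e \<in> {\<lambda>x. e0 x + s x | s. s \<in> ?S}"
        and ge: "\<And>s M. s \<in> ?S \<Longrightarrow> (\<And>x. cmod (y x + \<Phi> y * e x + s x) \<le> M) \<Longrightarrow> 1 + r - \<epsilon> / 2 \<le> M"
      obtain s where s: "s \<in> ?S" "e = (\<lambda>x. e0 x + s x)" using e by blast
      show thesis by (rule that[OF y s(1)]) (rule ge[unfolded s(2)])
    qed
    let ?e = "\<lambda>x. e0 x + s1 x" and ?h = "\<lambda>x. y x + \<Phi> y * (e0 x + s1 x)"
    have e: "cont ?e" using e0 C_spectral_cont[OF s1] by (intro continuous_intros)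
    have h: "cont ?h" by (intro continuous_intros y e)
    have X: "y \<in> carrier C_space" "?e \<in> carrier C_space" "?h \<in> carrier C_space"
      using y e h by (simp_all add: C_space_sel(1))
    have eE: "cs ?e = E" using coset_add_subspace[OF e0X s1] e0(2) by (simp add: C_space_sel(2))
    have sum: "cs y \<oplus>\<^bsub>Q\<^esub> (\<phi> (cs y) \<odot>\<^bsub>Q\<^esub> E) = cs ?h"
      using coset_scale[OF X(2), of "\<Phi> y"] coset_add[OF X(1) C.scale_closed[OF X(2)], of "\<Phi> y"]
      by (simp add: eE \<Phi>_def C_space_sel(2,4))
    show "\<exists>x\<in>carrier Q. vnorm Q x \<le> 1 \<and> 1 + cmod (\<phi> X0) - \<epsilon> \<le> vnorm Q (x \<oplus>\<^bsub>Q\<^esub> (\<phi> x \<odot>\<^bsub>Q\<^esub> E))"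
    proof (intro bexI[of _ "cs y"] conjI)
      show "vnorm Q (cs y) \<le> 1"
        using quotient_norm_le_norm[OF X(1)] C_norm_least[of y 1] y(2) by (meson order_trans)
      show "1 + cmod (\<phi> X0) - \<epsilon> \<le> vnorm Q (cs y \<oplus>\<^bsub>Q\<^esub> (\<phi> (cs y) \<odot>\<^bsub>Q\<^esub> E))"
        unfolding sum
      proof (rule quotient_norm_greatest[OF X(3)])
        fix s assume s: "s \<in> ?S"
        have c: "cont (\<lambda>x. ?h x + s x)" using h C_spectral_cont[OF s] by (rule continuous_on_add)
        have "1 + r - \<epsilon> / 2 \<le> vnorm C_space (\<lambda>x. ?h x + s x)"
          by (rule ge[OF s]) (rule upper[OF c])
        then show "1 + cmod (\<phi> X0) - \<epsilon> \<le> vnorm C_space (?h \<oplus>\<^bsub>C_space\<^esub> s)"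
          using r by (simp add: C_space_sel(2))
      qed
    qed (rule csC[OF y(1)])
  qed
qed

end
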